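(* Suppose that $\theta<\varkappa\le\kappa$ are infinite regular cardinals, $I$ is an ideal over $\kappa$ that is not weakly $\kappa$-saturated, and $S\subseteq\kappa$ is stationary. (1) For every $\theta^+$-complete ideal $J$ over $\kappa$ extending $J^{\mathrm{bd}}[\kappa]$, if $\mathrm{ubd}^+(J^+,J,\varkappa)$ holds, then so does $\mathrm{onto}^{++}(I^*,J,\theta)$. (2) If $\mathrm{ubd}(\mathrm{NS}_\kappa\restriction S,\kappa)$ holds, then for every normal ideal $J$ over $S$ extending $J^{\mathrm{bd}}[S]$, $\mathrm{onto}^{++}(J^*,J,\theta)$ holds.
   Context: For an ideal $J$: $J^+$ positive sets, $J^*$ dual filter. $J^{\mathrm{bd}}[X]$ is the ideal of bounded subsets of $X$; $\mathrm{NS}_\kappa\restriction S:=\mathrm{NS}_\kappa\cap\mathcal P(S)$; an ideal over $S$ is identified with the ideal over $\kappa$ it generates together with $\mathcal P(\kappa\setminus S)$. $J$ is normal if for every $\langle E_\eta\mid\eta<\kappa\rangle$ from $J^*$, $\{\beta<\kappa\mid\beta\in\bigcap_{\eta<\beta}E_\eta\}\in J^*$. $I$ is weakly $\kappa$-saturated if for every sequence $\langle B_i\mid i<\kappa\rangle$ of $I^+$-sets there are $i\neq j$ with $B_i\cap B_j\neq\emptyset$. Colourings are on pairs $\alpha<\beta<\kappa$; upper-regressive means $c(\alpha,\beta)<\beta$; $\{\eta\}\circledast B:=\{(\eta,\beta)\mid\beta\in B,\eta<\beta\}$. $\mathrm{ubd}(J,\theta)$: there is an upper-regressive $c:[\kappa]^2\to\theta$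 such that for every $B\in J^+$ some $\eta<\kappa$ has $\mathrm{otp}(c[\{\eta\}\circledast B])=\theta$. For $\mathcal A\subseteq\mathcal P(\kappa)$: $\mathrm{ubd}^+(\mathcal A,J,\theta)$ asserts an upper-regressive $c:[\kappa]^2\to\theta$ such that for all $A\in\mathcal A$, $B\in J^+$ there is $\eta\in A$ with $\mathrm{otp}(\{\tau<\theta\mid\{\beta\in B\setminus(\eta+1)\mid c(\eta,\beta)=\tau\}\in J^+\})=\theta$. $\mathrm{onto}^{++}(\mathcal A,J,\theta)$ asserts a colouring $c:[\kappa]^2\to\theta$ such that for every $A\in\mathcal A$ and every sequence $\langle B_\tau\mid\tau<\theta\rangle$ of $J^+$-sets there is $\eta\in A$ with $\{\beta\in B_\tau\setminus(\eta+1)\mid c(\eta,\beta)=\tau\}\in J^+$ for every $\tau<\theta$. *)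

theory Defs
  imports Main
begin

unbundle cardinal_syntax

text \<open>
  Ordinals are elements of an arbitrary well-ordered type: \<open>\<kappa>\<close> stands for the ordinal
  \<open>{..<\<kappa>}\<close>, so that \<open>\<theta> < \<kappa>\<close> and \<open>c \<alpha> \<beta> < \<beta>\<close> are the usual comparisons of ordinals.
  A colouring of \<open>[\<kappa>]\<^sup>2\<close> is a binary function of which only the values \<open>c \<alpha> \<beta>\<close> with
  \<open>\<alpha> < \<beta> < \<kappa>\<close> matter.
\<close>

definition le_on :: "'a::wellorder set \<Rightarrow> 'a rel" where
  "le_on X = {(x, y). x \<in> X \<and> y \<in> X \<and> x \<le> y}"

definition infinite_regular_cardinal :: "'a::wellorder \<Rightarrow> bool" where
  "infinite_regular_cardinal \<kappa> \<longleftrightarrow>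
     Card_order (le_on {..<\<kappa>}) \<and> infinite {..<\<kappa>} \<and> regularCard (le_on {..<\<kappa>})"

text \<open>\<open>otp(X) = \<theta>\<close>\<close>

definition has_otp :: "'a::wellorder set \<Rightarrow> 'a \<Rightarrow> bool" where
  "has_otp X \<theta> \<longleftrightarrow> le_on X =o le_on {..<\<theta>}"

text \<open>
  Ideals are not required to be proper; the improper ideal is weakly saturated and has no
  positive sets.
\<close>

definition ideal_over :: "'a set \<Rightarrow> 'a set set \<Rightarrow> bool" where
  "ideal_over X J \<longleftrightarrow> J \<subseteq> Pow X \<and> {} \<in> J \<and>
     (\<forall>A\<in>J. \<forall>B. B \<subseteq> A \<longrightarrow> B \<in> J) \<and> (\<forall>A\<in>J. \<forall>B\<in>J. A \<union> B \<in> J)"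

definition positive :: "'a::wellorder \<Rightarrow> 'a set set \<Rightarrow> 'a set set" where
  "positive \<kappa> J = Pow {..<\<kappa>} - J"

definition dual_filter :: "'a::wellorder \<Rightarrow> 'a set set \<Rightarrow> 'a set set" where
  "dual_filter \<kappa> J = {{..<\<kappa>} - A | A. A \<in> J}"

text \<open>
  For an ideal \<open>J\<close> over \<open>S \<subseteq> \<kappa>\<close>, the ideal over \<open>\<kappa>\<close> generated by \<open>J\<close> together with the
  power set of \<open>\<kappa> - S\<close>.
\<close>

definition ideal_lift :: "'a::wellorder \<Rightarrow> 'a set \<Rightarrow> 'a set set \<Rightarrow> 'a set set" where
  "ideal_lift \<kappa> S J = {A \<union> B | A B. A \<in> J \<and> B \<subseteq> {..<\<kappa>} - S}"

definition bounded_ideal :: "'a::wellorder set \<Rightarrow> 'a set set" where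
  "bounded_ideal X = {A. A \<subseteq> X \<and> (\<exists>\<gamma>\<in>X. \<forall>\<alpha>\<in>A. \<alpha> < \<gamma>)}"

text \<open>\<open>\<mu>\<close> is a cardinal, given as a cardinal order relation.\<close>

definition complete_ideal :: "'b rel \<Rightarrow> 'a set set \<Rightarrow> bool" where
  "complete_ideal \<mu> J \<longleftrightarrow> (\<forall>F. F \<subseteq> J \<and> |F| <o \<mu> \<longrightarrow> \<Union>F \<in> J)"

definition normal_ideal :: "'a::wellorder \<Rightarrow> 'a set set \<Rightarrow> bool" where
  "normal_ideal \<kappa> J \<longleftrightarrow>
     (\<forall>E. (\<forall>\<eta><\<kappa>. E \<eta> \<in> dual_filter \<kappa> J) \<longrightarrow>
        {\<beta>. \<beta> < \<kappa> \<and> (\<forall>\<eta><\<beta>. \<beta> \<in> E \<eta>)} \<in> dual_filter \<kappa> J)"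

definition weakly_saturated :: "'a::wellorder \<Rightarrow> 'a set set \<Rightarrow> bool" where
  "weakly_saturated \<kappa> I \<longleftrightarrow>
     (\<forall>B. (\<forall>i<\<kappa>. B i \<in> positive \<kappa> I) \<longrightarrow>
        (\<exists>i<\<kappa>. \<exists>j<\<kappa>. i \<noteq> j \<and> B i \<inter> B j \<noteq> {}))"

text \<open>
  The premises of the closure condition say that \<open>\<delta>\<close> is a limit ordinal with
  \<open>sup(C \<inter> \<delta>) = \<delta>\<close>.
\<close>

definition club :: "'a::wellorder \<Rightarrow> 'a set \<Rightarrow> bool" where
  "club \<kappa> C \<longleftrightarrow> C \<subseteq> {..<\<kappa>} \<and> (\<forall>\<alpha><\<kappa>. \<exists>\<gamma>\<in>C. \<alpha> < \<gamma>) \<and>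
     (\<forall>\<delta><\<kappa>. {..<\<delta>} \<noteq> {} \<and> (\<forall>\<alpha><\<delta>. \<exists>\<gamma>\<in>C. \<alpha> < \<gamma> \<and> \<gamma> < \<delta>) \<longrightarrow> \<delta> \<in> C)"

definition stationary :: "'a::wellorder \<Rightarrow> 'a set \<Rightarrow> bool" where
  "stationary \<kappa> S \<longleftrightarrow> S \<subseteq> {..<\<kappa>} \<and> (\<forall>C. club \<kappa> C \<longrightarrow> S \<inter> C \<noteq> {})"

definition NS :: "'a::wellorder \<Rightarrow> 'a set set" where
  "NS \<kappa> = {A. A \<subseteq> {..<\<kappa>} \<and> \<not> stationary \<kappa> A}"

definition colouring :: "'a::wellorder \<Rightarrow> 'a \<Rightarrow> ('a \<Rightarrow> 'a \<Rightarrow> 'a) \<Rightarrow> bool" where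
  "colouring \<kappa> \<theta> c \<longleftrightarrow> (\<forall>\<alpha> \<beta>. \<alpha> < \<beta> \<and> \<beta> < \<kappa> \<longrightarrow> c \<alpha> \<beta> < \<theta>)"

definition upper_regressive :: "'a::wellorder \<Rightarrow> ('a \<Rightarrow> 'a \<Rightarrow> 'a) \<Rightarrow> bool" where
  "upper_regressive \<kappa> c \<longleftrightarrow> (\<forall>\<alpha> \<beta>. \<alpha> < \<beta> \<and> \<beta> < \<kappa> \<longrightarrow> c \<alpha> \<beta> < \<beta>)"

definition ubd :: "'a::wellorder \<Rightarrow> 'a set set \<Rightarrow> 'a \<Rightarrow> bool" where
  "ubd \<kappa> J \<theta> \<longleftrightarrow>
     (\<exists>c. colouring \<kappa> \<theta> c \<and> upper_regressive \<kappa> c \<and>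
        (\<forall>B\<in>positive \<kappa> J. \<exists>\<eta><\<kappa>. has_otp {c \<eta> \<beta> | \<beta>. \<beta> \<in> B \<and> \<eta> < \<beta>} \<theta>))"

definition ubd_plus :: "'a::wellorder \<Rightarrow> 'a set set \<Rightarrow> 'a set set \<Rightarrow> 'a \<Rightarrow> bool" where
  "ubd_plus \<kappa> \<A> J \<theta> \<longleftrightarrow>
     (\<exists>c. colouring \<kappa> \<theta> c \<and> upper_regressive \<kappa> c \<and>
        (\<forall>A\<in>\<A>. \<forall>B\<in>positive \<kappa> J. \<exists>\<eta>\<in>A.
           has_otp {\<tau>. \<tau> < \<theta> \<and> {\<beta>\<in>B. \<eta> < \<beta> \<and> c \<eta> \<beta> = \<tau>} \<in> positive \<kappa> J} \<theta>))"

definition onto_plus_plus :: "'a::wellorder \<Rightarrow> 'a set set \<Rightarrow> 'a set set \<Rightarrow> 'a \<Rightarrow> bool" where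
  "onto_plus_plus \<kappa> \<A> J \<theta> \<longleftrightarrow>
     (\<exists>c. colouring \<kappa> \<theta> c \<and>
        (\<forall>A\<in>\<A>. \<forall>B. (\<forall>\<tau><\<theta>. B \<tau> \<in> positive \<kappa> J) \<longrightarrow>
           (\<exists>\<eta>\<in>A. \<forall>\<tau><\<theta>. {\<beta>\<in>B \<tau>. \<eta> < \<beta> \<and> c \<eta> \<beta> = \<tau>} \<in> positive \<kappa> J)))"

end

theory Submission
  imports Defs
begin

text \<open>
  In both parts a colouring is available for which some \<open>\<eta>\<close> (depending on the sets \<open>B\<^sub>\<tau>\<close>) makes all
  the sets \<open>T\<^sub>\<tau>\<close> of colours taken positively often on \<open>B\<^sub>\<tau>\<close>, \<open>\<tau> < \<theta>\<close>, unbounded in a regular cardinal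
  above \<open>\<theta>\<close>. It remains to find few functions \<open>g\<close> into \<open>\<theta>\<close> such that for all such
  \<open>\<langle>T\<^sub>\<tau> | \<tau> < \<theta>\<rangle>\<close> one of them takes the value \<open>\<tau>\<close> on \<open>T\<^sub>\<tau>\<close> for every \<open>\<tau>\<close>; the indices
  are then spread over disjoint \<open>I\<close>-positive sets, each of which meets every set in the dual filter.

  Cofinal maps reduce the existence of these functions to \<open>\<nu> = \<theta>\<^sup>+\<close>. There one walks from a
  point \<open>b\<close> of \<open>T\<^sub>\<tau>\<close> along a C-sequence. Partition the points of cofinality \<open>\<theta>\<close> into \<open>\<theta>\<close> stationary
  pieces; after a number \<open>n\<^sub>\<tau>\<close> of steps many of these walks pass through the \<open>\<tau>\<close>-th piece. The
  numbers \<open>n\<^sub>\<tau>\<close> are guessed by Moore's oscillation, which for almost every \<open>a\<close> takes, on every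
  unbounded set, all values in arbitrarily long intervals of natural numbers.
\<close>

section \<open>Initial segments of regular cardinals\<close>

text \<open>The disjoint positive sets can code only \<kappa> many functions, while the sets
  T_\<tau> are arbitrary, so the guesses must come from a list fixed in advance, and one of them has
  to be right for all \<tau> at once. Walks alone do not achieve this: the number of steps varies
  with \<tau>, and the sequences of such numbers may be more than \<kappa> many. Oscillation avoids
  listing them, because for each single \<tau> the points a with a wrong guess are bounded in
  \<theta>^+, and \<theta> many bounds there have a common bound. Regularity of \<theta> enters
  through points of cofinality \<theta>: fewer than \<theta> exceptions stay bounded below such a
  point, which makes the functions \<open>rho\<close> cohere there.

  The two statements differ in how one \<eta> is found for all B_\<tau>. In (1) the \<eta> that fail
  for one B_\<tau> form a set in J, and completeness collects them. In (2) \<open>ubd\<close> yields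
  just one \<eta> for each positive set, so the colours are first accumulated until every large
  \<eta> works, after which a supremum suffices. There J also takes the role of I, and its failure
  of weak saturation is derived from the same colouring.\<close>

lemma ex_has_least_wellorder:
  fixes m :: "'b \<Rightarrow> 'a::wellorder"
  assumes "P k"
  shows "\<exists>x. P x \<and> (\<forall>y. P y \<longrightarrow> m x \<le> m y)"
proof -
  have "\<exists>x. P x \<and> m x = (LEAST i. \<exists>x. P x \<and> m x = i)"
    using assms by (intro LeastI_ex[of "\<lambda>i. \<exists>x. P x \<and> m x = i"]) blast
  then show ?thesis by (metis (mono_tags, lifting) Least_le)
qed

lemma Field_le_on: "Field (le_on X) = X"
  by (auto simp: le_on_def Field_def)

lemma underS_le_on: "a \<in> X \<Longrightarrow> underS (le_on X) a = {x \<in> X. x < a}"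
  by (auto simp: le_on_def underS_def)

lemma card_of_initial_segment:
  assumes "infinite_regular_cardinal \<mu>"
  shows "|{..<\<mu>}| =o le_on {..<\<mu>}"
  using card_of_Field_ordIso[of "le_on {..<\<mu>}"] assms
  by (simp add: infinite_regular_cardinal_def Field_le_on)

lemma card_below_less:
  fixes a \<mu> :: "'a::wellorder"
  assumes "infinite_regular_cardinal \<mu>" "a < \<mu>"
  shows "|{..<a}| <o |{..<\<mu>}|"
proof -
  have "|underS (le_on {..<\<mu>}) a| <o le_on {..<\<mu>}"
    using assms by (intro card_of_underS) (auto simp: infinite_regular_cardinal_def Field_le_on)
  moreover have "underS (le_on {..<\<mu>}) a = {..<a}"
    using assms(2) by (auto simp: underS_le_on)
  ultimately show ?thesis
    using card_of_initial_segment[OF assms(1)] ordIso_symmetric ordLess_ordIso_trans by fastforce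
qed

lemma finite_card_less_infinite: "finite A \<Longrightarrow> infinite B \<Longrightarrow> |A| <o |B|"
  by (meson card_of_Well_order card_of_ordLeq_finite not_ordLeq_iff_ordLess)

lemma no_max_below:
  fixes a \<mu> :: "'a::wellorder"
  assumes "infinite_regular_cardinal \<mu>" "a < \<mu>"
  shows "\<exists>b<\<mu>. a < b"
proof (rule ccontr)
  assume "\<not> ?thesis"
  then have eq: "{..<\<mu>} = {a} \<union> {..<a}" using assms(2) by force
  have inf: "infinite {..<\<mu>}" using assms(1) by (simp add: infinite_regular_cardinal_def)
  have "|{a} \<union> {..<a}| <o |{..<\<mu>}|"
    using inf finite_card_less_infinite[OF _ inf, of "{a}"] card_below_less[OF assms]
    by (intro card_of_Un_ordLess_infinite) auto
  then show False using eq ordLess_irreflexive by fastforce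
qed

lemma regular_bounded:
  fixes \<mu> :: "'a::wellorder"
  assumes \<mu>: "infinite_regular_cardinal \<mu>" and X: "X \<subseteq> {..<\<mu>}" "|X| <o |{..<\<mu>}|"
  shows "\<exists>b<\<mu>. \<forall>x\<in>X. x < b"
proof (rule ccontr)
  assume neg: "\<not> ?thesis"
  have "cofinal X (le_on {..<\<mu>})"
    unfolding cofinal_def Field_le_on
  proof
    fix a assume "a \<in> {..<\<mu>}"
    then obtain b where b: "b < \<mu>" "a < b" using no_max_below[OF \<mu>, of a] by auto
    then obtain x where "x \<in> X" "b \<le> x" using neg by (meson not_less)
    then show "\<exists>b\<in>X. a \<noteq> b \<and> (a, b) \<in> le_on {..<\<mu>}"
      using b X(1) by (intro bexI[of _ x]) (auto simp: le_on_def)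
  qed
  then have "|X| =o le_on {..<\<mu>}"
    using \<mu> X(1) by (auto simp: infinite_regular_cardinal_def regularCard_def Field_le_on)
  then show False
    using X(2) card_of_initial_segment[OF \<mu>] not_ordLess_ordIso ordIso_symmetric ordIso_transitive
    by blast
qed

lemma le_card_unbounded:
  fixes \<mu> :: "'a::wellorder"
  assumes \<mu>: "infinite_regular_cardinal \<mu>" and X: "|X| =o |{..<\<mu>}|" and a: "a < \<mu>"
  shows "\<exists>x\<in>X. a < x"
proof (rule ccontr)
  assume "\<not> ?thesis"
  then have "X \<subseteq> {..a}" by (auto simp: not_less)
  obtain b where b: "b < \<mu>" "a < b" using no_max_below[OF \<mu> a] by auto
  with \<open>X \<subseteq> {..a}\<close> have "X \<subseteq> {..<b}" by auto
  then have "|X| \<le>o |{..<b}|" by (rule card_of_mono1)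
  then show False using card_below_less[OF \<mu> b(1)] X
    by (meson not_ordLess_ordIso ordLeq_ordLess_trans)
qed

text \<open>Order types are used only through this lemma: the bijection underlying the isomorphism
  gives X the cardinality of \<mu>, which no subset of a proper initial segment can have.\<close>

lemma has_otp_unbounded:
  fixes \<mu> :: "'a::wellorder"
  assumes \<mu>: "infinite_regular_cardinal \<mu>" and X: "has_otp X \<mu>" and a: "a < \<mu>"
  shows "\<exists>x\<in>X. a < x"
proof (rule le_card_unbounded[OF \<mu> _ a])
  obtain f where "iso (le_on X) (le_on {..<\<mu>}) f"
    using X by (auto simp: has_otp_def ordIso_def)
  then have "bij_betw f X {..<\<mu>}" by (simp add: iso_def Field_le_on)
  then show "|X| =o |{..<\<mu>}|" using card_of_ordIso by blast
qed

section \<open>The successor of a regular cardinal\<close>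

text \<open>\<theta>^+ is realised as an element of the type itself, so that ordinals below it need
  no conversion. It exists in the type as soon as some cardinal above \<theta> does, which is what
  \<theta> < \<mu> provides.\<close>

locale successor_cardinal =
  fixes \<theta> \<nu> :: "'a::wellorder"
  assumes regular_\<theta>: "infinite_regular_cardinal \<theta>"
    and \<nu>_eq: "\<nu> = (LEAST v. \<not> |{..<v}| \<le>o |{..<\<theta>}| )"
    and \<nu>_ex: "\<exists>v. \<not> |{..<v::'a}| \<le>o |{..<\<theta>}|"
begin

text \<open>Two thresholds for two kinds of boundedness: small sets are bounded below \<theta> and
  below each point of cofinality \<theta>, moderate sets are bounded below \<nu>.\<close>

definition small :: "'b set \<Rightarrow> bool" where "small X \<longleftrightarrow> |X| <o |{..<\<theta>}|"
definition moderate :: "'b set \<Rightarrow> bool" where "moderate X \<longleftrightarrow> |X| \<le>o |{..<\<theta>}|"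
definition unbounded :: "'a set \<Rightarrow> bool" where
  "unbounded X \<longleftrightarrow> X \<subseteq> {..<\<nu>} \<and> (\<forall>\<gamma><\<nu>. \<exists>x\<in>X. \<gamma> < x)"

lemma infinite_\<theta>: "infinite {..<\<theta>}"
  using regular_\<theta> by (simp add: infinite_regular_cardinal_def)

lemma Cinfinite_\<theta>: "Cinfinite |{..<\<theta>}|"
  using infinite_\<theta> card_of_Card_order[of "{..<\<theta>}"] Field_card_of[of "{..<\<theta>}"]
  unfolding cinfinite_def by auto

lemma regularCard_\<theta>: "regularCard |{..<\<theta>}|"
proof (rule regularCard_ordIso)
  show "le_on {..<\<theta>} =o |{..<\<theta>}|"
    using card_of_initial_segment[OF regular_\<theta>] ordIso_symmetric by blast
  show "Cinfinite (le_on {..<\<theta>})" "regularCard (le_on {..<\<theta>})"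
    using regular_\<theta> by (auto simp: infinite_regular_cardinal_def cinfinite_def Field_le_on)
qed

lemma small_moderate: "small X \<Longrightarrow> moderate X"
  by (simp add: small_def moderate_def ordLess_imp_ordLeq)

lemma finite_small: "finite X \<Longrightarrow> small X"
  unfolding small_def using infinite_\<theta> by (rule finite_card_less_infinite[rotated])

lemma small_mono: "small Y \<Longrightarrow> X \<subseteq> Y \<Longrightarrow> small X"
  unfolding small_def by (meson card_of_mono1 ordLeq_ordLess_trans)

lemma moderate_mono: "moderate Y \<Longrightarrow> X \<subseteq> Y \<Longrightarrow> moderate X"
  unfolding moderate_def by (meson card_of_mono1 ordLeq_transitive)

lemma small_image: "small X \<Longrightarrow> small (f ` X)"
  unfolding small_def by (meson card_of_image ordLeq_ordLess_trans)

lemma moderate_image: "moderate X \<Longrightarrow> moderate (f ` X)"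
  unfolding moderate_def by (meson card_of_image ordLeq_transitive)

lemma small_Un: "small X \<Longrightarrow> small Y \<Longrightarrow> small (X \<union> Y)"
  unfolding small_def using infinite_\<theta> by (rule card_of_Un_ordLess_infinite)

lemma small_UNION:
  assumes "small X" "\<And>x. x \<in> X \<Longrightarrow> small (f x)"
  shows "small (\<Union>x\<in>X. f x)"
  using assms card_of_UNION_ordLess_infinite_Field_regularCard[OF regularCard_\<theta> Cinfinite_\<theta>, of X f]
  unfolding small_def by blast

lemma moderate_UNION: "moderate X \<Longrightarrow> (\<And>x. x \<in> X \<Longrightarrow> moderate (f x)) \<Longrightarrow> moderate (\<Union>x\<in>X. f x)"
  unfolding moderate_def using card_of_UNION_ordLeq_infinite[OF infinite_\<theta>, of X f] by blast

lemma moderate_Times: "moderate X \<Longrightarrow> moderate Y \<Longrightarrow> moderate (X \<times> Y)"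
  unfolding moderate_def using card_of_Sigma_ordLeq_infinite[OF infinite_\<theta>, of X "\<lambda>_. Y"] by blast

lemma moderate_Un: "moderate X \<Longrightarrow> moderate Y \<Longrightarrow> moderate (X \<union> Y)"
  using moderate_UNION[of "{X, Y}" "\<lambda>x. x"] finite_small[of "{X, Y}"] small_moderate by auto

lemma moderate_lists:
  assumes "moderate X" shows "moderate (lists X)"
proof -
  have len: "moderate {xs \<in> lists X. length xs = n}" for n
  proof (induction n)
    case 0
    have "{xs \<in> lists X. length xs = 0} = {[]}" by auto
    then show ?case by (simp add: finite_small small_moderate)
  next
    case (Suc n)
    have "{xs \<in> lists X. length xs = Suc n}
        \<subseteq> (\<lambda>(x, xs). x # xs) ` (X \<times> {xs \<in> lists X. length xs = n})"
      by (auto simp: length_Suc_conv image_iff)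
    moreover have "moderate ((\<lambda>(x, xs). x # xs) ` (X \<times> {xs \<in> lists X. length xs = n}))"
      by (intro moderate_image moderate_Times assms Suc)
    ultimately show ?case using moderate_mono by blast
  qed
  have "moderate (UNIV :: nat set)"
    unfolding moderate_def using infinite_\<theta> infinite_iff_card_of_nat by blast
  then have "moderate (\<Union>n::nat. {xs \<in> lists X. length xs = n})"
    using len by (intro moderate_UNION) auto
  then show ?thesis by (rule moderate_mono) auto
qed

lemma small_below_\<theta>: "i < \<theta> \<Longrightarrow> small {..<i}"
  unfolding small_def by (rule card_below_less[OF regular_\<theta>])

lemma moderate_\<theta>: "moderate {..<\<theta>}"
  unfolding moderate_def using card_of_Well_order ordLeq_reflexive by blast

lemma \<theta>_bound: "X \<subseteq> {..<\<theta>} \<Longrightarrow> small X \<Longrightarrow> \<exists>b<\<theta>. \<forall>x\<in>X. x < b"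
  using regular_bounded[OF regular_\<theta>] by (simp add: small_def)

lemma moderate_below: "\<alpha> < \<nu> \<Longrightarrow> moderate {..<\<alpha>}"
  using not_less_Least \<nu>_eq unfolding moderate_def by blast

lemma not_moderate_\<nu>: "\<not> moderate {..<\<nu>}"
  unfolding moderate_def using LeastI_ex[OF \<nu>_ex] \<nu>_eq by simp

text \<open>Regularity of \<theta>^+: otherwise \<nu> would be a union of at most \<theta> many
  segments of size at most \<theta>.\<close>

lemma \<nu>_bound:
  assumes X: "X \<subseteq> {..<\<nu>}" "moderate X"
  shows "\<exists>b<\<nu>. \<forall>x\<in>X. x < b"
proof (rule ccontr)
  assume neg: "\<not> ?thesis"
  have "moderate (\<Union>x\<in>X. insert x {..<x})"
  proof (rule moderate_UNION[OF X(2)])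
    fix x assume "x \<in> X"
    then have "moderate {..<x}" using X(1) moderate_below by auto
    then show "moderate (insert x {..<x})"
      using moderate_Un[of "{x}" "{..<x}"] finite_small[of "{x}"] small_moderate by auto
  qed
  moreover have "{..<\<nu>} \<subseteq> (\<Union>x\<in>X. insert x {..<x})"
  proof
    fix b assume "b \<in> {..<\<nu>}"
    then obtain x where "x \<in> X" "b \<le> x" using neg by (meson lessThan_iff not_less)
    then show "b \<in> (\<Union>x\<in>X. insert x {..<x})" by (auto simp: le_less)
  qed
  ultimately show False using not_moderate_\<nu> moderate_mono by blast
qed

lemma \<nu>_finite_bound: "finite X \<Longrightarrow> X \<subseteq> {..<\<nu>} \<Longrightarrow> \<exists>b<\<nu>. \<forall>x\<in>X. x < b"
  using \<nu>_bound finite_small small_moderate by blast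

lemma \<nu>_limit: "\<alpha> < \<nu> \<Longrightarrow> \<exists>b<\<nu>. \<alpha> < b"
  using \<nu>_finite_bound[of "{\<alpha>}"] by auto

lemma \<theta>_limit: "\<alpha> < \<theta> \<Longrightarrow> \<exists>b<\<theta>. \<alpha> < b"
  using no_max_below[OF regular_\<theta>] .

lemma moderate_atMost: "\<eta> < \<nu> \<Longrightarrow> moderate {..\<eta>}"
proof -
  assume "\<eta> < \<nu>"
  then obtain b where "b < \<nu>" "\<eta> < b" using \<nu>_limit by auto
  then show "moderate {..\<eta>}" by (intro moderate_mono[OF moderate_below[of b]]) auto
qed

lemma unboundedD: "unbounded X \<Longrightarrow> \<gamma> < \<nu> \<Longrightarrow> \<exists>x\<in>X. \<gamma> < x \<and> x < \<nu>"
  unfolding unbounded_def by blast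

lemma not_unbounded: "X \<subseteq> {..<\<nu>} \<Longrightarrow> \<not> unbounded X \<Longrightarrow> \<exists>b<\<nu>. \<forall>x\<in>X. x < b"
  unfolding unbounded_def using \<nu>_limit by (meson le_less_trans not_less)

lemma unbounded_cases:
  assumes X: "unbounded X" and M: "moderate M" and f: "\<And>x. x \<in> X \<Longrightarrow> f x \<in> M"
  shows "\<exists>m\<in>M. unbounded {x \<in> X. f x = m}"
proof (rule ccontr)
  assume "\<not> ?thesis"
  then have "\<exists>b<\<nu>. \<forall>x\<in>{x \<in> X. f x = m}. x < b" if "m \<in> M" for m
    using that X by (intro not_unbounded) (auto simp: unbounded_def)
  then have "\<forall>m\<in>M. \<exists>b. b < \<nu> \<and> (\<forall>x\<in>X. f x = m \<longrightarrow> x < b)" by blast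
  from bchoice[OF this] obtain b
    where b: "\<And>m. m \<in> M \<Longrightarrow> b m < \<nu> \<and> (\<forall>x\<in>X. f x = m \<longrightarrow> x < b m)" by blast
  then obtain B where "B < \<nu>" "\<forall>x\<in>b ` M. x < B"
    using \<nu>_bound[of "b ` M"] moderate_image[OF M] by auto
  moreover obtain x where "x \<in> X" "B < x" using unboundedD[OF X \<open>B < \<nu>\<close>] by auto
  ultimately show False using b[of "f x"] f[of x] by force
qed

text \<open>These injections serve twice: their records form the C-sequence, and together they are
  an Ulam matrix.\<close>

definition idx :: "'a \<Rightarrow> 'a \<Rightarrow> 'a" where
  "idx \<beta> = (SOME f. inj_on f {..<\<beta>} \<and> f ` {..<\<beta>} \<subseteq> {..<\<theta>})"

lemma idx: assumes "\<beta> < \<nu>" shows "inj_on (idx \<beta>) {..<\<beta>}" "idx \<beta> ` {..<\<beta>} \<subseteq> {..<\<theta>}"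
proof -
  have "\<exists>f. inj_on f {..<\<beta>} \<and> f ` {..<\<beta>} \<subseteq> {..<\<theta>}"
    using moderate_below[OF assms] card_of_ordLeq by (auto simp: moderate_def)
  then have "inj_on (idx \<beta>) {..<\<beta>} \<and> idx \<beta> ` {..<\<beta>} \<subseteq> {..<\<theta>}"
    unfolding idx_def by (rule someI_ex)
  then show "inj_on (idx \<beta>) {..<\<beta>}" "idx \<beta> ` {..<\<beta>} \<subseteq> {..<\<theta>}" by auto
qed

lemma idx_less: "\<beta> < \<nu> \<Longrightarrow> x < \<beta> \<Longrightarrow> idx \<beta> x < \<theta>"
  using idx(2) by blast

text \<open>The records of the enumeration \<open>idx \<beta>\<close>: cofinal in \<open>\<beta>\<close>, with small initial segments. They
  need not be closed, which the walks below do not require.\<close>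

definition Cs :: "'a \<Rightarrow> 'a set" where
  "Cs \<beta> = {x. x < \<beta> \<and> (\<forall>y<\<beta>. idx \<beta> y < idx \<beta> x \<longrightarrow> y < x)}"

lemma Cs_less: "c \<in> Cs \<beta> \<Longrightarrow> c < \<beta>"
  by (simp add: Cs_def)

lemma Cs_cofinal:
  assumes "\<beta> < \<nu>" "\<xi> < \<beta>" shows "\<exists>c\<in>Cs \<beta>. \<xi> \<le> c"
proof -
  \<comment> \<open>Of all points of [\<xi>, \<beta>) take the one of least index. Whatever has a
    smaller index lies below \<xi>, so this point is a record.\<close>
  obtain c where c: "c < \<beta> \<and> \<xi> \<le> c" "\<forall>y. y < \<beta> \<and> \<xi> \<le> y \<longrightarrow> idx \<beta> c \<le> idx \<beta> y"
    using assms(2) ex_has_least_wellorder[of "\<lambda>c. c < \<beta> \<and> \<xi> \<le> c" \<xi> "idx \<beta>"] by blast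
  have "y < c" if "y < \<beta>" "idx \<beta> y < idx \<beta> c" for y
    using c that by (meson leD le_less_linear less_le_trans)
  then have "c \<in> Cs \<beta>" using c(1) by (auto simp: Cs_def)
  then show ?thesis using c by auto
qed

lemma Cs_idx_mono: "\<beta> < \<nu> \<Longrightarrow> x \<in> Cs \<beta> \<Longrightarrow> c \<in> Cs \<beta> \<Longrightarrow> x < c \<Longrightarrow> idx \<beta> x < idx \<beta> c"
proof -
  assume a: "\<beta> < \<nu>" "x \<in> Cs \<beta>" "c \<in> Cs \<beta>" "x < c"
  then have "\<not> idx \<beta> c < idx \<beta> x" by (auto simp: Cs_def)
  moreover have "idx \<beta> c \<noteq> idx \<beta> x"
    using inj_onD[OF idx(1)[OF a(1)], of c x] a by (auto simp: Cs_def)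
  ultimately show "idx \<beta> x < idx \<beta> c" by simp
qed

lemma Cs_small_idx:
  assumes "\<beta> < \<nu>" "n < \<theta>" shows "small {c \<in> Cs \<beta>. idx \<beta> c < n}"
proof -
  have "inj_on (idx \<beta>) {c \<in> Cs \<beta>. idx \<beta> c < n}"
    using idx(1)[OF assms(1)] by (rule inj_on_subset) (auto simp: Cs_def)
  moreover have "small (idx \<beta> ` {c \<in> Cs \<beta>. idx \<beta> c < n})"
    using small_below_\<theta>[OF assms(2)] by (rule small_mono) auto
  ultimately show ?thesis
    unfolding small_def using card_of_ordIsoI[OF bij_betw_imageI[OF _ refl]] ordIso_ordLess_trans
    by blast
qed

text \<open>Indices increase along \<open>Cs \<beta>\<close>, so its members up to a given one are
  counted by the ordinals up to the index of that one, which is below \<theta>.\<close>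

lemma Cs_small:
  assumes "\<beta> < \<nu>" "\<delta> < \<beta>" shows "small {c \<in> Cs \<beta>. c \<le> \<delta>}"
proof -
  obtain c where c: "c \<in> Cs \<beta>" "\<delta> \<le> c" using Cs_cofinal[OF assms] by auto
  obtain n where n: "n < \<theta>" "idx \<beta> c < n"
    using \<theta>_limit idx_less[OF assms(1) Cs_less[OF c(1)]] by blast
  have "{x \<in> Cs \<beta>. x \<le> \<delta>} \<subseteq> {x \<in> Cs \<beta>. idx \<beta> x < n}"
  proof safe
    fix x assume "x \<in> Cs \<beta>" "x \<le> \<delta>"
    have "x \<le> c" using \<open>x \<le> \<delta>\<close> c(2) by (rule order_trans)
    then show "idx \<beta> x < n"
      using \<open>x \<in> Cs \<beta>\<close> n Cs_idx_mono[OF assms(1) _ c(1), of x]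
      by (metis le_less less_trans)
  qed
  then show ?thesis using small_mono[OF Cs_small_idx[OF assms(1) n(1)]] by blast
qed

end

section \<open>A subadditive function\<close>

context successor_cardinal
begin

text \<open>By \<open>Cs_idx_mono\<close> an initial piece of the C-sequence. The bound on
  \<open>f\<close> for all its pairs makes any two of its elements comparable at level n; the bound
  on the index keeps it small.\<close>

definition chain_part :: "('a \<Rightarrow> 'a \<Rightarrow> 'a) \<Rightarrow> 'a \<Rightarrow> 'a \<Rightarrow> 'a set" where
  "chain_part f \<beta> n =
     {c \<in> Cs \<beta>. idx \<beta> c < n \<and> (\<forall>c'\<in>Cs \<beta>. \<forall>c''\<in>Cs \<beta>. c' < c'' \<and> c'' \<le> c \<longrightarrow> f c'' c' \<le> n)}"

definition cone :: "('a \<Rightarrow> 'a \<Rightarrow> 'a) \<Rightarrow> 'a \<Rightarrow> 'a \<Rightarrow> 'a set" where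
  "cone f \<beta> n = {\<alpha>. \<exists>c\<in>chain_part f \<beta> n. \<alpha> = c \<or> \<alpha> < c \<and> f c \<alpha> \<le> n}"

text \<open>A subadditive function in the manner of Todorcevic's rho: the first level at which
  \<alpha> enters the cone of \<beta>. By \<open>cone_cong\<close> the recursion consults only
  values at points below \<beta>.\<close>

definition rho :: "'a \<Rightarrow> 'a \<Rightarrow> 'a" where
  "rho = wfrec {(x, y). x < y} (\<lambda>f \<beta> \<alpha>. LEAST n. \<alpha> \<in> cone f \<beta> n)"

lemma cone_cong:
  assumes "\<And>c. c < \<beta> \<Longrightarrow> f c = g c" shows "cone f \<beta> n = cone g \<beta> n"
proof -
  have "chain_part f \<beta> n = chain_part g \<beta> n"
    unfolding chain_part_def using assms by (auto simp: Cs_def)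
  moreover have "c < \<beta>" if "c \<in> chain_part g \<beta> n" for c
    using that by (auto simp: chain_part_def Cs_def)
  ultimately show ?thesis unfolding cone_def using assms by auto
qed

lemma rho_unfold: "rho \<beta> \<alpha> = (LEAST n. \<alpha> \<in> cone rho \<beta> n)"
proof -
  have wf: "wf {(x, y). x < (y::'a)}" by (rule wf)
  have "rho \<beta> = (\<lambda>\<alpha>. LEAST n. \<alpha> \<in> cone (cut rho {(x, y). x < y} \<beta>) \<beta> n)"
    unfolding rho_def by (subst wfrec[OF wf]) simp
  moreover have "cone (cut rho {(x, y). x < y} \<beta>) \<beta> n = cone rho \<beta> n" for n
    by (rule cone_cong) (simp add: cut_apply)
  ultimately show ?thesis by simp
qed

lemma cone_mono: "n \<le> m \<Longrightarrow> cone f \<beta> n \<subseteq> cone f \<beta> m"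
  unfolding cone_def chain_part_def by (auto 4 4 intro: less_le_trans order_trans)

text \<open>\<open>cone rho \<beta> n\<close> is \<open>{\<xi>. rho \<beta> \<xi> \<le> n}\<close>. It is small, and the relation \<open>rho b a \<le> n\<close> (for
  \<open>a < b\<close>) is total on it and does not lead out of it; this is subadditivity.\<close>

lemma rho_properties:
  "\<beta> < \<nu> \<Longrightarrow>
     (\<forall>\<alpha><\<beta>. rho \<beta> \<alpha> < \<theta>) \<and> (\<forall>n<\<theta>. small {\<alpha>. \<alpha> < \<beta> \<and> rho \<beta> \<alpha> \<le> n}) \<and>
     (\<forall>\<alpha> b. \<alpha> < b \<and> b < \<beta> \<longrightarrow> rho \<beta> \<alpha> \<le> max (rho b \<alpha>) (rho \<beta> b)
                           \<and> rho b \<alpha> \<le> max (rho \<beta> \<alpha>) (rho \<beta> b))"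
proof (induction \<beta> rule: less_induct)
  case (less \<beta>)
  have IH: "rho c \<alpha> < \<theta>" "n < \<theta> \<Longrightarrow> small {\<alpha>. \<alpha> < c \<and> rho c \<alpha> \<le> n}"
    "\<alpha> < b \<Longrightarrow> b < c \<Longrightarrow> rho c \<alpha> \<le> max (rho b \<alpha>) (rho c b)"
    "\<alpha> < b \<Longrightarrow> b < c \<Longrightarrow> rho b \<alpha> \<le> max (rho c \<alpha>) (rho c b)" if "c < \<beta>" "\<alpha> < c" for c \<alpha> b n
    using less.IH[OF that(1)] that less.prems by (meson less_trans)+
  have cover: "\<exists>n<\<theta>. \<alpha> \<in> cone rho \<beta> n" if \<alpha>: "\<alpha> < \<beta>" for \<alpha>
  proof -
    obtain c where c: "c \<in> Cs \<beta>" "\<alpha> \<le> c" using Cs_cofinal[OF less.prems \<alpha>] by auto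
    define X where "X = {x \<in> Cs \<beta>. x \<le> c}"
    have sX: "small X" unfolding X_def using Cs_small[OF less.prems Cs_less[OF c(1)]] .
    \<comment> \<open>The values of \<open>rho\<close> on pairs from X are fewer than \<theta> many
      and lie below \<theta> by induction, so by regularity one level n bounds them all and puts c
      into the chain.\<close>
    define R where "R = (\<Union>c''\<in>X. (\<lambda>c'. rho c'' c') ` {c'\<in>X. c' < c''})"
    have "small R" unfolding R_def
      by (intro small_UNION small_image sX small_mono[OF sX]) auto
    then have sm: "small (R \<union> ({idx \<beta> c} \<union> (if \<alpha> < c then {rho c \<alpha>} else {})))"
      by (rule small_Un) (rule finite_small, simp)
    have "R \<subseteq> {..<\<theta>}"
      unfolding R_def X_def using IH(1) c by (auto dest: Cs_less)
    then have "R \<union> ({idx \<beta> c} \<union> (if \<alpha> < c then {rho c \<alpha>} else {})) \<subseteq> {..<\<theta>}"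
      using idx_less[OF less.prems] c IH(1)[of c \<alpha>] by (auto dest: Cs_less)
    then obtain n where n: "n < \<theta>"
      "\<forall>x\<in>R \<union> ({idx \<beta> c} \<union> (if \<alpha> < c then {rho c \<alpha>} else {})). x < n"
      using \<theta>_bound[OF _ sm] by blast
    have "rho c'' c' \<le> n" if "c' \<in> Cs \<beta>" "c'' \<in> Cs \<beta>" "c' < c''" "c'' \<le> c" for c' c''
    proof -
      have "rho c'' c' \<in> R" unfolding R_def X_def using that by auto
      then show ?thesis using n(2) by (auto simp: less_imp_le)
    qed
    then have "c \<in> chain_part rho \<beta> n" unfolding chain_part_def using n c by auto
    moreover have "\<alpha> = c \<or> \<alpha> < c \<and> rho c \<alpha> \<le> n" using n c by (auto simp: less_imp_le)
    ultimately show ?thesis using n(1) unfolding cone_def by blast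
  qed
  have mem: "rho \<beta> \<alpha> \<le> n \<longleftrightarrow> \<alpha> \<in> cone rho \<beta> n" if "\<alpha> < \<beta>" for \<alpha> n
  proof
    have "\<alpha> \<in> cone rho \<beta> (rho \<beta> \<alpha>)"
      using cover[OF that] unfolding rho_unfold[of \<beta> \<alpha>] by (auto intro: LeastI)
    then show "\<alpha> \<in> cone rho \<beta> n" if "rho \<beta> \<alpha> \<le> n" using cone_mono[OF that] by blast
    show "rho \<beta> \<alpha> \<le> n" if "\<alpha> \<in> cone rho \<beta> n"
      unfolding rho_unfold[of \<beta> \<alpha>] using that by (rule Least_le)
  qed
  have "rho \<beta> \<alpha> < \<theta>" if "\<alpha> < \<beta>" for \<alpha>
    using cover[OF that] mem[OF that] by (meson le_less_trans)
  moreover have "small {\<alpha>. \<alpha> < \<beta> \<and> rho \<beta> \<alpha> \<le> n}" if n: "n < \<theta>" for n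
  proof -
    have "small (chain_part rho \<beta> n)"
      using Cs_small_idx[OF less.prems n] by (rule small_mono) (auto simp: chain_part_def)
    then have "small (\<Union>c\<in>chain_part rho \<beta> n. {c} \<union> {\<alpha>. \<alpha> < c \<and> rho c \<alpha> \<le> n})"
    proof (rule small_UNION)
      fix c assume "c \<in> chain_part rho \<beta> n"
      then have c: "c < \<beta>" by (auto simp: chain_part_def Cs_less)
      have "small {\<alpha>. \<alpha> < c \<and> rho c \<alpha> \<le> n}"
        using less.IH[OF c] less.prems c n by (meson less_trans)
      then show "small ({c} \<union> {\<alpha>. \<alpha> < c \<and> rho c \<alpha> \<le> n})"
        by (intro small_Un[OF finite_small]) auto
    qed
    then show ?thesis
    proof (rule small_mono, safe)
      fix \<alpha> assume "\<alpha> < \<beta>" "rho \<beta> \<alpha> \<le> n"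
      then have "\<alpha> \<in> cone rho \<beta> n" using mem by blast
      then show "\<alpha> \<in> (\<Union>c\<in>chain_part rho \<beta> n. {c} \<union> {\<alpha>. \<alpha> < c \<and> rho c \<alpha> \<le> n})"
        unfolding cone_def by blast
    qed
  qed
  moreover have "rho \<beta> \<alpha> \<le> max (rho b \<alpha>) (rho \<beta> b)" if ab: "\<alpha> < b" "b < \<beta>" for \<alpha> b
  proof -
    let ?m = "max (rho b \<alpha>) (rho \<beta> b)"
    have "b \<in> cone rho \<beta> ?m" by (rule iffD1[OF mem[OF ab(2)]]) simp
    then obtain c where c: "c \<in> chain_part rho \<beta> ?m" "b = c \<or> b < c \<and> rho c b \<le> ?m"
      unfolding cone_def by blast
    have c\<beta>: "c < \<beta>" using c(1) by (auto simp: chain_part_def Cs_less)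
    have "\<alpha> < c \<and> rho c \<alpha> \<le> ?m"
    proof (cases "b = c")
      case False
      then have "b < c" "rho c b \<le> ?m" using c(2) by auto
      then have "rho c \<alpha> \<le> max (rho b \<alpha>) (rho c b)" using IH(3)[OF c\<beta>] ab(1) by (meson less_trans)
      also have "\<dots> \<le> ?m" using \<open>rho c b \<le> ?m\<close> by simp
      finally show ?thesis using \<open>b < c\<close> ab(1) by auto
    qed (use ab(1) in auto)
    then have "\<alpha> \<in> cone rho \<beta> ?m" unfolding cone_def using c(1) by blast
    then show ?thesis by (rule iffD2[OF mem[OF less_trans[OF ab]]])
  qed
  moreover have "rho b \<alpha> \<le> max (rho \<beta> \<alpha>) (rho \<beta> b)" if ab: "\<alpha> < b" "b < \<beta>" for \<alpha> b
  proof -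
    let ?m = "max (rho \<beta> \<alpha>) (rho \<beta> b)"
    have in_cone: "b \<in> cone rho \<beta> ?m" "\<alpha> \<in> cone rho \<beta> ?m"
      by (rule iffD1[OF mem[OF ab(2)]], simp) (rule iffD1[OF mem[OF less_trans[OF ab]]], simp)
    \<comment> \<open>The elements \<alpha> and b enter the cone through possibly different members
      of the chain. Raising both to the larger member c places them under a common point, where the
      induction hypothesis compares them.\<close>
    have lift: "x = c \<or> x < c \<and> rho c x \<le> ?m"
      if c: "c \<in> chain_part rho \<beta> ?m" "c1 \<in> chain_part rho \<beta> ?m" "c1 \<le> c"
        and x: "x = c1 \<or> x < c1 \<and> rho c1 x \<le> ?m" for x c c1
    proof (cases "c1 = c")
      case False
      then have less: "c1 < c" using c(3) by simp
      have le: "rho c c1 \<le> ?m" using c(1,2) less unfolding chain_part_def by blast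
      have c\<beta>: "c < \<beta>" using c(1) by (auto simp: chain_part_def Cs_less)
      show ?thesis
      proof (cases "x = c1")
        case False
        then have xc: "x < c1" "rho c1 x \<le> ?m" using x by auto
        have "rho c x \<le> max (rho c1 x) (rho c c1)"
          using IH(3)[OF c\<beta>] xc(1) less by (meson less_trans)
        also have "\<dots> \<le> ?m" using xc(2) le by simp
        finally show ?thesis using xc(1) less by auto
      qed (use less le in auto)
    qed (use x in simp)
    obtain c1 where c1: "c1 \<in> chain_part rho \<beta> ?m" "\<alpha> = c1 \<or> \<alpha> < c1 \<and> rho c1 \<alpha> \<le> ?m"
      using in_cone(2) unfolding cone_def by blast
    obtain c2 where c2: "c2 \<in> chain_part rho \<beta> ?m" "b = c2 \<or> b < c2 \<and> rho c2 b \<le> ?m"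
      using in_cone(1) unfolding cone_def by blast
    define c where "c = max c1 c2"
    have c: "c \<in> chain_part rho \<beta> ?m" using c1 c2 by (simp add: c_def max_def)
    have c\<beta>: "c < \<beta>" using c by (auto simp: chain_part_def Cs_less)
    have \<alpha>: "\<alpha> = c \<or> \<alpha> < c \<and> rho c \<alpha> \<le> ?m"
      by (rule lift[OF c c1(1) _ c1(2)]) (simp add: c_def)
    have b: "b = c \<or> b < c \<and> rho c b \<le> ?m"
      by (rule lift[OF c c2(1) _ c2(2)]) (simp add: c_def)
    show ?thesis
    proof (cases "b = c")
      case True
      then show ?thesis using \<alpha> ab(1) by auto
    next
      case False
      then have bc: "b < c" "rho c b \<le> ?m" using b by auto
      then have \<alpha>c: "rho c \<alpha> \<le> ?m" "\<alpha> < c" using \<alpha> ab(1) by auto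
      have "rho b \<alpha> \<le> max (rho c \<alpha>) (rho c b)" by (rule IH(4)[OF c\<beta> \<alpha>c(2) ab(1) bc(1)])
      also have "\<dots> \<le> ?m" using \<alpha>c bc by simp
      finally show ?thesis .
    qed
  qed
  ultimately show ?case by blast
qed

lemma rho_less: "\<beta> < \<nu> \<Longrightarrow> \<alpha> < \<beta> \<Longrightarrow> rho \<beta> \<alpha> < \<theta>"
  using rho_properties by blast

lemma rho_small: "\<beta> < \<nu> \<Longrightarrow> n < \<theta> \<Longrightarrow> small {\<alpha>. \<alpha> < \<beta> \<and> rho \<beta> \<alpha> \<le> n}"
  using rho_properties by blast

text \<open>The two inequalities act like an ultrametric: the values at \<xi> can differ only if
  neither exceeds \<open>rho \<beta> \<alpha>\<close>.\<close>

lemma rho_eq: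
  assumes "\<beta> < \<nu>" "\<alpha> < \<beta>" "\<xi> < \<alpha>" "rho \<beta> \<alpha> < rho \<alpha> \<xi>" shows "rho \<alpha> \<xi> = rho \<beta> \<xi>"
proof -
  have "rho \<beta> \<xi> \<le> max (rho \<alpha> \<xi>) (rho \<beta> \<alpha>)" "rho \<alpha> \<xi> \<le> max (rho \<beta> \<xi>) (rho \<beta> \<alpha>)"
    using rho_properties assms by blast+
  then show ?thesis using assms(4) by (auto simp: max_def split: if_splits)
qed

text \<open>The points of cofinality \<theta>, expressed without cofinalities: X empty excludes 0,
  singletons exclude successors, and larger cofinalities do not occur below \<theta>^+.\<close>

definition Scof :: "'a set" where
  "Scof = {\<delta>. \<delta> < \<nu> \<and> (\<forall>X. X \<subseteq> {..<\<delta>} \<and> small X \<longrightarrow> (\<exists>\<gamma><\<delta>. \<forall>x\<in>X. x < \<gamma>))}"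

lemma Scof_less: "\<delta> \<in> Scof \<Longrightarrow> \<delta> < \<nu>"
  by (simp add: Scof_def)

lemma Scof_bound: "\<delta> \<in> Scof \<Longrightarrow> X \<subseteq> {..<\<delta>} \<Longrightarrow> small X \<Longrightarrow> \<exists>\<gamma><\<delta>. \<forall>x\<in>X. x < \<gamma>"
  unfolding Scof_def by blast

lemma Scof_finite_bound: "\<delta> \<in> Scof \<Longrightarrow> X \<subseteq> {..<\<delta>} \<Longrightarrow> finite X \<Longrightarrow> \<exists>\<gamma><\<delta>. \<forall>x\<in>X. x < \<gamma>"
  using Scof_bound finite_small by blast

text \<open>By \<open>rho_eq\<close> a disagreement at \<xi> forces
  \<open>rho \<alpha> \<xi> \<le> rho \<beta> \<alpha>\<close>. Such \<xi> form a small set, and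
  small sets are bounded below a point of cofinality \<theta>.\<close>

lemma rho_coherent_aux:
  assumes "\<delta> \<in> Scof" "\<delta> \<le> \<alpha>" "\<alpha> < \<beta>" "\<beta> < \<nu>"
  shows "\<exists>\<gamma><\<delta>. \<forall>\<xi>. \<gamma> \<le> \<xi> \<and> \<xi> < \<delta> \<longrightarrow> rho \<alpha> \<xi> = rho \<beta> \<xi>"
proof -
  let ?X = "{\<xi>. \<xi> < \<delta> \<and> rho \<alpha> \<xi> \<le> rho \<beta> \<alpha>}"
  have "small {\<xi>. \<xi> < \<alpha> \<and> rho \<alpha> \<xi> \<le> rho \<beta> \<alpha>}"
    using assms rho_less[of \<beta> \<alpha>] by (intro rho_small) auto
  then have "small ?X" by (rule small_mono) (use assms in auto)
  then obtain \<gamma> where \<gamma>: "\<gamma> < \<delta>" "\<forall>x\<in>?X. x < \<gamma>"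
    using Scof_bound[OF assms(1), of ?X] by auto
  have "rho \<alpha> \<xi> = rho \<beta> \<xi>" if "\<gamma> \<le> \<xi>" "\<xi> < \<delta>" for \<xi>
  proof (rule rho_eq[OF assms(4,3)])
    show "\<xi> < \<alpha>" using that assms by auto
    show "rho \<beta> \<alpha> < rho \<alpha> \<xi>" using \<gamma>(2) that by (metis (mono_tags, lifting) leD mem_Collect_eq not_less)
  qed
  then show ?thesis using \<gamma>(1) by blast
qed

lemma rho_coherent:
  assumes "\<delta> \<in> Scof" "\<delta> \<le> \<alpha>" "\<alpha> < \<nu>" "\<delta> \<le> \<beta>" "\<beta> < \<nu>"
  shows "\<exists>\<gamma><\<delta>. \<forall>\<xi>. \<gamma> \<le> \<xi> \<and> \<xi> < \<delta> \<longrightarrow> rho \<alpha> \<xi> = rho \<beta> \<xi>"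
proof (cases \<alpha> \<beta> rule: linorder_cases)
  case less
  then show ?thesis using rho_coherent_aux assms by blast
next
  case equal
  then show ?thesis using Scof_finite_bound[OF assms(1), of "{}"] by auto
next
  case greater
  then show ?thesis using rho_coherent_aux[OF assms(1) assms(4) _ assms(3)] by metis
qed

end

section \<open>Stationary sets and walks\<close>

context successor_cardinal
begin

text \<open>Stationarity is phrased through closure points of functions instead of clubs, because
  closing off under a function is how it is always applied.\<close>

definition stat :: "'a set \<Rightarrow> bool" where
  "stat R \<longleftrightarrow> R \<subseteq> Scof \<and> (\<forall>h. (\<forall>\<eta><\<nu>. h \<eta> < \<nu>) \<longrightarrow> (\<exists>\<delta>\<in>R. \<forall>\<eta><\<delta>. h \<eta> < \<delta>))"

text \<open>Close off \<theta> times under h. The supremum of the resulting increasing sequence is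
  closed under h and has cofinality \<theta>, as \<theta> is regular.\<close>

lemma Scof_stat: "stat Scof"
  unfolding stat_def
proof safe
  fix h :: "'a \<Rightarrow> 'a" assume h: "\<forall>\<eta><\<nu>. h \<eta> < \<nu>"
  define s where "s = wfrec {(x, y). x < y}
    (\<lambda>f (i::'a). LEAST x. \<forall>k<i. f k < x \<and> (\<forall>y\<le>f k. h y < x))"
  have s: "s i = (LEAST x. \<forall>k<i. s k < x \<and> (\<forall>y\<le>s k. h y < x))" for i
  proof -
    have "s i = (LEAST x. \<forall>k<i. cut s {(x, y). x < y} i k < x
                  \<and> (\<forall>y\<le>cut s {(x, y). x < y} i k. h y < x))"
      unfolding s_def by (subst wfrec[OF wf]) simp
    then show ?thesis by (simp add: cut_apply cong: imp_cong)
  qed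
  have s_prop: "s i < \<nu> \<and> (\<forall>k<i. s k < s i \<and> (\<forall>y\<le>s k. h y < s i))" if "i < \<theta>" for i
    using that
  proof (induction i rule: less_induct)
    case (less i)
    have s\<nu>: "s k < \<nu>" if "k < i" for k using less that by (meson less_trans)
    have "moderate (\<Union>k\<in>{..<i}. h ` {..s k} \<union> {s k})"
    proof (rule moderate_UNION)
      show "moderate {..<i}" using small_below_\<theta>[OF less.prems] by (rule small_moderate)
      fix k assume "k \<in> {..<i}"
      then show "moderate (h ` {..s k} \<union> {s k})"
        using s\<nu> by (intro moderate_Un moderate_image moderate_atMost small_moderate[OF finite_small]) auto
    qed
    moreover have "(\<Union>k\<in>{..<i}. h ` {..s k} \<union> {s k}) \<subseteq> {..<\<nu>}"
      using s\<nu> h by (auto intro: le_less_trans)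
    ultimately obtain b where "b < \<nu>" "\<forall>x\<in>(\<Union>k\<in>{..<i}. h ` {..s k} \<union> {s k}). x < b"
      using \<nu>_bound by metis
    then have b: "b < \<nu>" "\<forall>k<i. s k < b \<and> (\<forall>y\<le>s k. h y < b)" by auto
    have "\<forall>k<i. s k < s i \<and> (\<forall>y\<le>s k. h y < s i)"
      unfolding s[of i] using b(2) by (rule LeastI)
    moreover have "s i \<le> b" unfolding s[of i] using b(2) by (rule Least_le)
    ultimately show ?case using b(1) by auto
  qed
  have "\<exists>b<\<nu>. \<forall>x\<in>s ` {..<\<theta>}. x < b"
    by (rule \<nu>_bound) (use s_prop moderate_image[OF moderate_\<theta>] in auto)
  then obtain b where b: "b < \<nu>" "\<forall>i<\<theta>. s i < b" by auto
  define \<delta> where "\<delta> = (LEAST x. \<forall>i<\<theta>. s i < x)"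
  have \<delta>: "\<forall>i<\<theta>. s i < \<delta>" unfolding \<delta>_def using b(2) by (rule LeastI)
  have \<delta>\<nu>: "\<delta> < \<nu>" unfolding \<delta>_def using Least_le[of "\<lambda>x. \<forall>i<\<theta>. s i < x", OF b(2)] b(1) by simp
  have below: "\<exists>i<\<theta>. \<eta> \<le> s i" if "\<eta> < \<delta>" for \<eta>
    using not_less_Least[of \<eta> "\<lambda>x. \<forall>i<\<theta>. s i < x"] that by (auto simp: \<delta>_def not_less)
  have "\<delta> \<in> Scof"
    unfolding Scof_def
  proof (safe intro!: \<delta>\<nu>)
    fix X assume X: "X \<subseteq> {..<\<delta>}" "small X"
    then have "\<forall>x\<in>X. \<exists>i. i < \<theta> \<and> x \<le> s i" using below by auto
    from bchoice[OF this] obtain f where f: "\<forall>x\<in>X. f x < \<theta> \<and> x \<le> s (f x)" by blast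
    then obtain i where i: "i < \<theta>" "\<forall>y\<in>f ` X. y < i"
      using \<theta>_bound[of "f ` X"] small_image[OF X(2)] by auto
    have "x < s i" if "x \<in> X" for x
      using f i s_prop[OF i(1)] that by (meson imageI le_less_trans)
    then show "\<exists>\<gamma><\<delta>. \<forall>x\<in>X. x < \<gamma>" using \<delta> i(1) by blast
  qed
  moreover have "h \<eta> < \<delta>" if \<eta>: "\<eta> < \<delta>" for \<eta>
  proof -
    obtain i where i: "i < \<theta>" "\<eta> \<le> s i" using below[OF \<eta>] by auto
    obtain j where j: "j < \<theta>" "i < j" using \<theta>_limit[OF i(1)] by auto
    then have "h \<eta> < s j" using s_prop[OF j(1)] i(2) by blast
    then show ?thesis using \<delta> j(1) by (meson less_trans)
  qed
  ultimately show "\<exists>\<delta>\<in>Scof. \<forall>\<eta><\<delta>. h \<eta> < \<delta>" by blast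
qed

lemma statD: "stat R \<Longrightarrow> (\<And>\<eta>. \<eta> < \<nu> \<Longrightarrow> h \<eta> < \<nu>) \<Longrightarrow> \<exists>\<delta>\<in>R. \<forall>\<eta><\<delta>. h \<eta> < \<delta>"
  unfolding stat_def by blast

lemma stat_unbounded:
  assumes "stat R" shows "unbounded R"
  unfolding unbounded_def
proof safe
  have sub: "R \<subseteq> Scof" using assms by (simp add: stat_def)
  then show "x < \<nu>" if "x \<in> R" for x using that Scof_less by blast
  fix \<gamma> assume "\<gamma> < \<nu>"
  then obtain \<delta> where \<delta>: "\<delta> \<in> R" "\<forall>\<eta><\<delta>. \<gamma> < \<delta>" using statD[OF assms, of "\<lambda>_. \<gamma>"] by blast
  then obtain \<eta> where "\<eta> < \<delta>" using sub Scof_finite_bound[of \<delta> "{}"] by auto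
  then show "\<exists>x\<in>R. \<gamma> < x" using \<delta> by blast
qed

text \<open>A substitute for an elementary submodel with trace \<delta> on \<nu>. The function to
  close under bounds, for the moderately many parameters available at stage \<eta>, both the sets
  \<open>Z x\<close> that are bounded and the next witnesses in those that are not.\<close>

lemma stat_reflect:
  assumes R: "stat R"
    and P: "\<And>\<eta>. \<eta> < \<nu> \<Longrightarrow> moderate (P \<eta>)" and mono: "\<And>\<eta> \<eta>'. \<eta> \<le> \<eta>' \<Longrightarrow> P \<eta> \<subseteq> P \<eta>'"
    and Z: "\<And>x. Z x \<subseteq> {..<\<nu>}"
  shows "\<exists>\<delta>\<in>R. \<forall>\<eta><\<delta>. \<forall>x\<in>P \<eta>.
           ((\<exists>z\<in>Z x. \<delta> \<le> z) \<longrightarrow> unbounded (Z x)) \<and> (unbounded (Z x) \<longrightarrow> (\<forall>\<eta><\<delta>. \<exists>z\<in>Z x. \<eta> < z \<and> z < \<delta>))"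
proof -
  have ex: "\<exists>b<\<nu>. \<forall>x\<in>P \<eta>. (unbounded (Z x) \<longrightarrow> (\<exists>z\<in>Z x. \<eta> < z \<and> z < b))
                         \<and> (\<not> unbounded (Z x) \<longrightarrow> (\<forall>z\<in>Z x. z < b))" if \<eta>: "\<eta> < \<nu>" for \<eta>
  proof -
    have "\<exists>b<\<nu>. (unbounded (Z x) \<longrightarrow> (\<exists>z\<in>Z x. \<eta> < z \<and> z < b))
                         \<and> (\<not> unbounded (Z x) \<longrightarrow> (\<forall>z\<in>Z x. z < b))" for x
    proof (cases "unbounded (Z x)")
      case True
      then obtain z where "z \<in> Z x" "\<eta> < z" "z < \<nu>" using unboundedD[OF _ \<eta>] by blast
      then show ?thesis using True \<nu>_limit[of z] by blast
    next
      case False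
      then show ?thesis using not_unbounded[OF Z] by auto
    qed
    then obtain b where b: "\<And>x. b x < \<nu>" "\<And>x. unbounded (Z x) \<Longrightarrow> \<exists>z\<in>Z x. \<eta> < z \<and> z < b x"
      "\<And>x. \<not> unbounded (Z x) \<Longrightarrow> \<forall>z\<in>Z x. z < b x" by metis
    obtain B where B: "B < \<nu>" "\<forall>y\<in>b ` P \<eta>. y < B"
      using \<nu>_bound[of "b ` P \<eta>"] moderate_image[OF P[OF \<eta>]] b(1) by auto
    then show ?thesis using b(2,3) by (intro exI[of _ B]) (meson imageI less_trans)
  qed
  define h where "h \<eta> = (SOME b. b < \<nu> \<and> (\<forall>x\<in>P \<eta>. (unbounded (Z x) \<longrightarrow> (\<exists>z\<in>Z x. \<eta> < z \<and> z < b))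
                         \<and> (\<not> unbounded (Z x) \<longrightarrow> (\<forall>z\<in>Z x. z < b))))" for \<eta>
  have h: "h \<eta> < \<nu> \<and> (\<forall>x\<in>P \<eta>. (unbounded (Z x) \<longrightarrow> (\<exists>z\<in>Z x. \<eta> < z \<and> z < h \<eta>))
                         \<and> (\<not> unbounded (Z x) \<longrightarrow> (\<forall>z\<in>Z x. z < h \<eta>)))" if "\<eta> < \<nu>" for \<eta>
    unfolding h_def using someI_ex[OF ex[OF that]] by simp
  obtain \<delta> where \<delta>: "\<delta> \<in> R" "\<forall>\<eta><\<delta>. h \<eta> < \<delta>" using statD[OF R, of h] h by blast
  have \<delta>\<nu>: "\<delta> < \<nu>" using R \<delta>(1) Scof_less by (auto simp: stat_def)
  have "((\<exists>z\<in>Z x. \<delta> \<le> z) \<longrightarrow> unbounded (Z x)) \<and> (unbounded (Z x) \<longrightarrow> (\<forall>\<eta><\<delta>. \<exists>z\<in>Z x. \<eta> < z \<and> z < \<delta>))"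
    if \<eta>: "\<eta> < \<delta>" and x: "x \<in> P \<eta>" for \<eta> x
  proof (intro conjI impI allI)
    show "unbounded (Z x)" if "\<exists>z\<in>Z x. \<delta> \<le> z"
    proof (rule ccontr)
      assume "\<not> unbounded (Z x)"
      then have "\<forall>z\<in>Z x. z < h \<eta>" using h[of \<eta>] \<eta> \<delta>\<nu> x by (meson less_trans)
      then show False using that \<delta>(2) \<eta> by (meson leD less_trans)
    qed
    fix \<eta>' assume u: "unbounded (Z x)" and \<eta>': "\<eta>' < \<delta>"
    \<comment> \<open>The parameter x appears at stage \<eta>, but the witness has to exceed
      \<eta>'; by monotonicity of P the later of the two stages handles both.\<close>
    let ?m = "max \<eta> \<eta>'"
    have m: "?m < \<delta>" using \<eta> \<eta>' by simp
    have "x \<in> P ?m" using mono[of \<eta> ?m] x by auto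
    then obtain z where "z \<in> Z x" "?m < z" "z < h ?m"
      using h[of ?m] m \<delta>\<nu> u by (meson less_trans)
    moreover have "h ?m < \<delta>" using \<delta>(2) m by blast
    ultimately show "\<exists>z\<in>Z x. \<eta>' < z \<and> z < \<delta>"
      by (meson less_trans max_less_iff_conj)
  qed
  then show ?thesis using \<delta>(1) by blast
qed

section \<open>Minimal walks and their lower traces\<close>

definition top_below :: "'a \<Rightarrow> 'a \<Rightarrow> 'a" where
  "top_below \<delta> \<beta> = (LEAST x. \<forall>c\<in>Cs \<beta>. c < \<delta> \<longrightarrow> c \<le> x)"

definition step :: "'a \<Rightarrow> 'a \<Rightarrow> 'a" where
  "step \<delta> \<beta> = (LEAST c. c \<in> Cs \<beta> \<and> \<delta> \<le> c)"

lemma step: assumes "\<beta> < \<nu>" "\<delta> < \<beta>" shows "step \<delta> \<beta> \<in> Cs \<beta>" "\<delta> \<le> step \<delta> \<beta>" "step \<delta> \<beta> < \<beta>"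
proof -
  have "step \<delta> \<beta> \<in> Cs \<beta> \<and> \<delta> \<le> step \<delta> \<beta>"
    unfolding step_def using Cs_cofinal[OF assms] LeastI_ex[of "\<lambda>c. c \<in> Cs \<beta> \<and> \<delta> \<le> c"] by blast
  then show "step \<delta> \<beta> \<in> Cs \<beta>" "\<delta> \<le> step \<delta> \<beta>" "step \<delta> \<beta> < \<beta>" using Cs_less by auto
qed

lemma top_below_ge: "c \<in> Cs \<beta> \<Longrightarrow> c < \<delta> \<Longrightarrow> c \<le> top_below \<delta> \<beta>"
  unfolding top_below_def using LeastI[of "\<lambda>x. \<forall>c\<in>Cs \<beta>. c < \<delta> \<longrightarrow> c \<le> x" \<delta>] by (simp add: less_imp_le)

lemma top_below_less:
  assumes "\<delta> \<in> Scof" "\<delta> < \<beta>" "\<beta> < \<nu>" shows "top_below \<delta> \<beta> < \<delta>"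
proof -
  have "small {c \<in> Cs \<beta>. c < \<delta>}"
    using Cs_small[OF assms(3,2)] by (rule small_mono) auto
  then obtain \<gamma> where "\<gamma> < \<delta>" "\<forall>x\<in>{c \<in> Cs \<beta>. c < \<delta>}. x < \<gamma>"
    using Scof_bound[OF assms(1), of "{c \<in> Cs \<beta>. c < \<delta>}"] by auto
  moreover from this have "top_below \<delta> \<beta> \<le> \<gamma>"
    unfolding top_below_def by (intro Least_le) auto
  ultimately show ?thesis by simp
qed

text \<open>The running maxima of \<open>sup (Cs \<beta>\<^sub>i \<inter> \<delta>)\<close> along the walk \<open>\<beta> = \<beta>\<^sub>0 > \<beta>\<^sub>1 > \<dots> > \<delta>\<close>. Without
  taking maxima a later entry could be small, and marks near \<open>\<delta>\<close> could not be controlled.\<close>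

function trace :: "'a \<Rightarrow> 'a \<Rightarrow> 'a \<Rightarrow> 'a list" where
  "trace m \<delta> \<beta> = (if \<delta> < \<beta> \<and> step \<delta> \<beta> < \<beta>
     then max m (top_below \<delta> \<beta>) # trace (max m (top_below \<delta> \<beta>)) \<delta> (step \<delta> \<beta>) else [])"
  by pat_completeness auto
termination by (relation "inv_image {(x, y). x < y} (\<lambda>(m, \<delta>, \<beta>). \<beta>)") (auto simp: wf)

declare trace.simps [simp del]

lemma trace_Cons: "\<delta> < \<beta> \<Longrightarrow> \<beta> < \<nu> \<Longrightarrow>
    trace m \<delta> \<beta> = max m (top_below \<delta> \<beta>) # trace (max m (top_below \<delta> \<beta>)) \<delta> (step \<delta> \<beta>)"
  using step(3) by (subst trace.simps) simp

lemma trace_Nil: "\<beta> \<le> \<delta> \<Longrightarrow> trace m \<delta> \<beta> = []"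
  by (subst trace.simps) (simp add: not_less)

primrec node :: "nat \<Rightarrow> 'a \<Rightarrow> 'a \<Rightarrow> 'a" where
  "node 0 \<delta> \<beta> = \<beta>"
| "node (Suc n) \<delta> \<beta> = node n \<delta> (step \<delta> \<beta>)"

lemma trace_ge: "x \<in> set (trace m \<delta> \<beta>) \<Longrightarrow> m \<le> x"
proof (induction m \<delta> \<beta> rule: trace.induct)
  case (1 m \<delta> \<beta>)
  show ?case
  proof (cases "\<delta> < \<beta> \<and> step \<delta> \<beta> < \<beta>")
    case True
    then have "x = max m (top_below \<delta> \<beta>) \<or> x \<in> set (trace (max m (top_below \<delta> \<beta>)) \<delta> (step \<delta> \<beta>))"
      using "1.prems" by (subst (asm) trace.simps) simp
    then show ?thesis using "1.IH"[OF True] by auto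
  next
    case False
    then show ?thesis using "1.prems" by (subst (asm) trace.simps) simp
  qed
qed

lemma trace_less:
  assumes "\<delta> \<in> Scof"
  shows "\<beta> < \<nu> \<Longrightarrow> m < \<delta> \<Longrightarrow> x \<in> set (trace m \<delta> \<beta>) \<Longrightarrow> x < \<delta>"
proof (induction \<beta> arbitrary: m rule: less_induct)
  case (less \<beta>)
  show ?case
  proof (cases "\<delta> < \<beta>")
    case True
    let ?m = "max m (top_below \<delta> \<beta>)"
    have m: "?m < \<delta>" using less.prems(2) top_below_less[OF assms True less.prems(1)] by simp
    have st: "step \<delta> \<beta> < \<beta>" using step(3)[OF less.prems(1) True] .
    have "x = ?m \<or> x \<in> set (trace ?m \<delta> (step \<delta> \<beta>))"
      using less.prems(3) trace_Cons[OF True less.prems(1)] by auto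
    then show ?thesis using m less.IH[OF st _ m] less.prems(1) st by (auto dest: less_trans)
  next
    case False
    then show ?thesis using less.prems(3) trace_Nil[of \<beta> \<delta> m] by simp
  qed
qed

text \<open>The entries bound the parts below \<delta>' of the C-sequences met on the way. If they
  lie below \<delta>, none of these C-sequences has an element in [\<delta>, \<delta>'), so the
  walks to \<delta> and to \<delta>' make the same steps until \<delta>' is reached.\<close>

lemma trace_pass:
  assumes "\<delta> < \<delta>'"
  shows "\<delta>' \<le> \<beta> \<Longrightarrow> \<beta> < \<nu> \<Longrightarrow> \<forall>x\<in>set (trace m \<delta>' \<beta>). x < \<delta> \<Longrightarrow>
    trace m \<delta> \<beta> = trace m \<delta>' \<beta> @ trace (last (m # trace m \<delta>' \<beta>)) \<delta> \<delta>'
    \<and> node (length (trace m \<delta>' \<beta>)) \<delta> \<beta> = \<delta>'"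
proof (induction \<beta> arbitrary: m rule: less_induct)
  case (less \<beta>)
  show ?case
  proof (cases "\<beta> = \<delta>'")
    case True
    then show ?thesis by (simp add: trace_Nil)
  next
    case False
    then have \<beta>: "\<delta>' < \<beta>" "\<delta> < \<beta>" using less.prems(1) assms by auto
    let ?m = "max m (top_below \<delta>' \<beta>)"
    have tr: "trace m \<delta>' \<beta> = ?m # trace ?m \<delta>' (step \<delta>' \<beta>)" by (rule trace_Cons[OF \<beta>(1) less.prems(2)])
    then have "top_below \<delta>' \<beta> < \<delta>" using less.prems(3) by simp
    then have C: "c < \<delta>' \<longleftrightarrow> c < \<delta>" if "c \<in> Cs \<beta>" for c
      using top_below_ge[OF that, of \<delta>'] assms by (meson le_less_trans less_trans)
    then have eq: "step \<delta> \<beta> = step \<delta>' \<beta>"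
      unfolding step_def by (metis (no_types, lifting) not_less)
    have eq': "top_below \<delta> \<beta> = top_below \<delta>' \<beta>"
      unfolding top_below_def using C by (metis (no_types, lifting))
    have st: "step \<delta>' \<beta> < \<beta>" "\<delta>' \<le> step \<delta>' \<beta>" using step[OF less.prems(2) \<beta>(1)] by auto
    have "trace ?m \<delta> (step \<delta>' \<beta>) = trace ?m \<delta>' (step \<delta>' \<beta>) @
        trace (last (?m # trace ?m \<delta>' (step \<delta>' \<beta>))) \<delta> \<delta>'
      \<and> node (length (trace ?m \<delta>' (step \<delta>' \<beta>))) \<delta> (step \<delta>' \<beta>) = \<delta>'"
      using less.prems(2,3) st tr by (intro less.IH) auto
    moreover have "trace m \<delta> \<beta> = ?m # trace ?m \<delta> (step \<delta>' \<beta>)"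
      using trace_Cons[OF \<beta>(2) less.prems(2)] eq eq' by simp
    ultimately show ?thesis using tr eq by simp
  qed
qed

text \<open>Moore's lower trace, kept as a list. The term \<open>LEAST x. True\<close> is the
  ordinal 0, from which the running maximum starts.\<close>

definition L :: "'a \<Rightarrow> 'a \<Rightarrow> 'a list" where
  "L \<delta> \<beta> = trace (LEAST x. True) \<delta> \<beta>"

lemma least_le: "(LEAST x::'a. True) \<le> y"
  by (rule Least_le) simp

lemma L_less: "\<delta> \<in> Scof \<Longrightarrow> \<beta> < \<nu> \<Longrightarrow> x \<in> set (L \<delta> \<beta>) \<Longrightarrow> x < \<delta>"
proof -
  assume a: "\<delta> \<in> Scof" "\<beta> < \<nu>" "x \<in> set (L \<delta> \<beta>)"
  then obtain \<gamma> where "\<gamma> < \<delta>" using Scof_finite_bound[of \<delta> "{}"] by auto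
  then have "(LEAST x::'a. True) < \<delta>" using least_le le_less_trans by blast
  then show "x < \<delta>" using trace_less a by (simp add: L_def)
qed

text \<open>An element c of \<open>Cs \<delta>'\<close> in (\<gamma>, \<delta>) pushes the first
  entry after \<delta>' above \<gamma>, hence above the maximum inherited from the part between
  \<beta> and \<delta>'. The tail is therefore \<open>L \<delta> \<delta>'\<close>, whatever \<beta>
  was.\<close>

lemma L_pass:
  assumes "\<delta> < \<delta>'" "\<delta>' < \<beta>" "\<beta> < \<nu>" and F: "\<forall>x\<in>set (L \<delta>' \<beta>). x \<le> \<gamma>" and \<gamma>: "\<gamma> < \<delta>"
  shows "node (length (L \<delta>' \<beta>)) \<delta> \<beta> = \<delta>'"
    and "c \<in> Cs \<delta>' \<Longrightarrow> c < \<delta> \<Longrightarrow> \<gamma> < c \<Longrightarrow> L \<delta> \<beta> = L \<delta>' \<beta> @ L \<delta> \<delta>' \<and> L \<delta> \<delta>' \<noteq> [] \<and> (\<forall>x\<in>set (L \<delta> \<delta>'). \<gamma> < x)"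
proof -
  have less: "\<forall>x\<in>set (L \<delta>' \<beta>). x < \<delta>" using F \<gamma> by (meson le_less_trans)
  note pass = trace_pass[OF assms(1) less_imp_le[OF assms(2)] assms(3) less[unfolded L_def]]
  then show "node (length (L \<delta>' \<beta>)) \<delta> \<beta> = \<delta>'" by (simp add: L_def)
  assume c: "c \<in> Cs \<delta>'" "c < \<delta>" "\<gamma> < c"
  let ?z = "LEAST x::'a. True" let ?m = "last (?z # L \<delta>' \<beta>)"
  have "?m \<le> \<gamma>" using F least_le by (metis last.simps last_in_set)
  then have m: "max ?m (top_below \<delta> \<delta>') = top_below \<delta> \<delta>'" "max ?z (top_below \<delta> \<delta>') = top_below \<delta> \<delta>'"
    using top_below_ge[OF c(1,2)] c(3) least_le[of "top_below \<delta> \<delta>'"] by auto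
  have \<delta>'\<nu>: "\<delta>' < \<nu>" using assms by auto
  have e: "L \<delta> \<delta>' = top_below \<delta> \<delta>' # trace (top_below \<delta> \<delta>') \<delta> (step \<delta> \<delta>')"
    using trace_Cons[OF assms(1) \<delta>'\<nu>, of ?z] m by (simp add: L_def)
  moreover have "trace ?m \<delta> \<delta>' = L \<delta> \<delta>'"
    using trace_Cons[OF assms(1) \<delta>'\<nu>, of ?m] m e by simp
  moreover have "\<gamma> < x" if "x \<in> set (L \<delta> \<delta>')" for x
  proof -
    have "top_below \<delta> \<delta>' \<le> x" using that e trace_ge by auto
    then show ?thesis using top_below_ge[OF c(1,2)] c(3) by auto
  qed
  ultimately show "L \<delta> \<beta> = L \<delta>' \<beta> @ L \<delta> \<delta>' \<and> L \<delta> \<delta>' \<noteq> [] \<and> (\<forall>x\<in>set (L \<delta> \<delta>'). \<gamma> < x)"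
    using pass by (simp add: L_def)
qed

end

section \<open>Oscillations\<close>

text \<open>The oscillation number: with \<open>s = False\<close> it counts the maximal blocks of
  true marks. The argument s is the mark preceding the list, which is what makes the count additive
  under append.\<close>

primrec rises :: "bool \<Rightarrow> bool list \<Rightarrow> nat" where
  "rises s [] = 0"
| "rises s (b # bs) = (if \<not> s \<and> b then 1 else 0) + rises b bs"

lemma rises_append: "rises s (xs @ ys) = rises s xs + rises (last (s # xs)) ys"
  by (induction xs arbitrary: s) auto

lemma rises_False: "\<forall>b\<in>set ys. \<not> b \<Longrightarrow> rises s ys = 0"
  by (induction ys arbitrary: s) auto

lemma rises_True: "\<forall>b\<in>set ys. b \<Longrightarrow> rises True ys = 0"
  by (induction ys) auto

lemma rises_False_True: "\<forall>b\<in>set ys. b \<Longrightarrow> ys \<noteq> [] \<Longrightarrow> rises False ys = 1"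
  by (cases ys) (auto simp: rises_True)

context successor_cardinal
begin

section \<open>Reflecting points and the extension of walks\<close>

definition prescribed :: "'a set \<Rightarrow> 'a list \<Rightarrow> 'a list \<Rightarrow> 'a set" where
  "prescribed A F p = {a \<in> A. map (rho a) F = p}"

text \<open>All that \<open>extend\<close> has to remember about a situation over \<delta>, coded by
  finite lists and one ordinal so that \<open>stat_reflect\<close> can range over all codes.\<close>

definition matching :: "'a set \<Rightarrow> 'a set \<Rightarrow> 'a list \<Rightarrow> 'a list \<Rightarrow> 'a list \<Rightarrow> 'a \<Rightarrow> 'a set" where
  "matching A T F p q g = {d \<in> Scof. \<exists>a\<in>A. \<exists>b\<in>T. d < a \<and> d < b \<and> L d b = F
     \<and> map (rho a) F = p \<and> map (rho b) F = q \<and> (\<forall>\<xi>. g < \<xi> \<and> \<xi> < d \<longrightarrow> rho a \<xi> = rho b \<xi>)}"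

text \<open>Exactly the \<eta> at which the conclusion of \<open>matching_above\<close> fails.
  Collected into a set, the failure itself can be reflected below \<delta>.\<close>

definition low_below :: "'a set \<Rightarrow> 'a set \<Rightarrow> 'a list \<Rightarrow> 'a list \<Rightarrow> 'a list \<Rightarrow> 'a \<Rightarrow> 'a set" where
  "low_below A T F p q g =
     {\<eta>. \<eta> < \<nu> \<and> (\<forall>d\<in>matching A T F p q g. \<eta> < d \<longrightarrow> (\<forall>c\<in>Cs d. c < \<eta> \<longrightarrow> c \<le> g))}"

definition large_above :: "'a set \<Rightarrow> 'a \<Rightarrow> bool" where
  "large_above A \<gamma> \<longleftrightarrow> (\<forall>K k \<zeta>. finite K \<and> K \<subseteq> {\<gamma><..<\<nu>} \<and> k < \<theta> \<and> \<zeta> < \<nu> \<longrightarrow>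
     (\<exists>a\<in>A. \<zeta> < a \<and> (\<forall>\<xi>\<in>K. \<xi> < a \<and> k < rho a \<xi>)))"

text \<open>Fix k and suppose every \<gamma> has a counterexample. Let \<delta> of cofinality
  \<theta> be closed under these, and take a in A beyond \<delta>. The \<xi> < \<delta> with
  \<open>rho a \<xi> \<le> k\<close> are bounded in \<delta>, say by \<gamma>, so a refutes the
  counterexample for \<gamma>. One \<gamma> then serves all k, as there are only \<theta> of
  them.\<close>

lemma ex_large_above:
  assumes A: "unbounded A" shows "\<exists>\<gamma><\<nu>. large_above A \<gamma>"
proof -
  let ?P = "\<lambda>k \<gamma>. \<forall>K \<zeta>. finite K \<and> K \<subseteq> {\<gamma><..<\<nu>} \<and> \<zeta> < \<nu> \<longrightarrow>
     (\<exists>a\<in>A. \<zeta> < a \<and> (\<forall>\<xi>\<in>K. \<xi> < a \<and> k < rho a \<xi>))"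
  have "\<exists>\<gamma><\<nu>. ?P k \<gamma>" if k: "k < \<theta>" for k
  proof (rule ccontr)
    assume "\<not> ?thesis"
    then have neg: "\<not> ?P k \<gamma>" if "\<gamma> < \<nu>" for \<gamma> using that by blast
    define bad where "bad \<gamma> w \<longleftrightarrow> finite (fst w) \<and> fst w \<subseteq> {\<gamma><..<\<nu>} \<and> snd w < \<nu> \<and>
      \<not> (\<exists>a\<in>A. snd w < a \<and> (\<forall>\<xi>\<in>fst w. \<xi> < a \<and> k < rho a \<xi>))" for \<gamma> and w :: "'a set \<times> 'a"
    have "\<forall>\<gamma>\<in>{..<\<nu>}. \<exists>w. bad \<gamma> w"
    proof
      fix \<gamma> assume "\<gamma> \<in> {..<\<nu>}"
      then obtain K \<zeta> where "finite K \<and> K \<subseteq> {\<gamma><..<\<nu>} \<and> \<zeta> < \<nu>"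
        "\<not> (\<exists>a\<in>A. \<zeta> < a \<and> (\<forall>\<xi>\<in>K. \<xi> < a \<and> k < rho a \<xi>))" using neg[of \<gamma>] by auto
      then have "bad \<gamma> (K, \<zeta>)" by (auto simp: bad_def)
      then show "\<exists>w. bad \<gamma> w" by blast
    qed
    from bchoice[OF this] obtain w where w: "\<forall>\<gamma>\<in>{..<\<nu>}. bad \<gamma> (w \<gamma>)" ..
    define K where "K \<gamma> = fst (w \<gamma>)" for \<gamma>
    define \<zeta> where "\<zeta> \<gamma> = snd (w \<gamma>)" for \<gamma>
    have K: "finite (K \<gamma>) \<and> K \<gamma> \<subseteq> {\<gamma><..<\<nu>} \<and> \<zeta> \<gamma> < \<nu> \<and>
      \<not> (\<exists>a\<in>A. \<zeta> \<gamma> < a \<and> (\<forall>\<xi>\<in>K \<gamma>. \<xi> < a \<and> k < rho a \<xi>))" if "\<gamma> < \<nu>" for \<gamma>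
      using w that by (auto simp: bad_def K_def \<zeta>_def)
    have "\<exists>b<\<nu>. \<forall>x\<in>insert (\<zeta> \<gamma>) (K \<gamma>). x < b" if "\<gamma> < \<nu>" for \<gamma>
      using K[OF that] by (intro \<nu>_finite_bound) auto
    then have "\<forall>\<gamma>\<in>{..<\<nu>}. \<exists>b. b < \<nu> \<and> (\<forall>x\<in>insert (\<zeta> \<gamma>) (K \<gamma>). x < b)" by blast
    from bchoice[OF this] obtain h
      where h: "\<And>\<gamma>. \<gamma> < \<nu> \<Longrightarrow> h \<gamma> < \<nu> \<and> (\<forall>x\<in>insert (\<zeta> \<gamma>) (K \<gamma>). x < h \<gamma>)" by blast
    obtain \<delta> where \<delta>: "\<delta> \<in> Scof" "\<forall>\<eta><\<delta>. h \<eta> < \<delta>" using statD[OF Scof_stat, of h] h by blast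
    have \<delta>\<nu>: "\<delta> < \<nu>" using Scof_less[OF \<delta>(1)] .
    obtain a where a: "a \<in> A" "\<delta> < a" "a < \<nu>" using unboundedD[OF A \<delta>\<nu>] by blast
    have "small {\<xi>. \<xi> < a \<and> rho a \<xi> \<le> k}" using rho_small[OF a(3) k] .
    then have "small {\<xi>. \<xi> < \<delta> \<and> rho a \<xi> \<le> k}" by (rule small_mono) (use a in auto)
    then obtain \<gamma> where \<gamma>: "\<gamma> < \<delta>" "\<forall>\<xi>\<in>{\<xi>. \<xi> < \<delta> \<and> rho a \<xi> \<le> k}. \<xi> < \<gamma>"
      using Scof_bound[OF \<delta>(1), of "{\<xi>. \<xi> < \<delta> \<and> rho a \<xi> \<le> k}"] by auto
    have \<gamma>\<nu>: "\<gamma> < \<nu>" using \<gamma>(1) \<delta>\<nu> by simp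
    have h\<gamma>: "h \<gamma> < \<delta>" using \<delta>(2) \<gamma>(1) by blast
    have "\<zeta> \<gamma> < a" using h[OF \<gamma>\<nu>] h\<gamma> a(2) by (meson insertI1 less_trans)
    then obtain \<xi> where \<xi>: "\<xi> \<in> K \<gamma>" "\<not> (\<xi> < a \<and> k < rho a \<xi>)" using K[OF \<gamma>\<nu>] a(1) by blast
    have "\<xi> < \<delta>" using h[OF \<gamma>\<nu>] h\<gamma> \<xi>(1) by (meson insertI2 less_trans)
    moreover have "rho a \<xi> \<le> k" using \<xi>(2) a(2) \<open>\<xi> < \<delta>\<close> by (meson less_trans not_less)
    ultimately have "\<xi> < \<gamma>" using \<gamma>(2) by blast
    moreover have "\<gamma> < \<xi>" using K[OF \<gamma>\<nu>] \<xi>(1) by auto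
    ultimately show False by simp
  qed
  then have "\<forall>k\<in>{..<\<theta>}. \<exists>\<gamma>. \<gamma> < \<nu> \<and> ?P k \<gamma>" by blast
  from bchoice[OF this] obtain g where g: "\<forall>k\<in>{..<\<theta>}. g k < \<nu> \<and> ?P k (g k)" ..
  have "g ` {..<\<theta>} \<subseteq> {..<\<nu>}" using g by blast
  then obtain \<gamma> where \<gamma>: "\<gamma> < \<nu>" "\<forall>x\<in>g ` {..<\<theta>}. x < \<gamma>"
    using \<nu>_bound[of "g ` {..<\<theta>}"] moderate_image[OF moderate_\<theta>, of g] by metis
  have "large_above A \<gamma>" unfolding large_above_def
  proof safe
    fix K k \<zeta> assume *: "finite K" "K \<subseteq> {\<gamma><..<\<nu>}" "k < \<theta>" "\<zeta> < \<nu>"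
    have "g k < \<gamma>" using \<gamma>(2) *(3) by auto
    then have "x \<in> {g k<..<\<nu>}" if "x \<in> K" for x
      using subsetD[OF *(2) that] by (auto intro: less_trans)
    then have "K \<subseteq> {g k<..<\<nu>}" by blast
    moreover have "?P k (g k)" using g *(3) by blast
    ultimately show "\<exists>a\<in>A. \<zeta> < a \<and> (\<forall>\<xi>\<in>K. \<xi> < a \<and> k < rho a \<xi>)" using *(1,4) by blast
  qed
  then show ?thesis using \<gamma>(1) by blast
qed

text \<open>The consequences needed from an elementary submodel that contains A and T and has trace
  \<delta> on \<nu>.\<close>

definition reflecting :: "'a set \<Rightarrow> 'a set \<Rightarrow> 'a \<Rightarrow> bool" where
  "reflecting A T \<delta> \<longleftrightarrow> \<delta> \<in> Scof \<and>
     (\<forall>F p q g. set F \<subseteq> {..<\<delta>} \<and> set p \<subseteq> {..<\<theta>} \<and> set q \<subseteq> {..<\<theta>} \<and> g < \<delta> \<longrightarrow>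
        (\<delta> \<in> low_below A T F p q g \<longrightarrow> (\<forall>\<eta><\<delta>. \<exists>z\<in>low_below A T F p q g. \<eta> < z \<and> z < \<delta>)) \<and>
        ((\<exists>a\<in>prescribed A F p. \<delta> \<le> a) \<longrightarrow> (\<forall>\<eta><\<delta>. \<exists>a\<in>prescribed A F p. \<eta> < a \<and> a < \<delta>)
           \<and> (\<exists>\<gamma><\<delta>. large_above (prescribed A F p) \<gamma>)))"

lemma ex_reflecting:
  assumes A: "A \<subseteq> {..<\<nu>}"
  shows "\<exists>\<delta>. reflecting A T \<delta>"
proof -
  define P where "P \<eta> = {..<3::nat} \<times> lists {..\<eta>} \<times> lists {..<\<theta>} \<times> lists {..<\<theta>} \<times> {..\<eta>}" for \<eta> :: 'a
  define \<gamma> where "\<gamma> F p = (SOME \<gamma>. \<gamma> < \<nu> \<and> large_above (prescribed A F p) \<gamma>)" for F p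
  have \<gamma>: "\<gamma> F p < \<nu> \<and> large_above (prescribed A F p) (\<gamma> F p)" if "unbounded (prescribed A F p)" for F p
    unfolding \<gamma>_def using someI_ex[OF ex_large_above[OF that]] by simp
  \<comment> \<open>The third family consists of singletons so that reflection also locates the
    chosen threshold: a singleton is never unbounded, hence its element cannot be at or above
    \<delta>.\<close>
  define Z where "Z = (\<lambda>(i::nat, F, p, q, g). if i = 0 then low_below A T F p q g
     else if i = 1 then prescribed A F p
     else if unbounded (prescribed A F p) then {\<gamma> F p} else ({} :: 'a set))"
  have "\<exists>\<delta>\<in>Scof. \<forall>\<eta><\<delta>. \<forall>x\<in>P \<eta>. ((\<exists>z\<in>Z x. \<delta> \<le> z) \<longrightarrow> unbounded (Z x))
            \<and> (unbounded (Z x) \<longrightarrow> (\<forall>\<eta><\<delta>. \<exists>z\<in>Z x. \<eta> < z \<and> z < \<delta>))"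
  proof (rule stat_reflect[OF Scof_stat])
    show "moderate (P \<eta>)" if "\<eta> < \<nu>" for \<eta>
      unfolding P_def using that
      by (intro moderate_Times moderate_lists moderate_atMost moderate_\<theta>)
        (auto intro: small_moderate finite_small)
    show "P \<eta> \<subseteq> P \<eta>'" if "\<eta> \<le> \<eta>'" for \<eta> \<eta>'
      unfolding P_def using that lists_mono[of "{..\<eta>}" "{..\<eta>'}"] by fastforce
    show "Z x \<subseteq> {..<\<nu>}" for x
      using A \<gamma> by (auto simp: Z_def low_below_def prescribed_def split: prod.splits if_splits)
  qed
  then obtain \<delta> :: 'a where \<delta>: "\<delta> \<in> Scof" and refl: "\<And>\<eta> x. \<eta> < \<delta> \<Longrightarrow> x \<in> P \<eta> \<Longrightarrow>
      ((\<exists>z\<in>Z x. \<delta> \<le> z) \<longrightarrow> unbounded (Z x)) \<and> (unbounded (Z x) \<longrightarrow> (\<forall>\<eta><\<delta>. \<exists>z\<in>Z x. \<eta> < z \<and> z < \<delta>))"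
    by blast
  have "reflecting A T \<delta>"
    unfolding reflecting_def
  proof (intro conjI \<delta> allI impI)
    fix F p q g assume *: "set F \<subseteq> {..<\<delta>} \<and> set p \<subseteq> {..<\<theta>} \<and> set q \<subseteq> {..<\<theta>} \<and> g < \<delta>"
    obtain \<eta> where \<eta>: "\<eta> < \<delta>" "\<forall>x\<in>insert g (set F). x < \<eta>"
      using Scof_finite_bound[OF \<delta>, of "insert g (set F)"] * by auto
    have "(i, F, p, q, g) \<in> P \<eta>" if "i < 3" for i
      unfolding P_def using that * \<eta> by (auto simp: lists_eq_set less_imp_le)
    note R = refl[OF \<eta>(1) this]
    show "\<exists>z\<in>low_below A T F p q g. \<eta> < z \<and> z < \<delta>" if "\<delta> \<in> low_below A T F p q g" "\<eta> < \<delta>" for \<eta>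
      using R[of 0] that by (auto simp: Z_def)
    assume "\<exists>a\<in>prescribed A F p. \<delta> \<le> a"
    then have u: "unbounded (prescribed A F p)" using R[of 1] by (auto simp: Z_def)
    then show "\<exists>a\<in>prescribed A F p. \<eta> < a \<and> a < \<delta>" if "\<eta> < \<delta>" for \<eta>
      using R[of 1] that by (auto simp: Z_def)
    have "\<not> unbounded {\<gamma> F p}"
      using \<gamma>[OF u] unboundedD[of "{\<gamma> F p}" "\<gamma> F p"] by auto
    then have "\<gamma> F p < \<delta>" using R[of 2] u by (auto simp: Z_def not_le)
    then show "\<exists>\<gamma><\<delta>. large_above (prescribed A F p) \<gamma>" using \<gamma>[OF u] by blast
  qed
  then show ?thesis by blast
qed

lemma reflecting_Scof: "reflecting A T \<delta> \<Longrightarrow> \<delta> \<in> Scof"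
  by (simp add: reflecting_def)

text \<open>Otherwise \<open>\<delta>\<close> lies in \<open>low_below\<close>, hence is a limit of it, and \<open>Cs \<delta>\<close> is bounded by \<open>g\<close>.\<close>

lemma matching_above:
  assumes \<delta>: "reflecting A T \<delta>" and *: "set F \<subseteq> {..<\<delta>}" "set p \<subseteq> {..<\<theta>}" "set q \<subseteq> {..<\<theta>}" "g < \<delta>"
    and mem: "\<delta> \<in> matching A T F p q g"
  shows "\<exists>d\<in>matching A T F p q g. \<delta> < d \<and> (\<exists>c\<in>Cs d. g < c \<and> c < \<delta>)"
proof (rule ccontr)
  assume neg: "\<not> ?thesis"
  have \<delta>S: "\<delta> \<in> Scof" using reflecting_Scof[OF \<delta>] .
  have "\<delta> \<in> low_below A T F p q g"
    unfolding low_below_def using neg Scof_less[OF \<delta>S] by (auto simp: not_less) (meson leD leI)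
  then have low: "\<exists>z\<in>low_below A T F p q g. \<eta> < z \<and> z < \<delta>" if "\<eta> < \<delta>" for \<eta>
    using \<delta> * that unfolding reflecting_def by blast
  obtain g' where g': "g' < \<delta>" "g < g'" using Scof_finite_bound[OF \<delta>S, of "{g}"] *(4) by auto
  obtain c where c: "c \<in> Cs \<delta>" "g' \<le> c" using Cs_cofinal[OF Scof_less[OF \<delta>S] g'(1)] by auto
  obtain z where z: "z \<in> low_below A T F p q g" "c < z" "z < \<delta>" using low[OF Cs_less[OF c(1)]] by auto
  then have "c \<le> g" using mem c(1) unfolding low_below_def by blast
  then show False using c(2) g'(2) by simp
qed

text \<open>A point d above \<delta> carries a copy (a', b') of the situation (a, b). Walking on
  from d to \<delta> adds a nonempty piece K above the coherence threshold, so a' and b' agree on K.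
  Exchanging a' for some a'' at which \<open>rho\<close> exceeds all values of \<open>rho b'\<close>
  on K makes them disagree throughout K. In both cases the old entries keep their values.\<close>

lemma extend:
  assumes \<delta>: "reflecting A T \<delta>" and A: "A \<subseteq> {..<\<nu>}" and T: "T \<subseteq> {..<\<nu>}"
    and a: "a \<in> A" "\<delta> < a" and b: "b \<in> T" "\<delta> < b"
  obtains a' a'' b' K where "a' \<in> A" "\<delta> < a'" "a'' \<in> A" "\<delta> < a''" "b' \<in> T" "\<delta> < b'"
      "L \<delta> b' = L \<delta> b @ K" "K \<noteq> []" "map (rho b') (L \<delta> b) = map (rho b) (L \<delta> b)"
      "map (rho a') (L \<delta> b) = map (rho a) (L \<delta> b)" "\<forall>\<xi>\<in>set K. rho a' \<xi> = rho b' \<xi>"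
      "map (rho a'') (L \<delta> b) = map (rho a) (L \<delta> b)" "\<forall>\<xi>\<in>set K. rho a'' \<xi> \<noteq> rho b' \<xi>"
proof -
  have \<delta>S: "\<delta> \<in> Scof" and \<delta>\<nu>: "\<delta> < \<nu>" using reflecting_Scof[OF \<delta>] Scof_less by auto
  have a\<nu>: "a < \<nu>" and b\<nu>: "b < \<nu>" using a b A T by auto
  define F where "F = L \<delta> b"
  define p where "p = map (rho a) F"
  define q where "q = map (rho b) F"
  have F: "set F \<subseteq> {..<\<delta>}" unfolding F_def using L_less[OF \<delta>S b\<nu>] by auto
  have p: "set p \<subseteq> {..<\<theta>}" unfolding p_def using rho_less[OF a\<nu>] F a(2) by (auto intro: less_trans)
  have q: "set q \<subseteq> {..<\<theta>}" unfolding q_def using rho_less[OF b\<nu>] F b(2) by (auto intro: less_trans)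
  obtain \<gamma> where \<gamma>: "\<gamma> < \<delta>" "\<forall>\<xi>. \<gamma> \<le> \<xi> \<and> \<xi> < \<delta> \<longrightarrow> rho a \<xi> = rho b \<xi>"
    using rho_coherent[OF \<delta>S _ a\<nu> _ b\<nu>] a b by (meson less_imp_le)
  have "a \<in> prescribed A F p" using a by (simp add: prescribed_def p_def)
  then have "\<exists>a\<in>prescribed A F p. \<delta> \<le> a" using a(2) by (meson less_imp_le)
  then obtain \<gamma>1 where \<gamma>1: "\<gamma>1 < \<delta>" "large_above (prescribed A F p) \<gamma>1"
    using \<delta> F p q \<gamma>(1) unfolding reflecting_def by blast
  \<comment> \<open>One g beyond the coherence threshold \<gamma>, the largeness threshold \<gamma>1
    and the old entries: the new piece lies above g, so all three are available on it.\<close>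
  obtain g where g: "g < \<delta>" "\<forall>x\<in>{\<gamma>, \<gamma>1} \<union> set F. x < g"
    using Scof_finite_bound[OF \<delta>S, of "{\<gamma>, \<gamma>1} \<union> set F"] \<gamma>(1) \<gamma>1(1) F by auto
  have "\<delta> \<in> matching A T F p q g"
  proof -
    have "rho a \<xi> = rho b \<xi>" if "g < \<xi>" "\<xi> < \<delta>" for \<xi>
      using \<gamma>(2) g(2) that by (meson UnI1 insertI1 less_imp_le less_trans)
    then have "\<delta> < a \<and> \<delta> < b \<and> L \<delta> b = F \<and> map (rho a) F = p \<and> map (rho b) F = q
        \<and> (\<forall>\<xi>. g < \<xi> \<and> \<xi> < \<delta> \<longrightarrow> rho a \<xi> = rho b \<xi>)"
      using a b by (simp add: F_def p_def q_def)
    then show ?thesis unfolding matching_def using \<delta>S a(1) b(1) by blast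
  qed
  then obtain d c where d: "d \<in> matching A T F p q g" "\<delta> < d" "c \<in> Cs d" "g < c" "c < \<delta>"
    using matching_above[OF \<delta> F p q g(1)] by blast
  then obtain a' b' where ab: "a' \<in> A" "b' \<in> T" "d < a'" "d < b'" "L d b' = F"
    "map (rho a') F = p" "map (rho b') F = q" "\<forall>\<xi>. g < \<xi> \<and> \<xi> < d \<longrightarrow> rho a' \<xi> = rho b' \<xi>"
    unfolding matching_def by blast
  have d\<nu>: "d < \<nu>" using d(1) Scof_less unfolding matching_def by blast
  have b'\<nu>: "b' < \<nu>" using ab(2) T by auto
  define K where "K = L \<delta> d"
  have Lb: "L \<delta> b' = F @ K \<and> K \<noteq> [] \<and> (\<forall>x\<in>set K. g < x)"
    unfolding K_def ab(5)[symmetric]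
    by (rule L_pass(2)[OF d(2) ab(4) b'\<nu> _ g(1) d(3,5,4)]) (use ab(5) g(2) in auto)
  have K\<delta>: "x < \<delta>" if "x \<in> set K" for x using that L_less[OF \<delta>S d\<nu>] by (auto simp: K_def)
  have Kb: "rho b' x < \<theta>" if "x \<in> set K" for x
    using K\<delta>[OF that] d(2) ab(4) b'\<nu> by (intro rho_less) auto
  have "small (rho b' ` set K)" by (rule finite_small) simp
  then obtain k where k: "k < \<theta>" "\<forall>y\<in>rho b' ` set K. y < k"
    using \<theta>_bound[of "rho b' ` set K"] Kb by auto
  have "set K \<subseteq> {\<gamma>1<..<\<nu>}"
  proof
    fix x assume x: "x \<in> set K"
    have "\<gamma>1 < x" using g(2) Lb x by (meson UnI1 insertI1 insertI2 less_trans)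
    moreover have "x < \<nu>" using K\<delta>[OF x] \<delta>\<nu> by simp
    ultimately show "x \<in> {\<gamma>1<..<\<nu>}" by simp
  qed
  then obtain a'' where a'': "a'' \<in> prescribed A F p" "\<delta> < a''" "\<forall>\<xi>\<in>set K. \<xi> < a'' \<and> k < rho a'' \<xi>"
    using \<gamma>1(2) k(1) \<delta>\<nu> unfolding large_above_def by (meson List.finite_set)
  show thesis
  proof (rule that[of a' a'' b' K])
    show "a' \<in> A" "b' \<in> T" "\<delta> < a'" "\<delta> < b'" using ab d(2) by auto
    show "a'' \<in> A" "\<delta> < a''" "map (rho a'') (L \<delta> b) = map (rho a) (L \<delta> b)"
      using a'' by (auto simp: prescribed_def F_def p_def)
    show "L \<delta> b' = L \<delta> b @ K" "K \<noteq> []" using Lb by (auto simp: F_def)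
    show "map (rho b') (L \<delta> b) = map (rho b) (L \<delta> b)" "map (rho a') (L \<delta> b) = map (rho a) (L \<delta> b)"
      using ab(6,7) by (simp_all add: F_def p_def q_def)
    show "\<forall>\<xi>\<in>set K. rho a' \<xi> = rho b' \<xi>"
    proof
      fix \<xi> assume \<xi>: "\<xi> \<in> set K"
      then show "rho a' \<xi> = rho b' \<xi>" using ab(8) Lb K\<delta>[OF \<xi>] d(2) by (meson less_trans)
    qed
    show "\<forall>\<xi>\<in>set K. rho a'' \<xi> \<noteq> rho b' \<xi>"
    proof
      fix \<xi> assume \<xi>: "\<xi> \<in> set K"
      then have "rho b' \<xi> < k" "k < rho a'' \<xi>" using k(2) a''(3) by auto
      then show "rho a'' \<xi> \<noteq> rho b' \<xi>" by simp
    qed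
  qed
qed

text \<open>The end \<delta> of the walk is kept apart from a, since the chain below is built over a
  fixed \<delta> while a changes; they are identified only in \<open>oscillation\<close>.\<close>

definition marks :: "'a \<Rightarrow> 'a \<Rightarrow> 'a \<Rightarrow> bool list" where
  "marks \<delta> a b = map (\<lambda>\<xi>. rho a \<xi> \<noteq> rho b \<xi>) (L \<delta> b)"

lemma marks_extend:
  assumes "L \<delta> b' = L \<delta> b @ K" "map (rho b') (L \<delta> b) = map (rho b) (L \<delta> b)"
    "map (rho a') (L \<delta> b) = map (rho a) (L \<delta> b)"
  shows "marks \<delta> a' b' = marks \<delta> a b @ map (\<lambda>\<xi>. rho a' \<xi> \<noteq> rho b' \<xi>) K"
proof -
  have "rho a' \<xi> = rho a \<xi>" "rho b' \<xi> = rho b \<xi>" if "\<xi> \<in> set (L \<delta> b)" for \<xi>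
    using assms(2,3) that by (auto simp: map_eq_conv)
  then show ?thesis unfolding marks_def assms(1) map_append by (simp cong: map_cong)
qed

lemma last_marks_False: "K \<noteq> [] \<Longrightarrow> \<forall>\<xi>\<in>set K. \<not> P \<xi> \<Longrightarrow> \<not> last (s # xs @ map P K)"
  by (simp add: last_map)

text \<open>The next value is obtained by an extension on which all marks are true, followed by one on
  which all marks are false.\<close>

lemma oscillation_chain:
  assumes \<delta>: "reflecting A T \<delta>" and A: "unbounded A" and T: "unbounded T"
  shows "\<exists>a\<in>A. \<delta> < a \<and> (\<exists>n. \<exists>b. \<forall>m\<le>l. b m \<in> T \<and> \<delta> < b m \<and> set (L \<delta> (b m)) \<subseteq> set (L \<delta> (b l)) \<and>
           rises False (marks \<delta> a (b m)) = n + m \<and> \<not> last (False # marks \<delta> a (b m)))"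
proof (induction l)
  have sub: "A \<subseteq> {..<\<nu>}" "T \<subseteq> {..<\<nu>}" using A T by (auto simp: unbounded_def)
  {
    case 0
    have \<delta>\<nu>: "\<delta> < \<nu>" using reflecting_Scof[OF \<delta>] Scof_less by auto
    obtain a where a: "a \<in> A" "\<delta> < a" using unboundedD[OF A \<delta>\<nu>] by blast
    obtain b where b: "b \<in> T" "\<delta> < b" using unboundedD[OF T \<delta>\<nu>] by blast
    obtain a' b' K where *: "a' \<in> A" "\<delta> < a'" "b' \<in> T" "\<delta> < b'" "L \<delta> b' = L \<delta> b @ K" "K \<noteq> []"
      "map (rho b') (L \<delta> b) = map (rho b) (L \<delta> b)"
      "map (rho a') (L \<delta> b) = map (rho a) (L \<delta> b)" "\<forall>\<xi>\<in>set K. rho a' \<xi> = rho b' \<xi>"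
      by (rule extend[OF \<delta> sub a b])
    \<comment> \<open>Ending with agreement makes the last mark false, so that the next block of
      true marks adds exactly one rise.\<close>
    have "\<not> last (False # marks \<delta> a' b')"
      unfolding marks_extend[OF *(5,7,8)] using *(6,9) by (intro last_marks_False) auto
    then show ?case using *(1-4)
      by (intro bexI[of _ a'] conjI exI[of _ "rises False (marks \<delta> a' b')"] exI[of _ "\<lambda>_. b'"]) auto
  next
    case (Suc l)
    then obtain a n b where a: "a \<in> A" "\<delta> < a" and b: "\<forall>m\<le>l. b m \<in> T \<and> \<delta> < b m \<and>
        set (L \<delta> (b m)) \<subseteq> set (L \<delta> (b l)) \<and>
        rises False (marks \<delta> a (b m)) = n + m \<and> \<not> last (False # marks \<delta> a (b m))" by blast
    have bl: "b l \<in> T" "\<delta> < b l" "rises False (marks \<delta> a (b l)) = n + l"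
      "\<not> last (False # marks \<delta> a (b l))" using b by auto
    obtain a1 b1 K1 where 1: "a1 \<in> A" "\<delta> < a1" "b1 \<in> T" "\<delta> < b1" "L \<delta> b1 = L \<delta> (b l) @ K1" "K1 \<noteq> []"
      "map (rho b1) (L \<delta> (b l)) = map (rho (b l)) (L \<delta> (b l))"
      "map (rho a1) (L \<delta> (b l)) = map (rho a) (L \<delta> (b l))" "\<forall>\<xi>\<in>set K1. rho a1 \<xi> \<noteq> rho b1 \<xi>"
      by (rule extend[OF \<delta> sub a bl(1,2)])
    obtain a2 b2 K2 where 2: "a2 \<in> A" "\<delta> < a2" "b2 \<in> T" "\<delta> < b2" "L \<delta> b2 = L \<delta> b1 @ K2" "K2 \<noteq> []"
      "map (rho b2) (L \<delta> b1) = map (rho b1) (L \<delta> b1)"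
      "map (rho a2) (L \<delta> b1) = map (rho a1) (L \<delta> b1)" "\<forall>\<xi>\<in>set K2. rho a2 \<xi> = rho b2 \<xi>"
      by (rule extend[OF \<delta> sub 1(1-4)])
    have m1: "marks \<delta> a1 b1 = marks \<delta> a (b l) @ map (\<lambda>\<xi>. rho a1 \<xi> \<noteq> rho b1 \<xi>) K1"
      by (rule marks_extend[OF 1(5,7,8)])
    have m2: "marks \<delta> a2 b2 = marks \<delta> a1 b1 @ map (\<lambda>\<xi>. rho a2 \<xi> \<noteq> rho b2 \<xi>) K2"
      by (rule marks_extend[OF 2(5,7,8)])
    have "rises False (map (\<lambda>\<xi>. rho a1 \<xi> \<noteq> rho b1 \<xi>) K1) = 1"
      using 1(6,9) by (intro rises_False_True) auto
    then have r1: "rises False (marks \<delta> a1 b1) = n + Suc l"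
      unfolding m1 rises_append using bl(3,4) by simp
    have "rises s (map (\<lambda>\<xi>. rho a2 \<xi> \<noteq> rho b2 \<xi>) K2) = 0" for s
      using 2(9) by (intro rises_False) auto
    then have r2: "rises False (marks \<delta> a2 b2) = n + Suc l"
      unfolding m2 rises_append using r1 by simp
    have l2: "\<not> last (False # marks \<delta> a2 b2)"
      unfolding m2 using 2(6,9) by (intro last_marks_False) auto
    have agree: "rho a2 \<xi> = rho a \<xi>" if "\<xi> \<in> set (L \<delta> (b l))" for \<xi>
      using 1(5,8) 2(8) that by auto
    \<comment> \<open>All earlier traces are contained in that of \<open>b l\<close>, on which a2
      agrees with a. Thus the values already obtained survive the change of a, and a single a
      realises all of them.\<close>
    have old: "marks \<delta> a2 (b m) = marks \<delta> a (b m)" if "m \<le> l" for m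
    proof -
      have "rho a2 \<xi> = rho a \<xi>" if "\<xi> \<in> set (L \<delta> (b m))" for \<xi>
        using b \<open>m \<le> l\<close> agree that by blast
      then show ?thesis unfolding marks_def by (simp cong: map_cong)
    qed
    let ?b = "b(Suc l := b2)"
    have "?b m \<in> T \<and> \<delta> < ?b m \<and> set (L \<delta> (?b m)) \<subseteq> set (L \<delta> (?b (Suc l))) \<and>
        rises False (marks \<delta> a2 (?b m)) = n + m \<and> \<not> last (False # marks \<delta> a2 (?b m))"
      if "m \<le> Suc l" for m
    proof (cases "m = Suc l")
      case True
      then show ?thesis using 2(3,4) r2 l2 by simp
    next
      case False
      then have m: "m \<le> l" using that by simp
      then have "set (L \<delta> (b m)) \<subseteq> set (L \<delta> b2)" using b 1(5) 2(5) by auto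
      then show ?thesis using b m False old[OF m] by simp
    qed
    then show ?case using 2(1,2) by blast
  }
qed

text \<open>In the chain the walks end at some \<delta> below a. To make them end at the first
  coordinate itself, a is reflected to an \<alpha> in A below \<delta> with the same
  \<open>rho\<close> on all the entries. Each walk then continues from \<delta> to \<alpha>, which
  only translates the interval of values.\<close>

lemma oscillation:
  assumes A: "unbounded A" "A \<subseteq> Scof" and T: "unbounded T"
  shows "\<exists>a\<in>A. \<exists>n. \<forall>m\<le>l. \<exists>b\<in>T. a < b \<and> rises False (marks a a b) = n + m"
proof -
  have sub: "A \<subseteq> {..<\<nu>}" "T \<subseteq> {..<\<nu>}" using A T by (auto simp: unbounded_def)
  obtain \<delta> where \<delta>: "reflecting A T \<delta>" using ex_reflecting[OF sub(1)] by blast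
  have \<delta>S: "\<delta> \<in> Scof" and \<delta>\<nu>: "\<delta> < \<nu>" using reflecting_Scof[OF \<delta>] Scof_less by auto
  obtain a n b where a: "a \<in> A" "\<delta> < a" and b: "\<And>m. m \<le> l \<Longrightarrow> b m \<in> T \<and> \<delta> < b m \<and>
      set (L \<delta> (b m)) \<subseteq> set (L \<delta> (b l)) \<and>
      rises False (marks \<delta> a (b m)) = n + m \<and> \<not> last (False # marks \<delta> a (b m))"
    using oscillation_chain[OF \<delta> A(1) T, of l] by blast
  have b\<nu>: "b m < \<nu>" if "m \<le> l" for m using b[OF that] sub by auto
  define F where "F = L \<delta> (b l)"
  define p where "p = map (rho a) F"
  have F: "set F \<subseteq> {..<\<delta>}" unfolding F_def using L_less[OF \<delta>S b\<nu>[of l]] by auto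
  have a\<nu>: "a < \<nu>" using a sub by auto
  have p: "set p \<subseteq> {..<\<theta>}" unfolding p_def using rho_less[OF a\<nu>] F a(2) by (auto intro: less_trans)
  have "\<forall>m\<in>{..l}. \<exists>\<gamma>. \<gamma> < \<delta> \<and> (\<forall>\<xi>. \<gamma> \<le> \<xi> \<and> \<xi> < \<delta> \<longrightarrow> rho (b m) \<xi> = rho \<delta> \<xi>)"
    using rho_coherent[OF \<delta>S _ b\<nu> _ \<delta>\<nu>] b by (auto simp: less_imp_le)
  from bchoice[OF this] obtain g where g: "\<forall>m\<in>{..l}. g m < \<delta> \<and>
    (\<forall>\<xi>. g m \<le> \<xi> \<and> \<xi> < \<delta> \<longrightarrow> rho (b m) \<xi> = rho \<delta> \<xi>)" ..
  obtain \<gamma> where \<gamma>: "\<gamma> < \<delta>" "\<forall>x\<in>g ` {..l} \<union> set F. x < \<gamma>"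
    using Scof_finite_bound[OF \<delta>S, of "g ` {..l} \<union> set F"] g F by auto
  obtain \<gamma>' where \<gamma>': "\<gamma>' < \<delta>" "\<gamma> < \<gamma>'" using Scof_finite_bound[OF \<delta>S, of "{\<gamma>}"] \<gamma>(1) by auto
  obtain c where c: "c \<in> Cs \<delta>" "\<gamma>' \<le> c" using Cs_cofinal[OF \<delta>\<nu> \<gamma>'(1)] by auto
  have c\<delta>: "c < \<delta>" using Cs_less[OF c(1)] .
  have "a \<in> prescribed A F p" using a by (simp add: prescribed_def p_def)
  then have "\<exists>a\<in>prescribed A F p. \<delta> \<le> a" using a(2) by (meson less_imp_le)
  then obtain \<alpha> where \<alpha>: "\<alpha> \<in> prescribed A F p" "c < \<alpha>" "\<alpha> < \<delta>"
    using \<delta> F p \<gamma>(1) c\<delta> unfolding reflecting_def by (metis empty_set empty_subsetI)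
  have \<alpha>A: "\<alpha> \<in> A" "map (rho \<alpha>) F = map (rho a) F"
    using \<alpha>(1) by (auto simp: prescribed_def p_def)
  have \<alpha>S: "\<alpha> \<in> Scof" using \<alpha>A A(2) by auto
  have \<gamma>c: "\<gamma> < c" using \<gamma>'(2) c(2) by simp
  \<comment> \<open>The contribution of the walk from \<delta> to \<alpha>. It is the same for every
    m: there all the functions \<open>rho (b m)\<close> coincide with \<open>rho \<delta>\<close>,
    and each head ends with a false mark.\<close>
  let ?t = "rises False (map (\<lambda>\<xi>. rho \<alpha> \<xi> \<noteq> rho \<delta> \<xi>) (L \<alpha> \<delta>))"
  have "b m \<in> T \<and> \<alpha> < b m \<and> rises False (marks \<alpha> \<alpha> (b m)) = n + ?t + m" if m: "m \<le> l" for m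
  proof -
    have Lm: "set (L \<delta> (b m)) \<subseteq> set F" using b[OF m] by (simp add: F_def)
    have L: "L \<alpha> (b m) = L \<delta> (b m) @ L \<alpha> \<delta> \<and> L \<alpha> \<delta> \<noteq> [] \<and> (\<forall>x\<in>set (L \<alpha> \<delta>). \<gamma> < x)"
    proof (rule L_pass(2)[OF \<alpha>(3) _ b\<nu>[OF m] _ _ c(1) \<alpha>(2) \<gamma>c])
      show "\<delta> < b m" using b[OF m] by simp
      show "\<forall>x\<in>set (L \<delta> (b m)). x \<le> \<gamma>" using Lm \<gamma>(2) by (auto simp: less_imp_le)
      show "\<gamma> < \<alpha>" using \<gamma>c \<alpha>(2) by simp
    qed
    have tail: "rho (b m) \<xi> = rho \<delta> \<xi>" if \<xi>: "\<xi> \<in> set (L \<alpha> \<delta>)" for \<xi>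
    proof -
      have "g m < \<gamma>" using \<gamma>(2) m by auto
      then have "g m \<le> \<xi>" using L \<xi> by (meson less_imp_le less_trans)
      moreover have "\<xi> < \<delta>" using L_less[OF \<alpha>S \<delta>\<nu> \<xi>] \<alpha>(3) by simp
      ultimately show ?thesis using g m by auto
    qed
    have head: "rho \<alpha> \<xi> = rho a \<xi>" if "\<xi> \<in> set (L \<delta> (b m))" for \<xi>
      using \<alpha>A(2) Lm that by auto
    have "marks \<alpha> \<alpha> (b m) = marks \<delta> a (b m) @ map (\<lambda>\<xi>. rho \<alpha> \<xi> \<noteq> rho \<delta> \<xi>) (L \<alpha> \<delta>)"
      unfolding marks_def using L head tail by simp
    then have "rises False (marks \<alpha> \<alpha> (b m)) = n + m + ?t"
      using b[OF m] rises_append[of False "marks \<delta> a (b m)"] by simp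
    then show ?thesis using b[OF m] \<alpha>(3) by auto
  qed
  then show ?thesis using \<alpha>A(1) by (intro bexI[of _ \<alpha>] exI[of _ "n + ?t"]) auto
qed

end

section \<open>Guessing functions\<close>

text \<open>The 2-adic valuation of n > 0. \<open>oscillation\<close> gives all values in a long
  interval but not its position; a valuation k occurs in every interval of length depending on k
  alone.\<close>

definition two_val :: "nat \<Rightarrow> nat" where
  "two_val n = (LEAST k. odd (n div 2 ^ k))"

lemma two_val_interval: "\<exists>m\<le>2 ^ (k + 2). two_val (n + m) = k"
proof -
  \<comment> \<open>\<open>2 ^ (k + 1) * q\<close> is the first multiple of
    \<open>2 ^ (k + 1)\<close> beyond n; adding \<open>2 ^ k\<close> to it gives N, an odd multiple
    of \<open>2 ^ k\<close>.\<close>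
  define q where "q = n div 2 ^ (k + 1) + 1"
  define N where "N = 2 ^ k * (2 * q + 1)"
  have n: "n = 2 ^ (k + 1) * (n div 2 ^ (k + 1)) + n mod 2 ^ (k + 1)" by simp
  have r: "n mod 2 ^ (k + 1) < 2 ^ (k + 1)" by simp
  have "N = 2 ^ (k + 1) * (n div 2 ^ (k + 1)) + 2 ^ (k + 1) + 2 ^ k"
    by (simp add: N_def q_def algebra_simps)
  moreover have "(2::nat) ^ (k + 2) = 2 ^ (k + 1) + 2 ^ k + 2 ^ k" "(2::nat) ^ (k + 1) = 2 ^ k + 2 ^ k"
    by simp_all
  ultimately have N: "n \<le> N" "N \<le> n + 2 ^ (k + 2)" using n r by linarith+
  have "two_val N = k"
    unfolding two_val_def
  proof (rule Least_equality)
    show "odd (N div 2 ^ k)" by (simp add: N_def)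
    show "k \<le> j" if "odd (N div 2 ^ j)" for j
    proof (rule ccontr)
      assume "\<not> k \<le> j"
      then obtain i where i: "k = j + Suc i" by (metis add_Suc_right less_imp_Suc_add not_le)
      have "N div 2 ^ j = 2 ^ Suc i * (2 * q + 1)"
        by (simp add: N_def i power_add mult.assoc)
      then show False using that by simp
    qed
  qed
  then show ?thesis using N by (intro exI[of _ "N - n"]) auto
qed

context successor_cardinal
begin

definition osc_val :: "'a \<Rightarrow> 'a \<Rightarrow> nat" where
  "osc_val a b = two_val (rises False (marks a a b))"

text \<open>For a single \<tau> the set of bad a is bounded, because \<open>oscillation\<close>
  applied to it would find a good one in it. Any a of cofinality \<theta> above the \<theta> many
  bounds is good for every \<tau>.\<close>

lemma osc_val_hits:
  assumes T: "\<And>\<tau>. \<tau> < \<theta> \<Longrightarrow> unbounded (T \<tau>)"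
  shows "\<exists>a\<in>Scof. \<forall>\<tau><\<theta>. \<exists>b\<in>T \<tau>. osc_val a b = n \<tau>"
proof -
  define bad where "bad \<tau> = {a \<in> Scof. \<forall>b\<in>T \<tau>. osc_val a b \<noteq> n \<tau>}" for \<tau>
  have "\<not> unbounded (bad \<tau>)" if \<tau>: "\<tau> < \<theta>" for \<tau>
  proof
    assume "unbounded (bad \<tau>)"
    moreover have "bad \<tau> \<subseteq> Scof" by (auto simp: bad_def)
    ultimately obtain a k where a: "a \<in> bad \<tau>"
      and k: "\<forall>m\<le>2 ^ (n \<tau> + 2). \<exists>b\<in>T \<tau>. a < b \<and> rises False (marks a a b) = k + m"
      using oscillation[of "bad \<tau>" "T \<tau>"] T[OF \<tau>] by blast
    obtain m where "m \<le> 2 ^ (n \<tau> + 2)" "two_val (k + m) = n \<tau>" using two_val_interval by blast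
    then obtain b where "b \<in> T \<tau>" "osc_val a b = n \<tau>" using k by (auto simp: osc_val_def)
    then show False using a by (auto simp: bad_def)
  qed
  moreover have "bad \<tau> \<subseteq> {..<\<nu>}" for \<tau> using Scof_less by (auto simp: bad_def)
  ultimately have "\<forall>\<tau>\<in>{..<\<theta>}. \<exists>b. b < \<nu> \<and> (\<forall>x\<in>bad \<tau>. x < b)" using not_unbounded by (meson lessThan_iff)
  from bchoice[OF this] obtain B where B: "\<forall>\<tau>\<in>{..<\<theta>}. B \<tau> < \<nu> \<and> (\<forall>x\<in>bad \<tau>. x < B \<tau>)" ..
  have "B ` {..<\<theta>} \<subseteq> {..<\<nu>}" using B by auto
  then obtain c where c: "c < \<nu>" "\<forall>x\<in>B ` {..<\<theta>}. x < c"
    using \<nu>_bound moderate_image[OF moderate_\<theta>] by metis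
  obtain a where a: "a \<in> Scof" "c < a"
    using unboundedD[OF stat_unbounded[OF Scof_stat] c(1)] by blast
  have "a \<notin> bad \<tau>" if "\<tau> < \<theta>" for \<tau>
    using B c(2) a(2) that by (metis imageI lessThan_iff less_asym less_trans)
  then show ?thesis using a(1) by (auto simp: bad_def)
qed

lemma stat_mono: "stat R \<Longrightarrow> R \<subseteq> R' \<Longrightarrow> R' \<subseteq> Scof \<Longrightarrow> stat R'"
  unfolding stat_def by blast

text \<open>Ulam matrices: the \<open>j\<close>-th row of \<open>idx\<close> splits \<open>Scof\<close> into many stationary pieces, for some
  \<open>j < \<theta>\<close>.\<close>

lemma stationary_partition: "\<exists>lab. \<forall>\<tau><\<theta>. stat {\<delta> \<in> Scof. lab \<delta> = \<tau>}"
proof -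
  define U where "U j \<zeta> = {\<delta> \<in> Scof. \<zeta> < \<delta> \<and> idx \<delta> \<zeta> = j}" for j \<zeta>
  have "\<exists>j<\<theta>. stat (U j \<zeta>)" if \<zeta>: "\<zeta> < \<nu>" for \<zeta>
  proof (rule ccontr)
    assume neg: "\<not> ?thesis"
    have "\<forall>j\<in>{..<\<theta>}. \<exists>h. (\<forall>\<eta><\<nu>. h \<eta> < \<nu>) \<and> \<not> (\<exists>\<delta>\<in>U j \<zeta>. \<forall>\<eta><\<delta>. h \<eta> < \<delta>)"
    proof
      fix j assume "j \<in> {..<\<theta>}"
      then have "\<not> stat (U j \<zeta>)" using neg by auto
      moreover have "U j \<zeta> \<subseteq> Scof" by (auto simp: U_def)
      ultimately show "\<exists>h. (\<forall>\<eta><\<nu>. h \<eta> < \<nu>) \<and> \<not> (\<exists>\<delta>\<in>U j \<zeta>. \<forall>\<eta><\<delta>. h \<eta> < \<delta>)"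
        unfolding stat_def by blast
    qed
    from bchoice[OF this] obtain h where
      h: "\<forall>j\<in>{..<\<theta>}. (\<forall>\<eta><\<nu>. h j \<eta> < \<nu>) \<and> \<not> (\<exists>\<delta>\<in>U j \<zeta>. \<forall>\<eta><\<delta>. h j \<eta> < \<delta>)" ..
    have "\<exists>b. b < \<nu> \<and> \<zeta> < b \<and> (\<forall>j<\<theta>. h j \<eta> < b)" if "\<eta> < \<nu>" for \<eta>
    proof -
      have "moderate ({\<zeta>} \<union> (\<lambda>j. h j \<eta>) ` {..<\<theta>})"
        by (intro moderate_Un[OF small_moderate[OF finite_small]] moderate_image moderate_\<theta>) simp
      moreover have "{\<zeta>} \<union> (\<lambda>j. h j \<eta>) ` {..<\<theta>} \<subseteq> {..<\<nu>}" using h \<zeta> that by auto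
      ultimately obtain b where "b < \<nu>" "\<forall>x\<in>{\<zeta>} \<union> (\<lambda>j. h j \<eta>) ` {..<\<theta>}. x < b"
        using \<nu>_bound by metis
      then show ?thesis by auto
    qed
    then have "\<forall>\<eta>\<in>{..<\<nu>}. \<exists>b. b < \<nu> \<and> \<zeta> < b \<and> (\<forall>j<\<theta>. h j \<eta> < b)" by blast
    from bchoice[OF this] obtain H where
      H: "\<forall>\<eta>\<in>{..<\<nu>}. H \<eta> < \<nu> \<and> \<zeta> < H \<eta> \<and> (\<forall>j<\<theta>. h j \<eta> < H \<eta>)" ..
    \<comment> \<open>H dominates all the functions witnessing that the pieces for \<zeta> are not
      stationary. A closure point \<delta> of H lies above \<zeta>, hence in the piece named by
      \<open>idx \<delta> \<zeta>\<close>, a contradiction.\<close>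
    obtain \<delta> where \<delta>: "\<delta> \<in> Scof" "\<forall>\<eta><\<delta>. H \<eta> < \<delta>" using statD[OF Scof_stat, of H] H by auto
    have \<delta>\<nu>: "\<delta> < \<nu>" using Scof_less[OF \<delta>(1)] .
    obtain \<eta>0 where \<eta>0: "\<eta>0 < \<delta>" using Scof_finite_bound[OF \<delta>(1), of "{}"] by auto
    have "\<zeta> < H \<eta>0" using H \<eta>0 \<delta>\<nu> by (meson lessThan_iff less_trans)
    then have \<zeta>\<delta>: "\<zeta> < \<delta>" using \<delta>(2) \<eta>0 by (meson less_trans)
    then have j: "idx \<delta> \<zeta> < \<theta>" using idx_less[OF \<delta>\<nu>] by blast
    have "\<delta> \<in> U (idx \<delta> \<zeta>) \<zeta>" using \<delta>(1) \<zeta>\<delta> by (simp add: U_def)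
    moreover have "h (idx \<delta> \<zeta>) \<eta> < \<delta>" if "\<eta> < \<delta>" for \<eta>
    proof -
      have "h (idx \<delta> \<zeta>) \<eta> < H \<eta>" using H j that \<delta>\<nu> by (meson lessThan_iff less_trans)
      then show ?thesis using \<delta>(2) that by (meson less_trans)
    qed
    ultimately show False using h j by blast
  qed
  then have "\<forall>\<zeta>\<in>{..<\<nu>}. \<exists>j. j < \<theta> \<and> stat (U j \<zeta>)" by blast
  from bchoice[OF this] obtain J where J: "\<forall>\<zeta>\<in>{..<\<nu>}. J \<zeta> < \<theta> \<and> stat (U (J \<zeta>) \<zeta>)" ..
  have "unbounded {..<\<nu>}" using \<nu>_limit by (auto simp: unbounded_def)
  then obtain j where j: "unbounded {\<zeta> \<in> {..<\<nu>}. J \<zeta> = j}"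
    using unbounded_cases[of "{..<\<nu>}" "{..<\<theta>}" J] moderate_\<theta> J by auto
  have "\<not> moderate {\<zeta> \<in> {..<\<nu>}. J \<zeta> = j}"
  proof
    assume "moderate {\<zeta> \<in> {..<\<nu>}. J \<zeta> = j}"
    then obtain b where "b < \<nu>" "\<forall>x\<in>{\<zeta> \<in> {..<\<nu>}. J \<zeta> = j}. x < b"
      using \<nu>_bound[of "{\<zeta> \<in> {..<\<nu>}. J \<zeta> = j}"] by auto
    then show False using unboundedD[OF j] by (metis less_asym)
  qed
  then have "|{..<\<theta>}| \<le>o |{\<zeta> \<in> {..<\<nu>}. J \<zeta> = j}|"
    unfolding moderate_def using ordLeq_total card_of_Well_order by blast
  then obtain e where e: "inj_on e {..<\<theta>}" "e ` {..<\<theta>} \<subseteq> {\<zeta> \<in> {..<\<nu>}. J \<zeta> = j}"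
    using card_of_ordLeq[of "{..<\<theta>}" "{\<zeta> \<in> {..<\<nu>}. J \<zeta> = j}"] by blast
  \<comment> \<open>The row j is now fixed, and injectivity of \<open>idx \<delta>\<close> makes the
    pieces belonging to different \<open>e \<tau>\<close> disjoint.\<close>
  define lab where "lab \<delta> = (THE \<tau>. \<tau> < \<theta> \<and> e \<tau> < \<delta> \<and> idx \<delta> (e \<tau>) = j)" for \<delta>
  have "stat {\<delta> \<in> Scof. lab \<delta> = \<tau>}" if \<tau>: "\<tau> < \<theta>" for \<tau>
  proof (rule stat_mono)
    have "e \<tau> < \<nu>" "J (e \<tau>) = j" using e(2) \<tau> by auto
    then show "stat (U j (e \<tau>))" using J by auto
    show "U j (e \<tau>) \<subseteq> {\<delta> \<in> Scof. lab \<delta> = \<tau>}"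
    proof
      fix \<delta> assume "\<delta> \<in> U j (e \<tau>)"
      then have \<delta>: "\<delta> \<in> Scof" "e \<tau> < \<delta>" "idx \<delta> (e \<tau>) = j" by (auto simp: U_def)
      have "lab \<delta> = \<tau>"
        unfolding lab_def
      proof (rule the_equality)
        show "\<tau> < \<theta> \<and> e \<tau> < \<delta> \<and> idx \<delta> (e \<tau>) = j" using \<delta> \<tau> by simp
        fix \<sigma> assume \<sigma>: "\<sigma> < \<theta> \<and> e \<sigma> < \<delta> \<and> idx \<delta> (e \<sigma>) = j"
        then have "e \<sigma> = e \<tau>"
          using inj_onD[OF idx(1)[OF Scof_less[OF \<delta>(1)]], of "e \<sigma>" "e \<tau>"] \<delta> by auto
        then show "\<sigma> = \<tau>" using inj_onD[OF e(1), of \<sigma> \<tau>] \<sigma> \<tau> by auto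
      qed
      then show "\<delta> \<in> {\<delta> \<in> Scof. lab \<delta> = \<tau>}" using \<delta>(1) by simp
    qed
  qed auto
  then show ?thesis by blast
qed

text \<open>Take \<delta> in R reflecting all sets \<open>D (l, n)\<close>, and any b in T above it.
  The lower trace from b is bounded by some l < \<delta>, so \<delta> belongs to the corresponding
  D, which is therefore unbounded. A bound l that does not depend on the point reached is what
  \<open>L_pass\<close> asks for.\<close>

lemma walk_reaches:
  assumes R: "stat R" and T: "unbounded T"
  shows "\<exists>n l. l < \<nu> \<and> (\<forall>\<delta><\<nu>. unbounded {b \<in> T. \<exists>d\<in>R. \<delta> < d \<and> d < b \<and> length (L d b) = n
           \<and> (\<forall>x\<in>set (L d b). x \<le> l)})"
proof -
  define D where "D = (\<lambda>(l, n). {d \<in> R. \<exists>b\<in>T. d < b \<and> length (L d b) = n \<and> (\<forall>x\<in>set (L d b). x \<le> l)})"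
  have RS: "R \<subseteq> Scof" using R by (simp add: stat_def)
  have "\<exists>\<delta>\<in>R. \<forall>\<eta><\<delta>. \<forall>x\<in>{..\<eta>} \<times> (UNIV :: nat set).
           ((\<exists>z\<in>D x. \<delta> \<le> z) \<longrightarrow> unbounded (D x)) \<and> (unbounded (D x) \<longrightarrow> (\<forall>\<eta><\<delta>. \<exists>z\<in>D x. \<eta> < z \<and> z < \<delta>))"
  proof (rule stat_reflect[OF R])
    have "moderate (UNIV :: nat set)"
      unfolding moderate_def using infinite_\<theta> infinite_iff_card_of_nat by blast
    then show "moderate ({..\<eta>} \<times> (UNIV :: nat set))" if "\<eta> < \<nu>" for \<eta>
      by (intro moderate_Times moderate_atMost that)
    show "{..\<eta>} \<times> (UNIV :: nat set) \<subseteq> {..\<eta>'} \<times> UNIV" if "\<eta> \<le> \<eta>'" for \<eta> \<eta>' :: 'a using that by auto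
    show "D x \<subseteq> {..<\<nu>}" for x using RS Scof_less by (auto simp: D_def split: prod.splits)
  qed
  then obtain \<delta> where \<delta>: "\<delta> \<in> R" and refl: "\<And>\<eta> x. \<eta> < \<delta> \<Longrightarrow> x \<in> {..\<eta>} \<times> (UNIV :: nat set) \<Longrightarrow>
     (\<exists>z\<in>D x. \<delta> \<le> z) \<longrightarrow> unbounded (D x)" by blast
  have \<delta>S: "\<delta> \<in> Scof" "\<delta> < \<nu>" using \<delta> RS Scof_less by auto
  obtain b where b: "b \<in> T" "\<delta> < b" "b < \<nu>" using unboundedD[OF T \<delta>S(2)] by blast
  obtain l where l: "l < \<delta>" "\<forall>x\<in>set (L \<delta> b). x < l"
    using Scof_finite_bound[OF \<delta>S(1), of "set (L \<delta> b)"] L_less[OF \<delta>S(1) b(3)] by auto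
  have "\<delta> \<in> D (l, length (L \<delta> b))" using \<delta> b l by (auto simp: D_def less_imp_le)
  then have u: "unbounded (D (l, length (L \<delta> b)))" using refl[OF l(1), of "(l, length (L \<delta> b))"] by auto
  have "unbounded {b' \<in> T. \<exists>d\<in>R. \<delta>' < d \<and> d < b' \<and> length (L d b') = length (L \<delta> b)
           \<and> (\<forall>x\<in>set (L d b'). x \<le> l)}" if \<delta>': "\<delta>' < \<nu>" for \<delta>'
    unfolding unbounded_def
  proof safe
    show "x < \<nu>" if "x \<in> T" for x using T that by (auto simp: unbounded_def)
    fix \<gamma> assume "\<gamma> < \<nu>"
    then obtain d where "d \<in> D (l, length (L \<delta> b))" "max \<gamma> \<delta>' < d"
      using unboundedD[OF u, of "max \<gamma> \<delta>'"] \<delta>' by auto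
    then obtain b' where b': "d \<in> R" "b' \<in> T" "d < b'" "length (L d b') = length (L \<delta> b)"
      "\<forall>x\<in>set (L d b'). x \<le> l" "\<gamma> < d" "\<delta>' < d" by (auto simp: D_def)
    then have "\<gamma> < b'" by (meson less_trans)
    then show "\<exists>x\<in>{b' \<in> T. \<exists>d\<in>R. \<delta>' < d \<and> d < b' \<and> length (L d b') = length (L \<delta> b)
           \<and> (\<forall>x\<in>set (L d b'). x \<le> l)}. \<gamma> < x" using b' by blast
  qed
  then show ?thesis using l(1) \<delta>S(2) by (meson less_trans)
qed

text \<open>The number of steps after which the walk from \<open>b\<close> meets the required piece of the partition
  depends on the set to which \<open>b\<close> belongs, so it has to be guessed: this is what \<open>osc_val\<close> is for.\<close>

lemma successor_guessing:
  "\<exists>g :: 'a \<Rightarrow> 'a \<Rightarrow> 'a \<Rightarrow> 'a. \<forall>T. (\<forall>\<tau><\<theta>. unbounded (T \<tau>)) \<longrightarrow>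
     (\<exists>a<\<nu>. \<exists>\<delta><\<nu>. \<forall>\<tau><\<theta>. \<exists>b\<in>T \<tau>. g a \<delta> b = \<tau>)"
proof -
  obtain lab where lab: "\<forall>\<tau><\<theta>. stat {\<delta> \<in> Scof. lab \<delta> = \<tau>}" using stationary_partition by blast
  have "\<exists>a<\<nu>. \<exists>\<delta><\<nu>. \<forall>\<tau><\<theta>. \<exists>b\<in>T \<tau>. lab (node (osc_val a b) \<delta> b) = \<tau>"
    if T: "\<forall>\<tau><\<theta>. unbounded (T \<tau>)" for T
  proof -
    define W where "W \<tau> n l \<delta> = {b \<in> T \<tau>. \<exists>d\<in>{\<delta> \<in> Scof. lab \<delta> = \<tau>}. \<delta> < d \<and> d < b
      \<and> length (L d b) = n \<and> (\<forall>x\<in>set (L d b). x \<le> l)}" for \<tau> n l \<delta>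
    have "\<forall>\<tau>\<in>{..<\<theta>}. \<exists>w. snd w < \<nu> \<and> (\<forall>\<delta><\<nu>. unbounded (W \<tau> (fst w) (snd w) \<delta>))"
    proof
      fix \<tau> assume "\<tau> \<in> {..<\<theta>}"
      then have "stat {\<delta> \<in> Scof. lab \<delta> = \<tau>}" "unbounded (T \<tau>)" using lab T by auto
      from walk_reaches[OF this] obtain n l where "l < \<nu>" "\<forall>\<delta><\<nu>. unbounded (W \<tau> n l \<delta>)"
        unfolding W_def by blast
      then show "\<exists>w. snd w < \<nu> \<and> (\<forall>\<delta><\<nu>. unbounded (W \<tau> (fst w) (snd w) \<delta>))"
        by (intro exI[of _ "(n, l)"]) simp
    qed
    from bchoice[OF this] obtain w where
      w: "\<forall>\<tau>\<in>{..<\<theta>}. snd (w \<tau>) < \<nu> \<and> (\<forall>\<delta><\<nu>. unbounded (W \<tau> (fst (w \<tau>)) (snd (w \<tau>)) \<delta>))" ..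
    have "(\<lambda>\<tau>. snd (w \<tau>)) ` {..<\<theta>} \<subseteq> {..<\<nu>}" using w by auto
    \<comment> \<open>This \<delta> exceeds the bounds l of all \<tau>, so for b in the \<tau>-th
      set the walk to \<delta> is at the point d of the \<tau>-th piece after exactly the number of
      steps to be guessed.\<close>
    then obtain \<delta> where \<delta>: "\<delta> < \<nu>" "\<forall>x\<in>(\<lambda>\<tau>. snd (w \<tau>)) ` {..<\<theta>}. x < \<delta>"
      using \<nu>_bound moderate_image[OF moderate_\<theta>] by metis
    have "\<exists>a\<in>Scof. \<forall>\<tau><\<theta>. \<exists>b\<in>W \<tau> (fst (w \<tau>)) (snd (w \<tau>)) \<delta>. osc_val a b = fst (w \<tau>)"
      using w \<delta>(1) by (intro osc_val_hits) auto
    then obtain a where a: "a \<in> Scof"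
      "\<forall>\<tau><\<theta>. \<exists>b\<in>W \<tau> (fst (w \<tau>)) (snd (w \<tau>)) \<delta>. osc_val a b = fst (w \<tau>)" by blast
    have "\<exists>b\<in>T \<tau>. lab (node (osc_val a b) \<delta> b) = \<tau>" if \<tau>: "\<tau> < \<theta>" for \<tau>
    proof -
      obtain b where b: "b \<in> W \<tau> (fst (w \<tau>)) (snd (w \<tau>)) \<delta>" "osc_val a b = fst (w \<tau>)"
        using a(2) \<tau> by blast
      then obtain d where d: "b \<in> T \<tau>" "d \<in> Scof" "lab d = \<tau>" "\<delta> < d" "d < b"
        "length (L d b) = fst (w \<tau>)" "\<forall>x\<in>set (L d b). x \<le> snd (w \<tau>)"
        by (auto simp: W_def)
      have b\<nu>: "b < \<nu>" using T \<tau> d(1) by (auto simp: unbounded_def)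
      have "snd (w \<tau>) < \<delta>" using \<delta>(2) \<tau> by auto
      then have "node (length (L d b)) \<delta> b = d" using L_pass(1)[OF d(4,5) b\<nu> d(7)] by blast
      then have "lab (node (osc_val a b) \<delta> b) = \<tau>" using b(2) d(3,6) by simp
      then show ?thesis using d(1) by blast
    qed
    then show ?thesis using Scof_less[OF a(1)] \<delta>(1) by blast
  qed
  then show ?thesis by (intro exI[of _ "\<lambda>a \<delta> b. lab (node (osc_val a b) \<delta> b)"]) blast
qed

section \<open>From the successor of \<theta> to larger regular cardinals\<close>

definition cofinal_map :: "'a \<Rightarrow> ('a \<Rightarrow> 'a) \<Rightarrow> bool" where
  "cofinal_map \<epsilon> s \<longleftrightarrow> (\<forall>i<\<nu>. s i < \<epsilon>) \<and> (\<forall>i<\<nu>. \<forall>k<i. s k < s i) \<and> (\<forall>\<xi><\<epsilon>. \<exists>i<\<nu>. \<xi> < s i)"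

text \<open>Choose an increasing sequence of length \<nu> such that between any two terms each
  \<open>T \<tau>\<close> has a point. Every stage involves at most \<theta> many ordinals, which
  are bounded in the regular \<mu> > \<theta>. When \<nu> = \<mu> the limit \<epsilon> may be \<mu>
  itself, hence the weak inequality.\<close>

lemma ex_common_limit:
  fixes \<mu> :: 'a
  assumes \<mu>: "infinite_regular_cardinal \<mu>" "\<theta> < \<mu>" "\<nu> \<le> \<mu>"
    and T: "\<And>\<tau>. \<tau> < \<theta> \<Longrightarrow> T \<tau> \<subseteq> {..<\<mu>} \<and> (\<forall>\<gamma><\<mu>. \<exists>x\<in>T \<tau>. \<gamma> < x)"
  shows "\<exists>\<epsilon>\<le>\<mu>. (\<exists>s. cofinal_map \<epsilon> s) \<and> (\<forall>\<tau><\<theta>. \<forall>\<gamma><\<epsilon>. \<exists>x\<in>T \<tau>. \<gamma> < x \<and> x < \<epsilon>)"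
proof -
  have bound: "\<exists>b<\<mu>. \<forall>x\<in>X. x < b" if "X \<subseteq> {..<\<mu>}" "moderate X" for X
    using regular_bounded[OF \<mu>(1) that(1)] that(2) card_below_less[OF \<mu>(1,2)]
    unfolding moderate_def by (meson ordLeq_ordLess_trans)
  define Q where "Q y x \<longleftrightarrow> y < x \<and> (\<forall>\<tau><\<theta>. \<exists>t\<in>T \<tau>. y < t \<and> t < x)" for y x
  define s where "s = wfrec {(x, y). x < y} (\<lambda>f (i::'a). LEAST x. \<forall>k<i. Q (f k) x)"
  have s: "s i = (LEAST x. \<forall>k<i. Q (s k) x)" for i
  proof -
    have "s i = (LEAST x. \<forall>k<i. Q (cut s {(x, y). x < y} i k) x)"
      unfolding s_def by (subst wfrec[OF wf]) simp
    then show ?thesis by (simp add: cut_apply cong: imp_cong)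
  qed
  have s_prop: "s i < \<mu> \<and> (\<forall>k<i. Q (s k) (s i))" if "i < \<nu>" for i
    using that
  proof (induction i rule: less_induct)
    case (less i)
    have s\<mu>: "s k < \<mu>" if "k < i" for k using less that by (meson less_trans)
    have "\<forall>z\<in>{..<i} \<times> {..<\<theta>}. \<exists>t. t \<in> T (snd z) \<and> s (fst z) < t"
    proof
      fix z assume "z \<in> {..<i} \<times> {..<\<theta>}"
      then have "snd z < \<theta>" "s (fst z) < \<mu>" using s\<mu> by auto
      then show "\<exists>t. t \<in> T (snd z) \<and> s (fst z) < t" using T by blast
    qed
    from bchoice[OF this] obtain t where
      t: "\<forall>z\<in>{..<i} \<times> {..<\<theta>}. t z \<in> T (snd z) \<and> s (fst z) < t z" ..
    let ?X = "s ` {..<i} \<union> t ` ({..<i} \<times> {..<\<theta>})"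
    have "moderate ?X"
      by (intro moderate_Un moderate_image moderate_Times moderate_\<theta> moderate_below less.prems)
    moreover have "?X \<subseteq> {..<\<mu>}" using t T s\<mu> by fastforce
    ultimately obtain b where b: "b < \<mu>" "\<forall>x\<in>?X. x < b" using bound by metis
    have "Q (s k) b" if "k < i" for k
      unfolding Q_def
    proof (intro conjI allI impI)
      show "s k < b" using b(2) that by auto
      fix \<tau> assume "\<tau> < \<theta>"
      then have "(k, \<tau>) \<in> {..<i} \<times> {..<\<theta>}" using that by simp
      then show "\<exists>t\<in>T \<tau>. s k < t \<and> t < b" using t b(2) by (intro bexI[of _ "t (k, \<tau>)"]) auto
    qed
    then have Q: "\<forall>k<i. Q (s k) b" by blast
    have "\<forall>k<i. Q (s k) (s i)" unfolding s[of i] using Q by (rule LeastI)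
    moreover have "s i \<le> b" unfolding s[of i] using Q by (rule Least_le)
    ultimately show ?case using b(1) by auto
  qed
  define \<epsilon> where "\<epsilon> = (LEAST x. \<forall>i<\<nu>. s i < x)"
  have all: "\<forall>i<\<nu>. s i < \<mu>" using s_prop by blast
  have \<epsilon>: "\<forall>i<\<nu>. s i < \<epsilon>" unfolding \<epsilon>_def using all by (rule LeastI)
  have \<epsilon>\<mu>: "\<epsilon> \<le> \<mu>" unfolding \<epsilon>_def using all by (rule Least_le)
  have below: "\<exists>i<\<nu>. \<xi> \<le> s i" if "\<xi> < \<epsilon>" for \<xi>
    using not_less_Least[of \<xi> "\<lambda>x. \<forall>i<\<nu>. s i < x"] that by (auto simp: \<epsilon>_def not_less)
  have "cofinal_map \<epsilon> s"
    unfolding cofinal_map_def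
  proof (intro conjI \<epsilon> allI impI)
    show "s k < s i" if "i < \<nu>" "k < i" for i k using s_prop that by (auto simp: Q_def)
    fix \<xi> assume "\<xi> < \<epsilon>"
    then obtain i where i: "i < \<nu>" "\<xi> \<le> s i" using below by blast
    then obtain j where j: "j < \<nu>" "i < j" using \<nu>_limit by blast
    then have "\<xi> < s j" using s_prop[of j] i by (auto simp: Q_def intro: le_less_trans)
    then show "\<exists>i<\<nu>. \<xi> < s i" using j(1) by blast
  qed
  moreover have "\<exists>x\<in>T \<tau>. \<gamma> < x \<and> x < \<epsilon>" if \<tau>: "\<tau> < \<theta>" and \<gamma>: "\<gamma> < \<epsilon>" for \<tau> \<gamma>
  proof -
    obtain i where i: "i < \<nu>" "\<gamma> \<le> s i" using below[OF \<gamma>] by blast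
    then obtain j where j: "j < \<nu>" "i < j" using \<nu>_limit by blast
    then obtain t where "t \<in> T \<tau>" "s i < t" "t < s j" using s_prop[of j] \<tau> unfolding Q_def by blast
    then show ?thesis using i \<epsilon> j(1) by (meson le_less_trans less_trans)
  qed
  ultimately show ?thesis using \<epsilon>\<mu> by blast
qed

text \<open>Sending x < \<epsilon> to the first term of the cofinal sequence above it maps each
  \<open>T \<tau>\<close> onto an unbounded subset of \<nu>. Since \<epsilon> depends on T it
  becomes a further index; all indices are at most \<mu>, so the list stays short enough to be coded
  below \<kappa>.\<close>

lemma regular_guessing:
  fixes \<mu> :: 'a
  assumes \<mu>: "infinite_regular_cardinal \<mu>" "\<theta> < \<mu>" "\<nu> \<le> \<mu>"
  shows "\<exists>g :: 'a \<Rightarrow> 'a \<Rightarrow> 'a \<Rightarrow> 'a \<Rightarrow> 'a. \<forall>T. (\<forall>\<tau><\<theta>. T \<tau> \<subseteq> {..<\<mu>} \<and> (\<forall>\<gamma><\<mu>. \<exists>x\<in>T \<tau>. \<gamma> < x)) \<longrightarrow>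
     (\<exists>a\<le>\<mu>. \<exists>\<delta>\<le>\<mu>. \<exists>\<epsilon>\<le>\<mu>. \<forall>\<tau><\<theta>. \<exists>x\<in>T \<tau>. g a \<delta> \<epsilon> x = \<tau>)"
proof -
  obtain g :: "'a \<Rightarrow> 'a \<Rightarrow> 'a \<Rightarrow> 'a" where g: "\<And>T. \<forall>\<tau><\<theta>. unbounded (T \<tau>) \<Longrightarrow>
     \<exists>a<\<nu>. \<exists>\<delta><\<nu>. \<forall>\<tau><\<theta>. \<exists>b\<in>T \<tau>. g a \<delta> b = \<tau>" using successor_guessing by blast
  define s where "s \<epsilon> = (SOME s. cofinal_map \<epsilon> s)" for \<epsilon>
  define \<pi> where "\<pi> \<epsilon> x = (LEAST i. x < s \<epsilon> i)" for \<epsilon> x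
  have "\<exists>a\<le>\<mu>. \<exists>\<delta>\<le>\<mu>. \<exists>\<epsilon>\<le>\<mu>. \<forall>\<tau><\<theta>. \<exists>x\<in>T \<tau>. g a \<delta> (\<pi> \<epsilon> x) = \<tau>"
    if T: "\<forall>\<tau><\<theta>. T \<tau> \<subseteq> {..<\<mu>} \<and> (\<forall>\<gamma><\<mu>. \<exists>x\<in>T \<tau>. \<gamma> < x)" for T
  proof -
    obtain \<epsilon> where \<epsilon>: "\<epsilon> \<le> \<mu>" "\<exists>s. cofinal_map \<epsilon> s" "\<forall>\<tau><\<theta>. \<forall>\<gamma><\<epsilon>. \<exists>x\<in>T \<tau>. \<gamma> < x \<and> x < \<epsilon>"
      using ex_common_limit[OF \<mu>, of T] T by blast
    have cof: "cofinal_map \<epsilon> (s \<epsilon>)" unfolding s_def using \<epsilon>(2) by (rule someI_ex)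
    have "unbounded {\<pi> \<epsilon> x |x. x \<in> T \<tau> \<and> x < \<epsilon>}" if \<tau>: "\<tau> < \<theta>" for \<tau>
      unfolding unbounded_def
    proof safe
      fix x assume "x < \<epsilon>"
      then obtain i where "i < \<nu>" "x < s \<epsilon> i" using cof by (auto simp: cofinal_map_def)
      then show "\<pi> \<epsilon> x < \<nu>" unfolding \<pi>_def by (meson Least_le le_less_trans)
    next
      fix \<gamma> assume \<gamma>: "\<gamma> < \<nu>"
      then have "s \<epsilon> \<gamma> < \<epsilon>" using cof by (simp add: cofinal_map_def)
      then obtain x where x: "x \<in> T \<tau>" "s \<epsilon> \<gamma> < x" "x < \<epsilon>" using \<epsilon>(3) \<tau> by blast
      then obtain i where i: "i < \<nu>" "x < s \<epsilon> i" using cof by (auto simp: cofinal_map_def)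
      have "x < s \<epsilon> (\<pi> \<epsilon> x)" unfolding \<pi>_def using i(2) by (rule LeastI)
      then have lt: "s \<epsilon> \<gamma> < s \<epsilon> (\<pi> \<epsilon> x)" using x(2) by simp
      have "\<gamma> < \<pi> \<epsilon> x"
      proof (rule ccontr)
        assume "\<not> \<gamma> < \<pi> \<epsilon> x"
        then have "\<pi> \<epsilon> x = \<gamma> \<or> \<pi> \<epsilon> x < \<gamma>" by auto
        then show False using lt cof \<gamma> unfolding cofinal_map_def by (metis less_asym)
      qed
      then show "\<exists>y\<in>{\<pi> \<epsilon> x |x. x \<in> T \<tau> \<and> x < \<epsilon>}. \<gamma> < y" using x by blast
    qed
    then obtain a \<delta> where a: "a < \<nu>" "\<delta> < \<nu>"
      "\<forall>\<tau><\<theta>. \<exists>b\<in>{\<pi> \<epsilon> x |x. x \<in> T \<tau> \<and> x < \<epsilon>}. g a \<delta> b = \<tau>"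
      using g[of "\<lambda>\<tau>. {\<pi> \<epsilon> x |x. x \<in> T \<tau> \<and> x < \<epsilon>}"] by blast
    have "\<exists>x\<in>T \<tau>. g a \<delta> (\<pi> \<epsilon> x) = \<tau>" if "\<tau> < \<theta>" for \<tau> using a(3) that by blast
    moreover have "a \<le> \<mu>" "\<delta> \<le> \<mu>" using a(1,2) \<mu>(3) by auto
    ultimately show ?thesis using \<epsilon>(1) by blast
  qed
  then show ?thesis by (intro exI[of _ "\<lambda>a \<delta> \<epsilon> x. g a \<delta> (\<pi> \<epsilon> x)"]) blast
qed

end

lemma guessing_functions:
  fixes \<theta> \<mu> :: "'a::wellorder"
  assumes \<theta>: "infinite_regular_cardinal \<theta>" and \<mu>: "infinite_regular_cardinal \<mu>" "\<theta> < \<mu>"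
  shows "\<exists>g :: 'a \<Rightarrow> 'a \<Rightarrow> 'a \<Rightarrow> 'a \<Rightarrow> 'a. \<forall>T. (\<forall>\<tau><\<theta>. T \<tau> \<subseteq> {..<\<mu>} \<and> (\<forall>\<gamma><\<mu>. \<exists>x\<in>T \<tau>. \<gamma> < x)) \<longrightarrow>
     (\<exists>a\<le>\<mu>. \<exists>\<delta>\<le>\<mu>. \<exists>\<epsilon>\<le>\<mu>. \<forall>\<tau><\<theta>. \<exists>x\<in>T \<tau>. g a \<delta> \<epsilon> x = \<tau>)"
proof -
  have "\<not> |{..<\<mu>}| \<le>o |{..<\<theta>}|" using card_below_less[OF \<mu>] not_ordLess_ordLeq by blast
  then have "successor_cardinal \<theta> (LEAST v. \<not> |{..<v}| \<le>o |{..<\<theta>}| )"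
    using \<theta> by unfold_locales auto
  moreover have "(LEAST v. \<not> |{..<v}| \<le>o |{..<\<theta>}| ) \<le> \<mu>"
    using \<open>\<not> |{..<\<mu>}| \<le>o |{..<\<theta>}|\<close> by (rule Least_le)
  ultimately show ?thesis using successor_cardinal.regular_guessing \<mu> by blast
qed

section \<open>Ideals and colourings\<close>

lemma ideal_subset: "ideal_over X J \<Longrightarrow> A \<in> J \<Longrightarrow> B \<subseteq> A \<Longrightarrow> B \<in> J"
  by (simp add: ideal_over_def)

lemma ideal_Un: "ideal_over X J \<Longrightarrow> A \<in> J \<Longrightarrow> B \<in> J \<Longrightarrow> A \<union> B \<in> J"
  by (simp add: ideal_over_def)

lemma positive_superset:
  assumes "ideal_over {..<\<kappa>} J" "X \<in> positive \<kappa> J" "X \<subseteq> Y" "Y \<subseteq> {..<\<kappa>}"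
  shows "Y \<in> positive \<kappa> J"
  using assms(2,4) ideal_subset[OF assms(1) _ assms(3)] by (auto simp: positive_def)

lemma positive_diff:
  assumes "ideal_over {..<\<kappa>} J" "X \<in> positive \<kappa> J" "N \<in> J"
  shows "X - N \<in> positive \<kappa> J"
proof -
  have "X - N \<notin> J"
  proof
    assume "X - N \<in> J"
    then have "(X - N) \<union> N \<in> J" using assms(3) by (rule ideal_Un[OF assms(1)])
    then have "X \<in> J" by (rule ideal_subset[OF assms(1)]) auto
    then show False using assms(2) by (simp add: positive_def)
  qed
  then show ?thesis using assms(2) by (auto simp: positive_def)
qed

lemma card_atMost_regular:
  fixes \<kappa> :: "'a::wellorder"
  assumes "infinite_regular_cardinal \<kappa>"
  shows "|{..\<kappa>}| \<le>o |{..<\<kappa>}|"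
proof -
  have inf: "infinite {..<\<kappa>}" using assms by (simp add: infinite_regular_cardinal_def)
  have "|{\<kappa>}| \<le>o |{..<\<kappa>}|" using finite_card_less_infinite[OF _ inf, of "{\<kappa>}"] ordLess_imp_ordLeq by auto
  then have "|\<Union>X\<in>{{\<kappa>}, {..<\<kappa>}}. X| \<le>o |{..<\<kappa>}|"
    using inf finite_card_less_infinite[OF _ inf, of "{{\<kappa>}, {..<\<kappa>}}"] ordLess_imp_ordLeq
      ordLeq_reflexive[OF card_of_Well_order, of "{..<\<kappa>}"]
    by (intro card_of_UNION_ordLeq_infinite) auto
  moreover have "(\<Union>X\<in>{{\<kappa>}, {..<\<kappa>}}. X) = {..\<kappa>}" by auto
  ultimately show ?thesis by simp
qed

lemma infinite_regular_cardinal_pos: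
  assumes "infinite_regular_cardinal \<theta>" shows "\<exists>z. z < \<theta>"
proof -
  have "{..<\<theta>} \<noteq> {}" using assms by (auto simp: infinite_regular_cardinal_def)
  then show ?thesis by blast
qed

lemma code_quadruples:
  fixes \<kappa> :: "'a::wellorder"
  assumes "infinite_regular_cardinal \<kappa>"
  shows "\<exists>f. f ` {..<\<kappa>} = {..<\<kappa>} \<times> {..\<kappa>} \<times> {..\<kappa>} \<times> {..\<kappa>}"
proof -
  have inf: "infinite {..<\<kappa>}" using assms by (simp add: infinite_regular_cardinal_def)
  have times: "|X \<times> Y| \<le>o |{..<\<kappa>}|" if "|X| \<le>o |{..<\<kappa>}|" "|Y| \<le>o |{..<\<kappa>}|" for X :: "'b set" and Y :: "'c set"
    using card_of_Sigma_ordLeq_infinite[OF inf, of X "\<lambda>_. Y"] that by blast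
  note at = card_atMost_regular[OF assms]
  have "|{..<\<kappa>} \<times> {..\<kappa>} \<times> {..\<kappa>} \<times> {..\<kappa>}| \<le>o |{..<\<kappa>}|"
    by (intro times at) (rule ordLeq_reflexive[OF card_of_Well_order])
  moreover have "{..<\<kappa>} \<times> {..\<kappa>} \<times> {..\<kappa>} \<times> {..\<kappa>} \<noteq> {}" using inf by auto
  ultimately show ?thesis using card_of_ordLeq2 by metis
qed

text \<open>The \<eta> supplied by the colouring need not belong to the given set in the dual
  filter. It is therefore coded together with the guess, and a point x of that set in the right
  piece only acts as a name for the quadruple.\<close>

lemma onto_plus_plus_from_unbounded:
  fixes \<theta> \<mu> \<kappa> :: "'a::wellorder"
  assumes \<theta>: "infinite_regular_cardinal \<theta>" and \<mu>: "infinite_regular_cardinal \<mu>" "\<theta> < \<mu>" "\<mu> \<le> \<kappa>"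
    and \<kappa>: "infinite_regular_cardinal \<kappa>"
    and I: "ideal_over {..<\<kappa>} I" "\<not> weakly_saturated \<kappa> I"
    and J: "ideal_over {..<\<kappa>} J" "\<And>\<gamma>. \<gamma> < \<kappa> \<Longrightarrow> {..\<gamma>} \<in> J"
    and c: "\<And>B. (\<forall>\<tau><\<theta>. B \<tau> \<in> positive \<kappa> J) \<Longrightarrow>
      \<exists>\<eta><\<kappa>. \<forall>\<tau><\<theta>. \<forall>\<gamma><\<mu>. \<exists>\<xi><\<mu>. \<gamma> < \<xi> \<and> {\<beta>\<in>B \<tau>. \<eta> < \<beta> \<and> c \<eta> \<beta> = \<xi>} \<in> positive \<kappa> J"
  shows "onto_plus_plus \<kappa> (dual_filter \<kappa> I) J \<theta>"
proof -
  obtain g :: "'a \<Rightarrow> 'a \<Rightarrow> 'a \<Rightarrow> 'a \<Rightarrow> 'a"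
    where g: "\<And>T. (\<forall>\<tau><\<theta>. T \<tau> \<subseteq> {..<\<mu>} \<and> (\<forall>\<gamma><\<mu>. \<exists>x\<in>T \<tau>. \<gamma> < x)) \<Longrightarrow>
     \<exists>a\<le>\<mu>. \<exists>\<delta>\<le>\<mu>. \<exists>\<epsilon>\<le>\<mu>. \<forall>\<tau><\<theta>. \<exists>x\<in>T \<tau>. g a \<delta> \<epsilon> x = \<tau>"
    using guessing_functions[OF \<theta> \<mu>(1,2)] by blast
  obtain f where f: "f ` {..<\<kappa>} = {..<\<kappa>} \<times> {..\<kappa>} \<times> {..\<kappa>} \<times> {..\<kappa>}"
    using code_quadruples[OF \<kappa>] by blast
  obtain P where P: "\<And>i. i < \<kappa> \<Longrightarrow> P i \<in> positive \<kappa> I"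
    "\<And>i j. i < \<kappa> \<Longrightarrow> j < \<kappa> \<Longrightarrow> i \<noteq> j \<Longrightarrow> P i \<inter> P j = {}"
    using I(2) unfolding weakly_saturated_def by blast
  obtain z where z: "z < \<theta>" using infinite_regular_cardinal_pos[OF \<theta>] ..
  define ind where "ind x = f (THE i. i < \<kappa> \<and> x \<in> P i)" for x
  define colour where "colour = (\<lambda>(\<eta>, a, \<delta>, \<epsilon>) \<beta>. g a \<delta> \<epsilon> (c \<eta> \<beta>))"
  \<comment> \<open>The dummy colour z keeps values below \<theta> when x lies outside all pieces or
    the decoded guess leaves {..<\<theta>}.\<close>
  define d where "d x \<beta> = (if colour (ind x) \<beta> < \<theta> then colour (ind x) \<beta> else z)" for x \<beta>
  have ind: "ind x = f i" if "i < \<kappa>" "x \<in> P i" for x i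
  proof -
    have "(THE i. i < \<kappa> \<and> x \<in> P i) = i" using P(2) that by (intro the_equality) auto
    then show ?thesis by (simp add: ind_def)
  qed
  have "colouring \<kappa> \<theta> d" using z by (auto simp: colouring_def d_def)
  moreover have "\<exists>x\<in>A. \<forall>\<tau><\<theta>. {\<beta>\<in>B \<tau>. x < \<beta> \<and> d x \<beta> = \<tau>} \<in> positive \<kappa> J"
    if A: "A \<in> dual_filter \<kappa> I" and B: "\<forall>\<tau><\<theta>. B \<tau> \<in> positive \<kappa> J" for A B
  proof -
    obtain \<eta> where \<eta>: "\<eta> < \<kappa>"
      "\<forall>\<tau><\<theta>. \<forall>\<gamma><\<mu>. \<exists>\<xi><\<mu>. \<gamma> < \<xi> \<and> {\<beta>\<in>B \<tau>. \<eta> < \<beta> \<and> c \<eta> \<beta> = \<xi>} \<in> positive \<kappa> J"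
      using c[OF B] by blast
    define T where "T \<tau> = {\<xi>. \<xi> < \<mu> \<and> {\<beta>\<in>B \<tau>. \<eta> < \<beta> \<and> c \<eta> \<beta> = \<xi>} \<in> positive \<kappa> J}" for \<tau>
    have "\<forall>\<tau><\<theta>. T \<tau> \<subseteq> {..<\<mu>} \<and> (\<forall>\<gamma><\<mu>. \<exists>x\<in>T \<tau>. \<gamma> < x)" using \<eta>(2) by (auto simp: T_def)
    from g[OF this] obtain a \<delta> \<epsilon> where *: "a \<le> \<mu>" "\<delta> \<le> \<mu>" "\<epsilon> \<le> \<mu>" "\<forall>\<tau><\<theta>. \<exists>x\<in>T \<tau>. g a \<delta> \<epsilon> x = \<tau>"
      by blast
    then have "(\<eta>, a, \<delta>, \<epsilon>) \<in> f ` {..<\<kappa>}" unfolding f using \<eta>(1) \<mu>(3) by auto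
    then obtain i where i: "i < \<kappa>" "f i = (\<eta>, a, \<delta>, \<epsilon>)" by force
    obtain N where N: "N \<in> I" "A = {..<\<kappa>} - N" using A by (auto simp: dual_filter_def)
    have "P i \<subseteq> {..<\<kappa>}" "P i \<notin> I" using P(1)[OF i(1)] by (auto simp: positive_def)
    then have "\<not> P i \<subseteq> N" using ideal_subset[OF I(1) N(1)] by blast
    then obtain x where x: "x \<in> P i" "x \<in> A" using N(2) \<open>P i \<subseteq> {..<\<kappa>}\<close> by blast
    have x\<kappa>: "x < \<kappa>" using x(2) N by auto
    have col: "colour (ind x) \<beta> = g a \<delta> \<epsilon> (c \<eta> \<beta>)" for \<beta>
      using ind[OF i(1) x(1)] i(2) by (simp add: colour_def)
    have "{\<beta>\<in>B \<tau>. x < \<beta> \<and> d x \<beta> = \<tau>} \<in> positive \<kappa> J" if \<tau>: "\<tau> < \<theta>" for \<tau>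
    proof -
      obtain \<xi> where \<xi>: "\<xi> \<in> T \<tau>" "g a \<delta> \<epsilon> \<xi> = \<tau>" using *(4) \<tau> by blast
      then have "{\<beta>\<in>B \<tau>. \<eta> < \<beta> \<and> c \<eta> \<beta> = \<xi>} \<in> positive \<kappa> J" by (simp add: T_def)
      \<comment> \<open>The name x may be larger than \<eta>. Discarding the \<beta> up to x costs a
        set in J only.\<close>
      from positive_diff[OF J(1) this J(2)[OF x\<kappa>]] show ?thesis
      proof (rule positive_superset[OF J(1)])
        show "{\<beta>\<in>B \<tau>. \<eta> < \<beta> \<and> c \<eta> \<beta> = \<xi>} - {..x} \<subseteq> {\<beta>\<in>B \<tau>. x < \<beta> \<and> d x \<beta> = \<tau>}"
          using \<xi>(2) \<tau> by (auto simp: d_def col)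
        show "{\<beta>\<in>B \<tau>. x < \<beta> \<and> d x \<beta> = \<tau>} \<subseteq> {..<\<kappa>}" using B \<tau> by (auto simp: positive_def)
      qed
    qed
    then show ?thesis using x(2) by blast
  qed
  ultimately show ?thesis unfolding onto_plus_plus_def by blast
qed

text \<open>For each \<tau> the \<eta> failing for \<open>B \<tau>\<close> cannot form a positive
  set, since that set could itself be used as A in \<open>ubd_plus\<close>. By completeness the
  \<theta> many exceptional sets have their union in J, and J is proper because it has positive
  sets.\<close>

lemma ubd_plus_imp_onto_plus_plus:
  fixes \<theta> \<mu> \<kappa> :: "'a::wellorder"
  assumes \<theta>: "infinite_regular_cardinal \<theta>" and \<mu>: "infinite_regular_cardinal \<mu>" "\<theta> < \<mu>" "\<mu> \<le> \<kappa>"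
    and \<kappa>: "infinite_regular_cardinal \<kappa>"
    and I: "ideal_over {..<\<kappa>} I" "\<not> weakly_saturated \<kappa> I"
    and J: "ideal_over {..<\<kappa>} J" "complete_ideal (cardSuc (le_on {..<\<theta>})) J"
      "bounded_ideal {..<\<kappa>} \<subseteq> J"
    and u: "ubd_plus \<kappa> (positive \<kappa> J) J \<mu>"
  shows "onto_plus_plus \<kappa> (dual_filter \<kappa> I) J \<theta>"
proof -
  obtain c where c: "\<And>A B. A \<in> positive \<kappa> J \<Longrightarrow> B \<in> positive \<kappa> J \<Longrightarrow>
      \<exists>\<eta>\<in>A. has_otp {\<tau>. \<tau> < \<mu> \<and> {\<beta>\<in>B. \<eta> < \<beta> \<and> c \<eta> \<beta> = \<tau>} \<in> positive \<kappa> J} \<mu>"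
    using u unfolding ubd_plus_def by blast
  obtain z where z: "z < \<theta>" using infinite_regular_cardinal_pos[OF \<theta>] ..
  show ?thesis
  proof (rule onto_plus_plus_from_unbounded[OF \<theta> \<mu> \<kappa> I J(1)])
    show "{..\<gamma>} \<in> J" if \<gamma>: "\<gamma> < \<kappa>" for \<gamma>
    proof -
      obtain b where "b < \<kappa>" "\<gamma> < b" using no_max_below[OF \<kappa> \<gamma>] by auto
      then have "{..\<gamma>} \<subseteq> {..<\<kappa>} \<and> (\<exists>\<gamma>'\<in>{..<\<kappa>}. \<forall>\<alpha>\<in>{..\<gamma>}. \<alpha> < \<gamma>')"
        by (auto intro!: bexI[of _ b])
      then have "{..\<gamma>} \<in> bounded_ideal {..<\<kappa>}" by (simp add: bounded_ideal_def)
      then show ?thesis using J(3) by blast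
    qed
    fix B :: "'a \<Rightarrow> 'a set" assume B: "\<forall>\<tau><\<theta>. B \<tau> \<in> positive \<kappa> J"
    define T where "T \<tau> \<eta> = {\<xi>. \<xi> < \<mu> \<and> {\<beta>\<in>B \<tau>. \<eta> < \<beta> \<and> c \<eta> \<beta> = \<xi>} \<in> positive \<kappa> J}" for \<tau> \<eta>
    define N where "N \<tau> = {\<eta>. \<eta> < \<kappa> \<and> \<not> has_otp (T \<tau> \<eta>) \<mu>}" for \<tau>
    have NJ: "N \<tau> \<in> J" if \<tau>: "\<tau> < \<theta>" for \<tau>
    proof (rule ccontr)
      assume "N \<tau> \<notin> J"
      then have "N \<tau> \<in> positive \<kappa> J" by (auto simp: positive_def N_def)
      then obtain \<eta> where "\<eta> \<in> N \<tau>" "has_otp (T \<tau> \<eta>) \<mu>"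
        using c[of "N \<tau>" "B \<tau>"] B \<tau> by (auto simp: T_def)
      then show False by (simp add: N_def)
    qed
    have "|N ` {..<\<theta>}| \<le>o |{..<\<theta>}|" by (rule card_of_image)
    then have "|N ` {..<\<theta>}| \<le>o le_on {..<\<theta>}"
      using card_of_initial_segment[OF \<theta>] ordLeq_ordIso_trans by blast
    then have "|N ` {..<\<theta>}| <o cardSuc (le_on {..<\<theta>})"
      using cardSuc_greater[of "le_on {..<\<theta>}"] \<theta> ordLeq_ordLess_trans
      by (auto simp: infinite_regular_cardinal_def)
    moreover have "N ` {..<\<theta>} \<subseteq> J" using NJ by auto
    ultimately have un: "\<Union> (N ` {..<\<theta>}) \<in> J" using J(2) unfolding complete_ideal_def by blast
    have "\<Union> (N ` {..<\<theta>}) \<noteq> {..<\<kappa>}"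
    proof
      assume "\<Union> (N ` {..<\<theta>}) = {..<\<kappa>}"
      then have "{..<\<kappa>} \<in> J" using un by simp
      moreover have "B z \<subseteq> {..<\<kappa>}" "B z \<notin> J" using B z by (auto simp: positive_def)
      ultimately show False using ideal_subset[OF J(1)] by blast
    qed
    then obtain \<eta> where \<eta>: "\<eta> < \<kappa>" "\<forall>\<tau><\<theta>. has_otp (T \<tau> \<eta>) \<mu>" by (auto simp: N_def)
    have "\<exists>\<xi><\<mu>. \<gamma> < \<xi> \<and> {\<beta>\<in>B \<tau>. \<eta> < \<beta> \<and> c \<eta> \<beta> = \<xi>} \<in> positive \<kappa> J" if "\<tau> < \<theta>" "\<gamma> < \<mu>" for \<tau> \<gamma>
      using has_otp_unbounded[OF \<mu>(1) \<eta>(2)[rule_format, OF that(1)] that(2)] by (auto simp: T_def)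
    then show "\<exists>\<eta><\<kappa>. \<forall>\<tau><\<theta>. \<forall>\<gamma><\<mu>. \<exists>\<xi><\<mu>. \<gamma> < \<xi> \<and> {\<beta>\<in>B \<tau>. \<eta> < \<beta> \<and> c \<eta> \<beta> = \<xi>} \<in> positive \<kappa> J"
      using \<eta>(1) by blast
  qed
qed

section \<open>Normal ideals\<close>

lemma normal_diagonal_union:
  assumes J: "ideal_over {..<\<kappa>} J" "normal_ideal \<kappa> J" and N: "\<And>\<eta>. \<eta> < \<kappa> \<Longrightarrow> N \<eta> \<in> J"
  shows "{\<beta>. \<beta> < \<kappa> \<and> (\<exists>\<eta><\<beta>. \<beta> \<in> N \<eta>)} \<in> J"
proof -
  have "\<forall>\<eta><\<kappa>. {..<\<kappa>} - N \<eta> \<in> dual_filter \<kappa> J" using N by (auto simp: dual_filter_def)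
  then have "{\<beta>. \<beta> < \<kappa> \<and> (\<forall>\<eta><\<beta>. \<beta> \<in> {..<\<kappa>} - N \<eta>)} \<in> dual_filter \<kappa> J"
    using J(2)[unfolded normal_ideal_def, rule_format, of "\<lambda>\<eta>. {..<\<kappa>} - N \<eta>"] by blast
  then obtain A where A: "A \<in> J" "{\<beta>. \<beta> < \<kappa> \<and> (\<forall>\<eta><\<beta>. \<beta> \<in> {..<\<kappa>} - N \<eta>)} = {..<\<kappa>} - A"
    by (auto simp: dual_filter_def)
  have "{\<beta>. \<beta> < \<kappa> \<and> (\<exists>\<eta><\<beta>. \<beta> \<in> N \<eta>)} \<subseteq> A"
  proof
    fix \<beta> assume \<beta>: "\<beta> \<in> {\<beta>. \<beta> < \<kappa> \<and> (\<exists>\<eta><\<beta>. \<beta> \<in> N \<eta>)}"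
    then have "\<beta> \<notin> {\<beta>. \<beta> < \<kappa> \<and> (\<forall>\<eta><\<beta>. \<beta> \<in> {..<\<kappa>} - N \<eta>)}" by blast
    then show "\<beta> \<in> A" unfolding A(2) using \<beta> by blast
  qed
  then show ?thesis by (rule ideal_subset[OF J(1) A(1)])
qed

text \<open>The pressing-down lemma: the diagonal union of the fibres of a regressive function
  covers its domain.\<close>

lemma normal_regressive:
  assumes J: "ideal_over {..<\<kappa>} J" "normal_ideal \<kappa> J"
    and h: "\<And>\<beta>. \<beta> \<in> X \<Longrightarrow> \<beta> < \<kappa> \<and> h \<beta> < \<beta>" and fib: "\<And>\<xi>. \<xi> < \<kappa> \<Longrightarrow> {\<beta>\<in>X. h \<beta> = \<xi>} \<in> J"
  shows "X \<in> J"
proof (rule ideal_subset[OF J(1) normal_diagonal_union[OF J, of "\<lambda>\<xi>. {\<beta>\<in>X. h \<beta> = \<xi>}"]])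
  show "X \<subseteq> {\<beta>. \<beta> < \<kappa> \<and> (\<exists>\<eta><\<beta>. \<beta> \<in> {\<beta>\<in>X. h \<beta> = \<eta>})}" using h by auto
qed (rule fib)

text \<open>Press down on the part of X where h is at least some b > \<gamma>. This part is positive
  by assumption, so one of the fibres above \<gamma> must be positive too.\<close>

lemma unbounded_many_positive_fibres:
  assumes J: "ideal_over {..<\<kappa>} J" "normal_ideal \<kappa> J" and \<kappa>: "infinite_regular_cardinal \<kappa>"
    and h: "\<And>\<beta>. \<beta> \<in> X \<Longrightarrow> \<beta> < \<kappa> \<and> h \<beta> < \<beta>"
    and unb: "\<not> (\<exists>b<\<kappa>. {\<beta>\<in>X. b \<le> h \<beta>} \<in> J)" and \<gamma>: "\<gamma> < \<kappa>"
  shows "\<exists>\<xi><\<kappa>. \<gamma> < \<xi> \<and> {\<beta>\<in>X. h \<beta> = \<xi>} \<in> positive \<kappa> J"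
proof (rule ccontr)
  assume neg: "\<not> ?thesis"
  obtain b where b: "b < \<kappa>" "\<gamma> < b" using no_max_below[OF \<kappa> \<gamma>] by auto
  have "{\<beta>\<in>X. b \<le> h \<beta>} \<in> J"
  proof (rule normal_regressive[OF J])
    show "\<beta> < \<kappa> \<and> h \<beta> < \<beta>" if "\<beta> \<in> {\<beta>\<in>X. b \<le> h \<beta>}" for \<beta> using h that by auto
    fix \<xi> assume \<xi>: "\<xi> < \<kappa>"
    have sub: "{\<beta>\<in>X. h \<beta> = \<xi>} \<subseteq> {..<\<kappa>}" using h by auto
    have empty: "{} \<in> J" using J(1) by (simp add: ideal_over_def)
    show "{\<beta> \<in> {\<beta>\<in>X. b \<le> h \<beta>}. h \<beta> = \<xi>} \<in> J"
    proof (cases "b \<le> \<xi>")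
      case True
      then have "{\<beta>\<in>X. h \<beta> = \<xi>} \<in> J" using neg \<xi> b(2) sub by (auto simp: positive_def)
      then show ?thesis by (rule ideal_subset[OF J(1)]) auto
    next
      case False
      then have "{\<beta> \<in> {\<beta>\<in>X. b \<le> h \<beta>}. h \<beta> = \<xi>} \<subseteq> {}" by auto
      then show ?thesis by (rule ideal_subset[OF J(1) empty])
    qed
  qed
  then show False using unb b(1) by blast
qed

section \<open>Making every large first coordinate work\<close>

definition tame :: "('a::wellorder \<Rightarrow> 'a \<Rightarrow> 'a) \<Rightarrow> 'a \<Rightarrow> bool" where
  "tame c \<beta> \<longleftrightarrow> (\<forall>\<zeta><\<beta>. \<exists>u<\<beta>. \<forall>\<eta>\<le>\<zeta>. c \<eta> \<beta> \<le> u)"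

text \<open>The \<open>\<eta>\<close> provided by \<open>ubd\<close> depends on the positive set; taking suprema over \<open>\<eta> \<le> \<zeta>\<close> makes all
  large \<open>\<zeta>\<close> work. If the supremum reaches \<open>\<beta>\<close>, then the colours \<open>c i \<beta>\<close> contain a short cofinal
  sequence in \<open>\<beta>\<close>, and its first term above \<open>\<zeta>\<close> is used instead.\<close>

definition accumulate :: "('a::wellorder \<Rightarrow> 'a \<Rightarrow> 'a) \<Rightarrow> 'a \<Rightarrow> 'a \<Rightarrow> 'a" where
  "accumulate c \<zeta> \<beta> =
     (if tame c \<beta> then LEAST u. \<forall>\<eta>\<le>\<zeta>. c \<eta> \<beta> \<le> u else c (LEAST i. \<zeta> < c i \<beta>) \<beta>)"

lemma not_tame:
  assumes "\<not> tame c \<beta>" obtains \<zeta> where "\<zeta> < \<beta>" "\<And>u. u < \<beta> \<Longrightarrow> \<exists>\<eta>\<le>\<zeta>. u < c \<eta> \<beta>"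
  using assms unfolding tame_def by (metis not_le)

lemma accumulate_tame:
  assumes "tame c \<beta>" "\<zeta> < \<beta>" shows "accumulate c \<zeta> \<beta> < \<beta>" "\<eta> \<le> \<zeta> \<Longrightarrow> c \<eta> \<beta> \<le> accumulate c \<zeta> \<beta>"
proof -
  obtain u where u: "u < \<beta>" "\<forall>\<eta>\<le>\<zeta>. c \<eta> \<beta> \<le> u" using assms unfolding tame_def by blast
  have "\<forall>\<eta>\<le>\<zeta>. c \<eta> \<beta> \<le> (LEAST u. \<forall>\<eta>\<le>\<zeta>. c \<eta> \<beta> \<le> u)" using u(2) by (rule LeastI)
  then show "c \<eta> \<beta> \<le> accumulate c \<zeta> \<beta>" if "\<eta> \<le> \<zeta>" using that assms(1) by (simp add: accumulate_def)
  have "(LEAST u. \<forall>\<eta>\<le>\<zeta>. c \<eta> \<beta> \<le> u) \<le> u" using u(2) by (rule Least_le)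
  then show "accumulate c \<zeta> \<beta> < \<beta>" using assms(1) u(1) by (simp add: accumulate_def)
qed

lemma accumulate_less:
  assumes c: "upper_regressive \<kappa> c" and \<beta>: "\<beta> < \<kappa>" "\<zeta> < \<beta>"
  shows "accumulate c \<zeta> \<beta> < \<beta>"
proof (cases "tame c \<beta>")
  case False
  then obtain z where z: "z < \<beta>" "\<And>u. u < \<beta> \<Longrightarrow> \<exists>\<eta>\<le>z. u < c \<eta> \<beta>" using not_tame by blast
  obtain \<eta> where "\<eta> \<le> z" "\<zeta> < c \<eta> \<beta>" using z(2)[OF \<beta>(2)] by blast
  then have "(LEAST i. \<zeta> < c i \<beta>) \<le> \<eta>" by (intro Least_le)
  then have "(LEAST i. \<zeta> < c i \<beta>) < \<beta>" using \<open>\<eta> \<le> z\<close> z(1) by simp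
  then show ?thesis using c \<beta> False by (simp add: accumulate_def upper_regressive_def)
qed (use accumulate_tame(1) \<beta> in blast)

text \<open>The hypotheses of (2) for the ideal lifted to \<kappa>. There \<open>ubd\<close> is
  inherited from the nonstationary ideal on S: the lifted ideal contains it, so it has fewer
  positive sets.\<close>

locale normal_colouring =
  fixes \<kappa> :: "'a::wellorder" and J :: "'a set set" and c :: "'a \<Rightarrow> 'a \<Rightarrow> 'a"
  assumes \<kappa>: "infinite_regular_cardinal \<kappa>"
    and ideal: "ideal_over {..<\<kappa>} J" and bounded: "\<And>\<gamma>. \<gamma> < \<kappa> \<Longrightarrow> {..\<gamma>} \<in> J"
    and normal: "normal_ideal \<kappa> J"
    and regressive: "upper_regressive \<kappa> c"
    and ubd: "\<And>B. B \<in> positive \<kappa> J \<Longrightarrow> \<exists>\<eta><\<kappa>. has_otp {c \<eta> \<beta> | \<beta>. \<beta> \<in> B \<and> \<eta> < \<beta>} \<kappa>"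
begin

text \<open>Normality turns unbounded colours into colours unbounded modulo J. If every \<eta> had a
  bound \<open>b \<eta>\<close> modulo J, removing the diagonal union of the exceptional sets would
  leave a positive set on which each single \<eta> takes only colours below \<open>b \<eta>\<close>,
  against \<open>ubd\<close>.\<close>

lemma colour_unbounded:
  assumes B: "B \<in> positive \<kappa> J"
  shows "\<exists>\<eta><\<kappa>. \<not> (\<exists>b<\<kappa>. {\<beta>\<in>B. \<eta> < \<beta> \<and> b \<le> c \<eta> \<beta>} \<in> J)"
proof (rule ccontr)
  assume "\<not> ?thesis"
  then have "\<forall>\<eta>\<in>{..<\<kappa>}. \<exists>b. b < \<kappa> \<and> {\<beta>\<in>B. \<eta> < \<beta> \<and> b \<le> c \<eta> \<beta>} \<in> J" by auto
  from bchoice[OF this] obtain b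
    where b: "\<forall>\<eta>\<in>{..<\<kappa>}. b \<eta> < \<kappa> \<and> {\<beta>\<in>B. \<eta> < \<beta> \<and> b \<eta> \<le> c \<eta> \<beta>} \<in> J" ..
  define N where "N \<eta> = {\<beta>\<in>B. \<eta> < \<beta> \<and> b \<eta> \<le> c \<eta> \<beta>}" for \<eta>
  let ?U = "{\<beta>. \<beta> < \<kappa> \<and> (\<exists>\<eta><\<beta>. \<beta> \<in> N \<eta>)}"
  have "?U \<in> J" by (rule normal_diagonal_union[OF ideal normal]) (use b in \<open>simp add: N_def\<close>)
  then have "B - ?U \<in> positive \<kappa> J" by (rule positive_diff[OF ideal B])
  then obtain \<eta> where \<eta>: "\<eta> < \<kappa>" "has_otp {c \<eta> \<beta> | \<beta>. \<beta> \<in> B - ?U \<and> \<eta> < \<beta>} \<kappa>" using ubd by blast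
  have "b \<eta> < \<kappa>" using b \<eta>(1) by simp
  then obtain \<beta> where \<beta>: "\<beta> \<in> B - ?U" "\<eta> < \<beta>" "b \<eta> < c \<eta> \<beta>"
    using has_otp_unbounded[OF \<kappa> \<eta>(2)] by blast
  have "\<beta> < \<kappa>" using B \<beta>(1) by (auto simp: positive_def)
  moreover have "\<beta> \<in> N \<eta>" using \<beta> by (simp add: N_def)
  ultimately show False using \<beta> by blast
qed

lemma eventually_unbounded_tame:
  assumes B: "B \<in> positive \<kappa> J" and tame: "\<And>\<beta>. \<beta> \<in> B \<Longrightarrow> tame c \<beta>"
  shows "\<exists>\<zeta>0<\<kappa>. \<forall>\<zeta><\<kappa>. \<zeta>0 \<le> \<zeta> \<longrightarrow> \<not> (\<exists>b<\<kappa>. {\<beta>\<in>B. \<zeta> < \<beta> \<and> b \<le> accumulate c \<zeta> \<beta>} \<in> J)"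
proof -
  obtain \<eta> where \<eta>: "\<eta> < \<kappa>" "\<not> (\<exists>b<\<kappa>. {\<beta>\<in>B. \<eta> < \<beta> \<and> b \<le> c \<eta> \<beta>} \<in> J)"
    using colour_unbounded[OF B] by blast
  have "\<not> (\<exists>b<\<kappa>. {\<beta>\<in>B. \<zeta> < \<beta> \<and> b \<le> accumulate c \<zeta> \<beta>} \<in> J)" if \<zeta>: "\<zeta> < \<kappa>" "\<eta> \<le> \<zeta>" for \<zeta>
  proof
    assume "\<exists>b<\<kappa>. {\<beta>\<in>B. \<zeta> < \<beta> \<and> b \<le> accumulate c \<zeta> \<beta>} \<in> J"
    then obtain b where b: "b < \<kappa>" "{\<beta>\<in>B. \<zeta> < \<beta> \<and> b \<le> accumulate c \<zeta> \<beta>} \<in> J" by blast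
    have "{\<beta>\<in>B. \<eta> < \<beta> \<and> b \<le> c \<eta> \<beta>} \<subseteq> {\<beta>\<in>B. \<zeta> < \<beta> \<and> b \<le> accumulate c \<zeta> \<beta>} \<union> {..\<zeta>}"
    proof
      fix \<beta> assume \<beta>: "\<beta> \<in> {\<beta>\<in>B. \<eta> < \<beta> \<and> b \<le> c \<eta> \<beta>}"
      show "\<beta> \<in> {\<beta>\<in>B. \<zeta> < \<beta> \<and> b \<le> accumulate c \<zeta> \<beta>} \<union> {..\<zeta>}"
      proof (cases "\<zeta> < \<beta>")
        case True
        then have "c \<eta> \<beta> \<le> accumulate c \<zeta> \<beta>" using accumulate_tame(2) tame \<beta> \<zeta>(2) by blast
        then show ?thesis using \<beta> True by auto
      qed (auto simp: not_less)
    qed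
    then have "{\<beta>\<in>B. \<eta> < \<beta> \<and> b \<le> c \<eta> \<beta>} \<in> J"
      using ideal_subset[OF ideal ideal_Un[OF ideal b(2) bounded[OF \<zeta>(1)]]] by blast
    then show False using \<eta>(2) b(1) by blast
  qed
  then show ?thesis using \<eta>(1) by blast
qed

text \<open>Otherwise there are \<kappa> many bad \<open>a k\<close>, spaced so that each exceeds
  the bounds of the earlier ones. By normality some \<beta> in B respects all bounds with k <
  \<beta>. The first colours above the \<open>a k\<close> are then strictly increasing in k, so
  their positions \<open>i k\<close> increase strictly as well. But these positions stay below a
  fixed z < \<beta> or at it, while there are \<beta> many of them.\<close>

lemma eventually_unbounded_not_tame:
  assumes B: "B \<in> positive \<kappa> J" and not: "\<And>\<beta>. \<beta> \<in> B \<Longrightarrow> \<not> tame c \<beta>"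
  shows "\<exists>\<zeta>0<\<kappa>. \<forall>\<zeta><\<kappa>. \<zeta>0 \<le> \<zeta> \<longrightarrow> \<not> (\<exists>b<\<kappa>. {\<beta>\<in>B. \<zeta> < \<beta> \<and> b \<le> accumulate c \<zeta> \<beta>} \<in> J)"
proof (rule ccontr)
  assume neg: "\<not> ?thesis"
  define bad where "bad \<zeta> b \<longleftrightarrow> \<zeta> < \<kappa> \<and> b < \<kappa> \<and> {\<beta>\<in>B. \<zeta> < \<beta> \<and> b \<le> accumulate c \<zeta> \<beta>} \<in> J" for \<zeta> b
  define bd where "bd \<zeta> = (SOME b. bad \<zeta> b)" for \<zeta>
  have bd: "bad \<zeta> (bd \<zeta>)" if "\<exists>b. bad \<zeta> b" for \<zeta> unfolding bd_def using that by (rule someI_ex)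
  have ex: "\<exists>\<zeta>. \<zeta>0 \<le> \<zeta> \<and> bad \<zeta> (bd \<zeta>)" if \<zeta>0: "\<zeta>0 < \<kappa>" for \<zeta>0
  proof -
    have "\<exists>\<zeta>. \<zeta> < \<kappa> \<and> \<zeta>0 \<le> \<zeta> \<and> (\<exists>b. bad \<zeta> b)" using neg \<zeta>0 unfolding bad_def by blast
    then obtain \<zeta> where "\<zeta>0 \<le> \<zeta>" "\<exists>b. bad \<zeta> b" by blast
    then show ?thesis using bd by blast
  qed
  define Q where "Q y x \<longleftrightarrow> y < x \<and> bd y < x" for y x
  define a where "a = wfrec {(x, y). x < y} (\<lambda>f (k::'a). LEAST x. bad x (bd x) \<and> (\<forall>j<k. Q (f j) x))"
  have a: "a k = (LEAST x. bad x (bd x) \<and> (\<forall>j<k. Q (a j) x))" for k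
  proof -
    have "a k = (LEAST x. bad x (bd x) \<and> (\<forall>j<k. Q (cut a {(x, y). x < y} k j) x))"
      unfolding a_def by (subst wfrec[OF wf]) simp
    then show ?thesis by (simp add: cut_apply cong: imp_cong)
  qed
  have a_prop: "bad (a k) (bd (a k)) \<and> (\<forall>j<k. Q (a j) (a k))" if "k < \<kappa>" for k
    using that
  proof (induction k rule: less_induct)
    case (less k)
    have inf: "infinite {..<\<kappa>}" using \<kappa> by (simp add: infinite_regular_cardinal_def)
    have IH: "a j < \<kappa>" "bd (a j) < \<kappa>" if "j < k" for j
      using less that by (auto simp: bad_def dest: less_trans)
    have "|a ` {..<k}| <o |{..<\<kappa>}|" "|(\<lambda>j. bd (a j)) ` {..<k}| <o |{..<\<kappa>}|"
      using card_below_less[OF \<kappa> less.prems] card_of_image ordLeq_ordLess_trans by blast+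
    then have "|a ` {..<k} \<union> (\<lambda>j. bd (a j)) ` {..<k}| <o |{..<\<kappa>}|"
      by (rule card_of_Un_ordLess_infinite[OF inf])
    moreover have "a ` {..<k} \<union> (\<lambda>j. bd (a j)) ` {..<k} \<subseteq> {..<\<kappa>}" using IH by auto
    ultimately obtain b where b: "b < \<kappa>" "\<forall>x\<in>a ` {..<k} \<union> (\<lambda>j. bd (a j)) ` {..<k}. x < b"
      using regular_bounded[OF \<kappa>] by metis
    obtain x where x: "b \<le> x" "bad x (bd x)" using ex[OF b(1)] by blast
    have "\<forall>j<k. Q (a j) x" using b(2) x(1) by (auto simp: Q_def intro: less_le_trans)
    then have "bad x (bd x) \<and> (\<forall>j<k. Q (a j) x)" using x(2) by blast
    then show ?case unfolding a[of k] by (rule LeastI)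
  qed
  \<comment> \<open>Including \<open>{..a k}\<close> guarantees that the surviving \<beta> lies
    above every \<open>a k\<close> with k < \<beta>.\<close>
  define N where "N k = {\<beta>\<in>B. a k < \<beta> \<and> bd (a k) \<le> accumulate c (a k) \<beta>} \<union> {..a k}" for k
  have "{\<beta>. \<beta> < \<kappa> \<and> (\<exists>k<\<beta>. \<beta> \<in> N k)} \<in> J"
  proof (rule normal_diagonal_union[OF ideal normal])
    fix k assume "k < \<kappa>"
    then have "bad (a k) (bd (a k))" using a_prop by blast
    then show "N k \<in> J" unfolding N_def bad_def using ideal_Un[OF ideal] bounded by blast
  qed
  then have "B - {\<beta>. \<beta> < \<kappa> \<and> (\<exists>k<\<beta>. \<beta> \<in> N k)} \<in> positive \<kappa> J" by (rule positive_diff[OF ideal B])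
  moreover have "{} \<in> J" using ideal by (simp add: ideal_over_def)
  ultimately have "B - {\<beta>. \<beta> < \<kappa> \<and> (\<exists>k<\<beta>. \<beta> \<in> N k)} \<noteq> {}" by (metis DiffD2 positive_def)
  then obtain \<beta> where \<beta>: "\<beta> \<in> B" "\<beta> < \<kappa>" "\<And>k. k < \<beta> \<Longrightarrow> \<beta> \<notin> N k"
    using B by (auto simp: positive_def)
  have ak: "a k < \<beta>" "accumulate c (a k) \<beta> < bd (a k)" if "k < \<beta>" for k
    using \<beta>(3)[OF that] \<beta>(1) by (auto simp: N_def not_le)
  obtain z where z: "z < \<beta>" "\<And>u. u < \<beta> \<Longrightarrow> \<exists>\<eta>\<le>z. u < c \<eta> \<beta>" using not_tame[OF not[OF \<beta>(1)]] by blast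
  define i where "i k = (LEAST i. a k < c i \<beta>)" for k
  have i: "a k < c (i k) \<beta>" "i k \<le> z" "c (i k) \<beta> < bd (a k)" if k: "k < \<beta>" for k
  proof -
    obtain \<eta> where \<eta>: "\<eta> \<le> z" "a k < c \<eta> \<beta>" using z(2)[OF ak(1)[OF k]] by blast
    show "a k < c (i k) \<beta>" unfolding i_def using \<eta>(2) by (rule LeastI)
    have "i k \<le> \<eta>" unfolding i_def using \<eta>(2) by (rule Least_le)
    then show "i k \<le> z" using \<eta>(1) by simp
    show "c (i k) \<beta> < bd (a k)"
      using ak(2)[OF k] not[OF \<beta>(1)] by (simp add: accumulate_def i_def)
  qed
  have mono: "i j < i k" if jk: "j < k" "k < \<beta>" for j k
  proof -
    have j: "j < \<beta>" using jk by simp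
    have Q: "a j < a k" "bd (a j) < a k" using a_prop[of k] jk \<beta>(2) by (auto simp: Q_def)
    have "a j < c (i k) \<beta>" using Q(1) i(1)[OF jk(2)] by simp
    then have "i j \<le> i k" unfolding i_def[of j] by (rule Least_le)
    moreover have "i j \<noteq> i k" using i(3)[OF j] i(1)[OF jk(2)] Q(2) by auto
    ultimately show ?thesis by simp
  qed
  have ge: "k \<le> i k" if "k < \<beta>" for k
    using that
  proof (induction k rule: less_induct)
    case (less k)
    show ?case
    proof (rule ccontr)
      assume "\<not> k \<le> i k"
      then have ik: "i k < k" by simp
      then have "i k \<le> i (i k)" using less by auto
      also have "\<dots> < i k" using mono[OF ik less.prems] .
      finally show False by simp
    qed
  qed
  \<comment> \<open>The colour \<open>c \<eta> \<beta>\<close> serves merely as an ordinal strictly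
    between z and \<beta>, at which k \<le> \<open>i k\<close> \<le> z fails.\<close>
  obtain \<eta> where \<eta>: "\<eta> \<le> z" "z < c \<eta> \<beta>" using z(2)[OF z(1)] by blast
  have "c \<eta> \<beta> < \<beta>" using regressive \<eta>(1) z(1) \<beta>(2) unfolding upper_regressive_def by auto
  from ge[OF this] i(2)[OF this] show False using \<eta>(2) by simp
qed

lemma eventually_unbounded:
  assumes B: "B \<in> positive \<kappa> J"
  shows "\<exists>\<zeta>0<\<kappa>. \<forall>\<zeta><\<kappa>. \<zeta>0 \<le> \<zeta> \<longrightarrow> \<not> (\<exists>b<\<kappa>. {\<beta>\<in>B. \<zeta> < \<beta> \<and> b \<le> accumulate c \<zeta> \<beta>} \<in> J)"
proof -
  let ?P = "\<lambda>B. \<exists>\<zeta>0<\<kappa>. \<forall>\<zeta><\<kappa>. \<zeta>0 \<le> \<zeta> \<longrightarrow> \<not> (\<exists>b<\<kappa>. {\<beta>\<in>B. \<zeta> < \<beta> \<and> b \<le> accumulate c \<zeta> \<beta>} \<in> J)"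
  have up: "?P B" if sub: "B' \<subseteq> B" and P: "?P B'" for B'
  proof -
    obtain \<zeta>0 where \<zeta>0: "\<zeta>0 < \<kappa>" "\<forall>\<zeta><\<kappa>. \<zeta>0 \<le> \<zeta> \<longrightarrow> \<not> (\<exists>b<\<kappa>. {\<beta>\<in>B'. \<zeta> < \<beta> \<and> b \<le> accumulate c \<zeta> \<beta>} \<in> J)"
      using P by blast
    have "\<not> (\<exists>b<\<kappa>. {\<beta>\<in>B. \<zeta> < \<beta> \<and> b \<le> accumulate c \<zeta> \<beta>} \<in> J)" if \<zeta>: "\<zeta> < \<kappa>" "\<zeta>0 \<le> \<zeta>" for \<zeta>
    proof
      assume "\<exists>b<\<kappa>. {\<beta>\<in>B. \<zeta> < \<beta> \<and> b \<le> accumulate c \<zeta> \<beta>} \<in> J"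
      then obtain b where b: "b < \<kappa>" "{\<beta>\<in>B. \<zeta> < \<beta> \<and> b \<le> accumulate c \<zeta> \<beta>} \<in> J" by blast
      have "{\<beta>\<in>B'. \<zeta> < \<beta> \<and> b \<le> accumulate c \<zeta> \<beta>} \<in> J"
        by (rule ideal_subset[OF ideal b(2)]) (use sub in blast)
      then show False using \<zeta>0(2) \<zeta> b(1) by blast
    qed
    then show ?thesis using \<zeta>0(1) by blast
  qed
  show ?thesis
  proof (cases "{\<beta>\<in>B. tame c \<beta>} \<in> J")
    case True
    then have "B - {\<beta>\<in>B. tame c \<beta>} \<in> positive \<kappa> J" by (rule positive_diff[OF ideal B])
    then show ?thesis by (intro up[of "B - {\<beta>\<in>B. tame c \<beta>}"] eventually_unbounded_not_tame) auto
  next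
    case False
    then have "{\<beta>\<in>B. tame c \<beta>} \<in> positive \<kappa> J" using B by (auto simp: positive_def)
    then show ?thesis by (intro up[of "{\<beta>\<in>B. tame c \<beta>}"] eventually_unbounded_tame) auto
  qed
qed

text \<open>Each \<open>B \<tau>\<close> admits all sufficiently large \<zeta>, so a bound in
  \<kappa> for the \<theta> many thresholds is good for all \<tau>. This is the reason for
  accumulating colours.\<close>

lemma simultaneous_unbounded:
  assumes \<theta>: "\<theta> < \<kappa>" and B: "\<forall>\<tau><\<theta>. B \<tau> \<in> positive \<kappa> J"
  shows "\<exists>\<zeta><\<kappa>. \<forall>\<tau><\<theta>. \<forall>\<gamma><\<kappa>. \<exists>\<xi><\<kappa>. \<gamma> < \<xi> \<and> {\<beta>\<in>B \<tau>. \<zeta> < \<beta> \<and> accumulate c \<zeta> \<beta> = \<xi>} \<in> positive \<kappa> J"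
proof -
  have "\<forall>\<tau>\<in>{..<\<theta>}. \<exists>z. z < \<kappa> \<and> (\<forall>\<zeta><\<kappa>. z \<le> \<zeta> \<longrightarrow> \<not> (\<exists>b<\<kappa>. {\<beta>\<in>B \<tau>. \<zeta> < \<beta> \<and> b \<le> accumulate c \<zeta> \<beta>} \<in> J))"
    using eventually_unbounded B by simp
  from bchoice[OF this] obtain z where z: "\<forall>\<tau>\<in>{..<\<theta>}. z \<tau> < \<kappa> \<and>
    (\<forall>\<zeta><\<kappa>. z \<tau> \<le> \<zeta> \<longrightarrow> \<not> (\<exists>b<\<kappa>. {\<beta>\<in>B \<tau>. \<zeta> < \<beta> \<and> b \<le> accumulate c \<zeta> \<beta>} \<in> J))" ..
  have "|z ` {..<\<theta>}| <o |{..<\<kappa>}|"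
    using card_below_less[OF \<kappa> \<theta>] card_of_image ordLeq_ordLess_trans by blast
  moreover have "z ` {..<\<theta>} \<subseteq> {..<\<kappa>}" using z by auto
  ultimately obtain \<zeta> where \<zeta>: "\<zeta> < \<kappa>" "\<forall>x\<in>z ` {..<\<theta>}. x < \<zeta>" using regular_bounded[OF \<kappa>] by metis
  have "\<exists>\<xi><\<kappa>. \<gamma> < \<xi> \<and> {\<beta>\<in>B \<tau>. \<zeta> < \<beta> \<and> accumulate c \<zeta> \<beta> = \<xi>} \<in> positive \<kappa> J"
    if \<tau>: "\<tau> < \<theta>" and \<gamma>: "\<gamma> < \<kappa>" for \<tau> \<gamma>
  proof -
    have z\<zeta>: "z \<tau> \<le> \<zeta>" using \<zeta>(2) \<tau> by (simp add: less_imp_le)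
    have "\<not> (\<exists>b<\<kappa>. {\<beta>\<in>{\<beta>\<in>B \<tau>. \<zeta> < \<beta>}. b \<le> accumulate c \<zeta> \<beta>} \<in> J)"
      using z \<tau> \<zeta>(1) z\<zeta> by (simp add: conj_ac)
    moreover have "\<beta> < \<kappa> \<and> accumulate c \<zeta> \<beta> < \<beta>" if "\<beta> \<in> {\<beta>\<in>B \<tau>. \<zeta> < \<beta>}" for \<beta>
      using accumulate_less[OF regressive] B \<tau> that by (auto simp: positive_def)
    ultimately have "\<exists>\<xi><\<kappa>. \<gamma> < \<xi> \<and> {\<beta>\<in>{\<beta>\<in>B \<tau>. \<zeta> < \<beta>}. accumulate c \<zeta> \<beta> = \<xi>} \<in> positive \<kappa> J"
      using \<gamma> by (intro unbounded_many_positive_fibres[OF ideal normal \<kappa>])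
    then show ?thesis by (simp add: conj_ac)
  qed
  then show ?thesis using \<zeta>(1) by blast
qed

text \<open>With every \<open>B \<tau>\<close> equal to {..<\<kappa>}, the positive fibres of the
  accumulated colour are \<kappa> many disjoint positive sets.\<close>

lemma not_weakly_saturated:
  assumes proper: "{..<\<kappa>} \<notin> J" and \<theta>: "infinite_regular_cardinal \<theta>" "\<theta> < \<kappa>"
  shows "\<not> weakly_saturated \<kappa> J"
proof -
  obtain z where z: "z < \<theta>" using infinite_regular_cardinal_pos[OF \<theta>(1)] ..
  have "\<forall>\<tau><\<theta>. {..<\<kappa>} \<in> positive \<kappa> J" using proper by (simp add: positive_def)
  from simultaneous_unbounded[OF \<theta>(2) this] z obtain \<zeta> where
    \<zeta>: "\<forall>\<gamma><\<kappa>. \<exists>\<xi><\<kappa>. \<gamma> < \<xi> \<and> {\<beta>\<in>{..<\<kappa>}. \<zeta> < \<beta> \<and> accumulate c \<zeta> \<beta> = \<xi>} \<in> positive \<kappa> J" by blast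
  define X where "X = {\<xi>. \<xi> < \<kappa> \<and> {\<beta>\<in>{..<\<kappa>}. \<zeta> < \<beta> \<and> accumulate c \<zeta> \<beta> = \<xi>} \<in> positive \<kappa> J}"
  have "\<not> |X| <o |{..<\<kappa>}|"
  proof
    assume "|X| <o |{..<\<kappa>}|"
    then obtain b where b: "b < \<kappa>" "\<forall>x\<in>X. x < b" using regular_bounded[OF \<kappa>, of X] by (auto simp: X_def)
    obtain \<xi> where "\<xi> \<in> X" "b < \<xi>" using \<zeta> b(1) by (auto simp: X_def)
    then show False using b(2) by (meson less_asym)
  qed
  then have "|{..<\<kappa>}| \<le>o |X|" using not_ordLess_iff_ordLeq card_of_Well_order by blast
  then obtain e where e: "inj_on e {..<\<kappa>}" "e ` {..<\<kappa>} \<subseteq> X"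
    using card_of_ordLeq[of "{..<\<kappa>}" X] by blast
  define P where "P i = {\<beta>\<in>{..<\<kappa>}. \<zeta> < \<beta> \<and> accumulate c \<zeta> \<beta> = e i}" for i
  have "P i \<in> positive \<kappa> J" if "i < \<kappa>" for i using e(2) that by (auto simp: X_def P_def)
  moreover have "P i \<inter> P j = {}" if "i < \<kappa>" "j < \<kappa>" "i \<noteq> j" for i j
    using inj_onD[OF e(1), of i j] that by (auto simp: P_def)
  ultimately show ?thesis unfolding weakly_saturated_def by blast
qed

lemma onto_plus_plus_normal:
  assumes \<theta>: "infinite_regular_cardinal \<theta>" "\<theta> < \<kappa>"
  shows "onto_plus_plus \<kappa> (dual_filter \<kappa> J) J \<theta>"
proof (cases "{..<\<kappa>} \<in> J")
  \<comment> \<open>For the improper ideal the claim is vacuous, as \<theta> is nonempty and there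
    are no positive sets. Properness is needed below to refute weak saturation.\<close>
  case True
  obtain z where z: "z < \<theta>" using infinite_regular_cardinal_pos[OF \<theta>(1)] ..
  have "positive \<kappa> J = {}" using ideal_subset[OF ideal True] by (auto simp: positive_def)
  then show ?thesis
    unfolding onto_plus_plus_def colouring_def using z by (intro exI[of _ "\<lambda>_ _. z"]) auto
next
  case False
  show ?thesis
    using simultaneous_unbounded[OF \<theta>(2)]
    by (intro onto_plus_plus_from_unbounded[OF \<theta>(1) \<kappa> \<theta>(2) order_refl \<kappa> ideal
          not_weakly_saturated[OF False \<theta>] ideal bounded, where c = "accumulate c"])
qed

end

section \<open>Ideals over a stationary set, lifted to \<kappa>\<close>

lemma mem_ideal_lift:
  assumes "ideal_over S J"
  shows "X \<in> ideal_lift \<kappa> S J \<longleftrightarrow> X - S \<subseteq> {..<\<kappa>} \<and> X \<inter> S \<in> J"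
proof
  assume "X \<in> ideal_lift \<kappa> S J"
  then obtain A B where AB: "X = A \<union> B" "A \<in> J" "B \<subseteq> {..<\<kappa>} - S" unfolding ideal_lift_def by blast
  then have "A \<subseteq> S" using assms by (auto simp: ideal_over_def)
  then have "X \<inter> S = A" using AB by blast
  then show "X - S \<subseteq> {..<\<kappa>} \<and> X \<inter> S \<in> J" using AB \<open>A \<subseteq> S\<close> by auto
next
  assume *: "X - S \<subseteq> {..<\<kappa>} \<and> X \<inter> S \<in> J"
  then have "X = (X \<inter> S) \<union> (X - S) \<and> X \<inter> S \<in> J \<and> X - S \<subseteq> {..<\<kappa>} - S" by blast
  then show "X \<in> ideal_lift \<kappa> S J" unfolding ideal_lift_def by blast
qed

lemma ideal_over_lift:
  assumes J: "ideal_over S J" and S: "S \<subseteq> {..<\<kappa>}"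
  shows "ideal_over {..<\<kappa>} (ideal_lift \<kappa> S J)"
proof -
  note mem = mem_ideal_lift[OF J, of _ \<kappa>]
  have "A \<union> B \<in> ideal_lift \<kappa> S J" if "A \<in> ideal_lift \<kappa> S J" "B \<in> ideal_lift \<kappa> S J" for A B
    using that ideal_Un[OF J] unfolding mem by (auto simp: Int_Un_distrib2)
  moreover have "B \<in> ideal_lift \<kappa> S J" if "A \<in> ideal_lift \<kappa> S J" "B \<subseteq> A" for A B
  proof -
    have "B \<inter> S \<in> J" using that ideal_subset[OF J, of "A \<inter> S" "B \<inter> S"] unfolding mem by blast
    then show ?thesis using that unfolding mem by blast
  qed
  moreover have "{} \<in> J" using J by (simp add: ideal_over_def)
  then have "{} \<in> ideal_lift \<kappa> S J" unfolding mem by simp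
  moreover have "ideal_lift \<kappa> S J \<subseteq> Pow {..<\<kappa>}" using S mem by blast
  ultimately show ?thesis unfolding ideal_over_def by blast
qed

lemma stationary_unbounded:
  assumes \<kappa>: "infinite_regular_cardinal \<kappa>" and S: "stationary \<kappa> S" and \<gamma>: "\<gamma> < \<kappa>"
  shows "\<exists>x\<in>S. \<gamma> < x"
proof -
  have "club \<kappa> {x. \<gamma> < x \<and> x < \<kappa>}"
    unfolding club_def
  proof (intro conjI allI impI)
    fix \<alpha> assume "\<alpha> < \<kappa>"
    then have "max \<alpha> \<gamma> < \<kappa>" using \<gamma> by simp
    then show "\<exists>x\<in>{x. \<gamma> < x \<and> x < \<kappa>}. \<alpha> < x" using no_max_below[OF \<kappa>] by fastforce
  next
    fix \<delta> assume "\<delta> < \<kappa>" "{..<\<delta>} \<noteq> {} \<and> (\<forall>\<alpha><\<delta>. \<exists>x\<in>{x. \<gamma> < x \<and> x < \<kappa>}. \<alpha> < x \<and> x < \<delta>)"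
    then show "\<delta> \<in> {x. \<gamma> < x \<and> x < \<kappa>}" by fastforce
  qed auto
  then show ?thesis using S unfolding stationary_def by blast
qed

lemma lift_contains_bounded:
  assumes \<kappa>: "infinite_regular_cardinal \<kappa>" and S: "stationary \<kappa> S"
    and J: "ideal_over S J" "bounded_ideal S \<subseteq> J" and \<gamma>: "\<gamma> < \<kappa>"
  shows "{..\<gamma>} \<in> ideal_lift \<kappa> S J"
proof -
  obtain x where "x \<in> S" "\<gamma> < x" using stationary_unbounded[OF \<kappa> S \<gamma>] by blast
  then have "{..\<gamma>} \<inter> S \<in> bounded_ideal S"
    unfolding bounded_ideal_def by (auto intro!: bexI[of _ x] dest: le_less_trans)
  then have "{..\<gamma>} \<inter> S \<in> J" using J(2) by blast
  then show ?thesis using \<gamma> unfolding mem_ideal_lift[OF J(1)] by auto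
qed

text \<open>Let \<open>nx \<eta>\<close> be an element of the club C above \<eta>. A point \<beta> >
  0 outside C is not a limit of C, so \<open>nx \<eta> \<ge> \<beta>\<close> for some \<eta> <
  \<beta>; such points lie in the diagonal union of the bounded sets
  \<open>{..nx \<eta>}\<close>.\<close>

lemma normal_contains_nonstationary:
  fixes \<kappa> :: "'a::wellorder"
  assumes J: "ideal_over {..<\<kappa>} J" "normal_ideal \<kappa> J" "\<And>\<gamma>. \<gamma> < \<kappa> \<Longrightarrow> {..\<gamma>} \<in> J"
    and A: "A \<in> NS \<kappa>"
  shows "A \<in> J"
proof -
  have A\<kappa>: "A \<subseteq> {..<\<kappa>}" using A by (simp add: NS_def)
  obtain C where C: "club \<kappa> C" "A \<inter> C = {}" using A by (auto simp: NS_def stationary_def)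
  have "\<forall>\<eta>\<in>{..<\<kappa>}. \<exists>\<gamma>. \<gamma> \<in> C \<and> \<eta> < \<gamma>" using C(1) by (auto simp: club_def)
  from bchoice[OF this] obtain nx where nx: "\<forall>\<eta>\<in>{..<\<kappa>}. nx \<eta> \<in> C \<and> \<eta> < nx \<eta>" ..
  have nx\<kappa>: "nx \<eta> < \<kappa>" if "\<eta> < \<kappa>" for \<eta> using nx that C(1) by (auto simp: club_def)
  let ?U = "{\<beta>. \<beta> < \<kappa> \<and> (\<exists>\<eta><\<beta>. \<beta> \<in> {..nx \<eta>})}"
  have U: "?U \<in> J" by (rule normal_diagonal_union[OF J(1,2)]) (use J(3) nx\<kappa> in blast)
  have empty: "{} \<in> J" using J(1) by (simp add: ideal_over_def)
  show ?thesis
  proof (cases "A = {}")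
    case False
    then obtain x where x: "x \<in> A" by blast
    let ?z = "LEAST x::'a. True"
    have zle: "?z \<le> y" for y by (rule Least_le) simp
    have z\<kappa>: "?z < \<kappa>" using zle[of x] x A\<kappa> by (auto intro: le_less_trans)
    \<comment> \<open>The set \<open>{..?z}\<close> accounts for the point 0, which has no \<eta>
      below it and so escapes the diagonal union.\<close>
    have "A \<subseteq> ?U \<union> {..?z}"
    proof
      fix \<beta> assume \<beta>: "\<beta> \<in> A"
      then have \<beta>\<kappa>: "\<beta> < \<kappa>" using A\<kappa> by auto
      show "\<beta> \<in> ?U \<union> {..?z}"
      proof (rule ccontr)
        assume neg: "\<beta> \<notin> ?U \<union> {..?z}"
        then have "?z < \<beta>" by auto
        then have ne: "{..<\<beta>} \<noteq> {}" by blast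
        have "\<exists>\<gamma>\<in>C. \<alpha> < \<gamma> \<and> \<gamma> < \<beta>" if "\<alpha> < \<beta>" for \<alpha>
        proof -
          have "nx \<alpha> < \<beta>" using neg \<beta>\<kappa> that by (auto simp: not_le)
          then show ?thesis using nx that \<beta>\<kappa> by (meson lessThan_iff less_trans)
        qed
        then have "\<beta> \<in> C" using C(1) \<beta>\<kappa> ne unfolding club_def by blast
        then show False using C(2) \<beta> by blast
      qed
    qed
    then show ?thesis using ideal_subset[OF J(1) ideal_Un[OF J(1) U J(3)[OF z\<kappa>]]] by blast
  qed (use empty in simp)
qed

lemma ubd_imp_onto_plus_plus:
  fixes \<theta> \<kappa> :: "'a::wellorder"
  assumes \<theta>: "infinite_regular_cardinal \<theta>" "\<theta> < \<kappa>" and \<kappa>: "infinite_regular_cardinal \<kappa>"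
    and S: "stationary \<kappa> S" and u: "ubd \<kappa> (ideal_lift \<kappa> S (NS \<kappa> \<inter> Pow S)) \<kappa>"
    and J: "ideal_over S J" "normal_ideal \<kappa> (ideal_lift \<kappa> S J)" "bounded_ideal S \<subseteq> J"
  shows "onto_plus_plus \<kappa> (dual_filter \<kappa> (ideal_lift \<kappa> S J)) (ideal_lift \<kappa> S J) \<theta>"
proof -
  have S\<kappa>: "S \<subseteq> {..<\<kappa>}" using S by (simp add: stationary_def)
  note ideal = ideal_over_lift[OF J(1) S\<kappa>]
  note bounded = lift_contains_bounded[OF \<kappa> S J(1,3)]
  obtain c where c: "upper_regressive \<kappa> c" "\<And>B. B \<in> positive \<kappa> (ideal_lift \<kappa> S (NS \<kappa> \<inter> Pow S)) \<Longrightarrow>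
      \<exists>\<eta><\<kappa>. has_otp {c \<eta> \<beta> | \<beta>. \<beta> \<in> B \<and> \<eta> < \<beta>} \<kappa>" using u unfolding ubd_def by blast
  have sub: "ideal_lift \<kappa> S (NS \<kappa> \<inter> Pow S) \<subseteq> ideal_lift \<kappa> S J"
  proof
    fix X assume "X \<in> ideal_lift \<kappa> S (NS \<kappa> \<inter> Pow S)"
    then obtain A B where AB: "X = A \<union> B" "A \<in> NS \<kappa>" "A \<subseteq> S" "B \<subseteq> {..<\<kappa>} - S"
      unfolding ideal_lift_def by blast
    have "A \<in> ideal_lift \<kappa> S J" by (rule normal_contains_nonstationary[OF ideal J(2) bounded AB(2)])
    then have "A \<inter> S \<in> J" using mem_ideal_lift[OF J(1)] by blast
    then have "A \<in> J" using AB(3) by (simp add: Int_absorb2)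
    then show "X \<in> ideal_lift \<kappa> S J" unfolding ideal_lift_def using AB by blast
  qed
  interpret normal_colouring \<kappa> "ideal_lift \<kappa> S J" c
    using \<kappa> ideal bounded J(2) c sub by unfold_locales (auto simp: positive_def)
  show ?thesis by (rule onto_plus_plus_normal[OF \<theta>])
qed

theorem theorem6p10:
  fixes \<theta> \<mu> \<kappa> :: "'a::wellorder" and I :: "'a set set" and S :: "'a set"
  assumes "infinite_regular_cardinal \<theta>"
    and "infinite_regular_cardinal \<mu>"
    and "infinite_regular_cardinal \<kappa>"
    and "\<theta> < \<mu>" and "\<mu> \<le> \<kappa>"
    and "ideal_over {..<\<kappa>} I" and "\<not> weakly_saturated \<kappa> I"
    and "stationary \<kappa> S"
  shows "(\<forall>J. ideal_over {..<\<kappa>} J \<and> complete_ideal (cardSuc (le_on {..<\<theta>})) J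
              \<and> bounded_ideal {..<\<kappa>} \<subseteq> J \<and> ubd_plus \<kappa> (positive \<kappa> J) J \<mu>
            \<longrightarrow> onto_plus_plus \<kappa> (dual_filter \<kappa> I) J \<theta>)
       \<and> (ubd \<kappa> (ideal_lift \<kappa> S (NS \<kappa> \<inter> Pow S)) \<kappa>
            \<longrightarrow> (\<forall>J. ideal_over S J \<and> normal_ideal \<kappa> (ideal_lift \<kappa> S J) \<and> bounded_ideal S \<subseteq> J
                   \<longrightarrow> onto_plus_plus \<kappa> (dual_filter \<kappa> (ideal_lift \<kappa> S J)) (ideal_lift \<kappa> S J) \<theta>))"
proof (intro conjI allI impI; elim conjE)
  fix J
  assume "ideal_over {..<\<kappa>} J" "complete_ideal (cardSuc (le_on {..<\<theta>})) J"
    "bounded_ideal {..<\<kappa>} \<subseteq> J" "ubd_plus \<kappa> (positive \<kappa> J) J \<mu>"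
  then show "onto_plus_plus \<kappa> (dual_filter \<kappa> I) J \<theta>"
    by (rule ubd_plus_imp_onto_plus_plus[OF assms(1,2,4,5,3,6,7)])
next
  fix J
  assume "ubd \<kappa> (ideal_lift \<kappa> S (NS \<kappa> \<inter> Pow S)) \<kappa>"
    and "ideal_over S J" "normal_ideal \<kappa> (ideal_lift \<kappa> S J)" "bounded_ideal S \<subseteq> J"
  then show "onto_plus_plus \<kappa> (dual_filter \<kappa> (ideal_lift \<kappa> S J)) (ideal_lift \<kappa> S J) \<theta>"
    by (rule ubd_imp_onto_plus_plus[OF assms(1) less_le_trans[OF assms(4,5)] assms(3,8)])
qed

end
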